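(* Let $\mathcal{Q}$ be a small quantaloid. Then $\mathcal{M}_{\mathrm{b}}:\mathbf{B}(\mathcal{Q}\text{-}\mathbf{Dist})^{\mathrm{op}}\to\mathcal{Q}\text{-}\mathbf{CCat}$ is an equivalence of quantaloids; hence, $\mathbf{B}(\mathcal{Q}\text{-}\mathbf{Dist})$ and $\mathcal{Q}\text{-}\mathbf{CCat}$ are dually equivalent quantaloids.
   Context: A quantaloid is a category whose hom-sets are complete lattices and whose composition preserves arbitrary joins in each variable. A quantaloid homomorphism is a functor preserving joins of arrows; it is an equivalence of quantaloids if its underlying functor is an equivalence of categories. For arrows $f:X\to Y$, $g:Y\to Z$, $h:X\to Z$ the implications $h\swarrow f:Y\to Z$ and $g\searrow h:X\to Y$ are determined by $g\circ f\leq h\iff g\leq h\swarrow f\iff f\leq g\searrow h$. $\mathcal{C}^{\mathrm{op}}$ is the opposite category with the same order on hom-sets; $\mathcal{C}$ and $\mathcal{D}$ are dually equivalent if $\mathcal{C}^{\mathrm{op}}$ and $\mathcal{D}$ are equivalent as quantaloids. For a quantaloid $\mathcal{C}$, a Chu connection from $f:X_1\to Y_1$ to $g:X_2\to Y_2$ is a pair of arrows $(u:X_1\to X_2,\ v:Y_1\to Y_2)$ with $f\swarrow u=v\searrow g$. Arrows of $\mathcal{C}$ and Chu connections, with componentwise composition, identities $(1_X,1_Y)$, order and joins, form the quantaloid $\mathbf{ChuCon}(\mathcal{C})$. For Chu connections $(u,v),(u',v'):f\to g$ write $(u,v)\sim(u',v')$ if $f\swarrow u=f\swarrow u'$ (equivalently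 $v\searrow g=v'\searrow g$). This is a congruence (compatible with composition and joins), and $\mathbf{B}(\mathcal{C}):=\mathbf{ChuCon}(\mathcal{C})/\!\sim$ is the quotient quantaloid (same objects, equivalence classes as arrows, induced compositions and joins), called the quantaloid of back diagonals in $\mathcal{C}$. A $\mathcal{Q}$-category $\mathbb{A}$ is a set $\mathbb{A}_0$ with a type map $t:\mathbb{A}_0\to\mathrm{ob}\,\mathcal{Q}$ and hom-arrows $\mathbb{A}(x,y)\in\mathcal{Q}(tx,ty)$ with $1_{tx}\leq\mathbb{A}(x,x)$ and $\mathbb{A}(y,z)\circ\mathbb{A}(x,y)\leq\mathbb{A}(x,z)$. Its underlying preorder is: $x\leq y$ iff $tx=ty$ and $1_{tx}\leq\mathbb{A}(x,y)$; $\mathbb{A}$ is skeletal if this is a partial order. A $\mathcal{Q}$-functor $F:\mathbb{A}\to\mathbb{B}$ is a type-preserving map with $\mathbb{A}(x,y)\leq\mathbb{B}(Fx,Fy)$; $\mathcal{Q}$-functors are ordered pointwise, giving the locally ordered 2-category $\mathcal{Q}\text{-}\mathbf{Cat}$, in which adjunctions are taken. A $\mathcal{Q}$-distributor $\phi$ from $\mathbb{A}$ to $\mathbb{B}$ assigns to each $(x,y)\in\mathbb{A}_0\times\mathbb{B}_0$ an arrow $\phi(x,y)\in\mathcal{Q}(tx,ty)$ with $\mathbb{B}(y,y')\circ\phi(x,y)\circ\mathbb{A}(x',x)\leq\phi(x',y')$. With $(\psi\circ\phi)(x,z)=\bigvee_{y}\psi(y,z)\circ\phi(x,y)$, identities $\mathbb{A}$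 and the pointwise order, these form a quantaloid $\mathcal{Q}\text{-}\mathbf{Dist}$. For $X\in\mathrm{ob}\,\mathcal{Q}$, $*_X$ is the $\mathcal{Q}$-category with one object, of type $X$, and hom-arrow $1_X$. $\mathcal{P}\mathbb{A}$ has as objects of type $X$ the $\mathcal{Q}$-distributors $\mu$ from $\mathbb{A}$ to $*_X$, with $\mathcal{P}\mathbb{A}(\mu,\mu')=\mu'\swarrow\mu$; $\mathcal{P}^{\dagger}\mathbb{A}$ has as objects of type $X$ the $\mathcal{Q}$-distributors $\lambda$ from $*_X$ to $\mathbb{A}$, with $\mathcal{P}^{\dagger}\mathbb{A}(\lambda,\lambda')=\lambda'\searrow\lambda$. $\mathbb{A}$ is complete if the Yoneda embedding $\mathbb{A}\to\mathcal{P}\mathbb{A}$, $x\mapsto\mathbb{A}(-,x)$, has a left adjoint in $\mathcal{Q}\text{-}\mathbf{Cat}$. $\mathcal{Q}\text{-}\mathbf{CCat}$ is the quantaloid of skeletal complete $\mathcal{Q}$-categories and left adjoint $\mathcal{Q}$-functors, with the pointwise order. Each $\mathcal{Q}$-distributor $\phi$ from $\mathbb{A}$ to $\mathbb{B}$ induces an adjunction $\phi_{\uparrow}\dashv\phi^{\downarrow}$ with $\phi_{\uparrow}:\mathcal{P}\mathbb{A}\to\mathcal{P}^{\dagger}\mathbb{B}$, $\mu\mapsto\phi\swarrow\mu$, and $\phi^{\downarrow}:\mathcal{P}^{\dagger}\mathbb{B}\to\mathcal{P}\mathbb{A}$, $\lambda\mapsto\lambda\searrow\phi$. $\mathcal{M}\phi$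 is the full $\mathcal{Q}$-subcategory of $\mathcal{P}\mathbb{A}$ on those $\mu$ with $\phi^{\downarrow}\phi_{\uparrow}\mu=\mu$; it is a skeletal complete $\mathcal{Q}$-category. For a Chu connection $(\zeta,\eta)$ in $\mathcal{Q}\text{-}\mathbf{Dist}$ from $\phi$ (from $\mathbb{A}$ to $\mathbb{B}$) to $\psi$ (from $\mathbb{A}'$ to $\mathbb{B}'$), $\mathcal{M}(\zeta,\eta):\mathcal{M}\psi\to\mathcal{M}\phi$ is the left adjoint $\mathcal{Q}$-functor $\mu'\mapsto\phi^{\downarrow}\phi_{\uparrow}(\mu'\circ\zeta)$. This gives a quantaloid homomorphism $\mathcal{M}:\mathbf{ChuCon}(\mathcal{Q}\text{-}\mathbf{Dist})^{\mathrm{op}}\to\mathcal{Q}\text{-}\mathbf{CCat}$ that identifies $\sim$-equivalent Chu connections; $\mathcal{M}_{\mathrm{b}}:\mathbf{B}(\mathcal{Q}\text{-}\mathbf{Dist})^{\mathrm{op}}\to\mathcal{Q}\text{-}\mathbf{CCat}$ is the unique quantaloid homomorphism through which $\mathcal{M}$ factors along the quotient homomorphism, i.e. $\phi\mapsto\mathcal{M}\phi$ and $[(\zeta,\eta)]\mapsto\mathcal{M}(\zeta,\eta)$. *)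

theory Defs
  imports "HOL-Algebra.Complete_Lattice" "HOL-Library.FuncSet"
begin

unbundle cardinal_syntax

section \<open>Quantaloids\<close>

text \<open>
  Hom-sets need not be disjoint, so composition, order and the action of functors on arrows are
  indexed by the objects involved: for \<open>f : X \<rightarrow> Y\<close> and \<open>g : Y \<rightarrow> Z\<close>, the composite
  \<open>g \<circ> f\<close> is \<open>Comp C X Y Z g f\<close>.
\<close>

record ('o, 'a) quant =
  Ob :: "'o set"
  Hom :: "'o \<Rightarrow> 'o \<Rightarrow> 'a set"
  Comp :: "'o \<Rightarrow> 'o \<Rightarrow> 'o \<Rightarrow> 'a \<Rightarrow> 'a \<Rightarrow> 'a"
  Ident :: "'o \<Rightarrow> 'a"
  Leq :: "'o \<Rightarrow> 'o \<Rightarrow> 'a \<Rightarrow> 'a \<Rightarrow> bool"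

definition hom_order :: "('o, 'a) quant \<Rightarrow> 'o \<Rightarrow> 'o \<Rightarrow> 'a gorder" where
  "hom_order C X Y = \<lparr>carrier = Hom C X Y, eq = (=), le = Leq C X Y\<rparr>"

locale quantaloid =
  fixes C :: "('o, 'a) quant"
  assumes ident_in: "X \<in> Ob C \<Longrightarrow> Ident C X \<in> Hom C X X"
    and comp_in: "\<lbrakk>X \<in> Ob C; Y \<in> Ob C; Z \<in> Ob C; f \<in> Hom C X Y; g \<in> Hom C Y Z\<rbrakk>
      \<Longrightarrow> Comp C X Y Z g f \<in> Hom C X Z"
    and comp_assoc: "\<lbrakk>W \<in> Ob C; X \<in> Ob C; Y \<in> Ob C; Z \<in> Ob C;
        f \<in> Hom C W X; g \<in> Hom C X Y; h \<in> Hom C Y Z\<rbrakk>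
      \<Longrightarrow> Comp C W Y Z h (Comp C W X Y g f) = Comp C W X Z (Comp C X Y Z h g) f"
    and comp_ident_right: "\<lbrakk>X \<in> Ob C; Y \<in> Ob C; f \<in> Hom C X Y\<rbrakk>
      \<Longrightarrow> Comp C X X Y f (Ident C X) = f"
    and comp_ident_left: "\<lbrakk>X \<in> Ob C; Y \<in> Ob C; f \<in> Hom C X Y\<rbrakk>
      \<Longrightarrow> Comp C X Y Y (Ident C Y) f = f"
    and hom_complete_lattice: "\<lbrakk>X \<in> Ob C; Y \<in> Ob C\<rbrakk> \<Longrightarrow> complete_lattice (hom_order C X Y)"
    and comp_sup_right: "\<lbrakk>X \<in> Ob C; Y \<in> Ob C; Z \<in> Ob C; S \<subseteq> Hom C X Y; g \<in> Hom C Y Z\<rbrakk>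
      \<Longrightarrow> Comp C X Y Z g (\<Squnion>\<^bsub>hom_order C X Y\<^esub> S)
        = \<Squnion>\<^bsub>hom_order C X Z\<^esub> ((\<lambda>f. Comp C X Y Z g f) ` S)"
    and comp_sup_left: "\<lbrakk>X \<in> Ob C; Y \<in> Ob C; Z \<in> Ob C; f \<in> Hom C X Y; S \<subseteq> Hom C Y Z\<rbrakk>
      \<Longrightarrow> Comp C X Y Z (\<Squnion>\<^bsub>hom_order C Y Z\<^esub> S) f
        = \<Squnion>\<^bsub>hom_order C X Z\<^esub> ((\<lambda>g. Comp C X Y Z g f) ` S)"

text \<open>For \<open>f : X \<rightarrow> Y\<close> and \<open>h : X \<rightarrow> Z\<close>, the arrow \<open>h \<swarrow> f : Y \<rightarrow> Z\<close>.\<close>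

definition limp :: "('o, 'a) quant \<Rightarrow> 'o \<Rightarrow> 'o \<Rightarrow> 'o \<Rightarrow> 'a \<Rightarrow> 'a \<Rightarrow> 'a" where
  "limp C X Y Z h f = (THE k. k \<in> Hom C Y Z \<and>
     (\<forall>g\<in>Hom C Y Z. Leq C X Z (Comp C X Y Z g f) h \<longleftrightarrow> Leq C Y Z g k))"

text \<open>For \<open>g : Y \<rightarrow> Z\<close> and \<open>h : X \<rightarrow> Z\<close>, the arrow \<open>g \<searrow> h : X \<rightarrow> Y\<close>.\<close>

definition rimp :: "('o, 'a) quant \<Rightarrow> 'o \<Rightarrow> 'o \<Rightarrow> 'o \<Rightarrow> 'a \<Rightarrow> 'a \<Rightarrow> 'a" where
  "rimp C X Y Z g h = (THE k. k \<in> Hom C X Y \<and>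
     (\<forall>f\<in>Hom C X Y. Leq C X Z (Comp C X Y Z g f) h \<longleftrightarrow> Leq C X Y f k))"

definition op_quant :: "('o, 'a) quant \<Rightarrow> ('o, 'a) quant" where
  "op_quant C = \<lparr>Ob = Ob C,
     Hom = (\<lambda>X Y. Hom C Y X),
     Comp = (\<lambda>X Y Z g f. Comp C Z Y X f g),
     Ident = Ident C,
     Leq = (\<lambda>X Y. Leq C Y X)\<rparr>"

section \<open>Homomorphisms and equivalences\<close>

definition is_functor ::
  "('o, 'a) quant \<Rightarrow> ('p, 'b) quant \<Rightarrow> ('o \<Rightarrow> 'p) \<Rightarrow> ('o \<Rightarrow> 'o \<Rightarrow> 'a \<Rightarrow> 'b) \<Rightarrow> bool" where
  "is_functor C D Fo Fa \<longleftrightarrow>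
     Fo \<in> Ob C \<rightarrow> Ob D \<and>
     (\<forall>X\<in>Ob C. \<forall>Y\<in>Ob C. Fa X Y \<in> Hom C X Y \<rightarrow> Hom D (Fo X) (Fo Y)) \<and>
     (\<forall>X\<in>Ob C. Fa X X (Ident C X) = Ident D (Fo X)) \<and>
     (\<forall>X\<in>Ob C. \<forall>Y\<in>Ob C. \<forall>Z\<in>Ob C. \<forall>f\<in>Hom C X Y. \<forall>g\<in>Hom C Y Z.
        Fa X Z (Comp C X Y Z g f) = Comp D (Fo X) (Fo Y) (Fo Z) (Fa Y Z g) (Fa X Y f))"

definition is_iso :: "('o, 'a) quant \<Rightarrow> 'o \<Rightarrow> 'o \<Rightarrow> 'a \<Rightarrow> bool" where
  "is_iso C X Y f \<longleftrightarrow> f \<in> Hom C X Y \<and>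
     (\<exists>g\<in>Hom C Y X. Comp C X Y X g f = Ident C X \<and> Comp C Y X Y f g = Ident C Y)"

definition naturally_isomorphic ::
  "('o, 'a) quant \<Rightarrow> ('p, 'b) quant \<Rightarrow> ('o \<Rightarrow> 'p) \<Rightarrow> ('o \<Rightarrow> 'o \<Rightarrow> 'a \<Rightarrow> 'b)
    \<Rightarrow> ('o \<Rightarrow> 'p) \<Rightarrow> ('o \<Rightarrow> 'o \<Rightarrow> 'a \<Rightarrow> 'b) \<Rightarrow> bool" where
  "naturally_isomorphic C D Fo Fa Go Ga \<longleftrightarrow>
     (\<exists>\<alpha>. (\<forall>X\<in>Ob C. is_iso D (Fo X) (Go X) (\<alpha> X)) \<and>
       (\<forall>X\<in>Ob C. \<forall>Y\<in>Ob C. \<forall>f\<in>Hom C X Y.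
          Comp D (Fo X) (Fo Y) (Go Y) (\<alpha> Y) (Fa X Y f)
        = Comp D (Fo X) (Go X) (Go Y) (Ga X Y f) (\<alpha> X)))"

definition category_equivalence ::
  "('o, 'a) quant \<Rightarrow> ('p, 'b) quant \<Rightarrow> ('o \<Rightarrow> 'p) \<Rightarrow> ('o \<Rightarrow> 'o \<Rightarrow> 'a \<Rightarrow> 'b) \<Rightarrow> bool" where
  "category_equivalence C D Fo Fa \<longleftrightarrow> is_functor C D Fo Fa \<and>
     (\<exists>Go Ga. is_functor D C Go Ga \<and>
        naturally_isomorphic C C (\<lambda>X. X) (\<lambda>X Y f. f)
          (\<lambda>X. Go (Fo X)) (\<lambda>X Y f. Ga (Fo X) (Fo Y) (Fa X Y f)) \<and>
        naturally_isomorphic D D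
          (\<lambda>X. Fo (Go X)) (\<lambda>X Y f. Fa (Go X) (Go Y) (Ga X Y f)) (\<lambda>X. X) (\<lambda>X Y f. f))"

definition quantaloid_hom ::
  "('o, 'a) quant \<Rightarrow> ('p, 'b) quant \<Rightarrow> ('o \<Rightarrow> 'p) \<Rightarrow> ('o \<Rightarrow> 'o \<Rightarrow> 'a \<Rightarrow> 'b) \<Rightarrow> bool" where
  "quantaloid_hom C D Fo Fa \<longleftrightarrow> quantaloid C \<and> quantaloid D \<and> is_functor C D Fo Fa \<and>
     (\<forall>X\<in>Ob C. \<forall>Y\<in>Ob C. \<forall>S. S \<subseteq> Hom C X Y \<longrightarrow>
        Fa X Y (\<Squnion>\<^bsub>hom_order C X Y\<^esub> S) = \<Squnion>\<^bsub>hom_order D (Fo X) (Fo Y)\<^esub> (Fa X Y ` S))"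

definition quantaloid_equivalence ::
  "('o, 'a) quant \<Rightarrow> ('p, 'b) quant \<Rightarrow> ('o \<Rightarrow> 'p) \<Rightarrow> ('o \<Rightarrow> 'o \<Rightarrow> 'a \<Rightarrow> 'b) \<Rightarrow> bool" where
  "quantaloid_equivalence C D Fo Fa \<longleftrightarrow>
     quantaloid_hom C D Fo Fa \<and> category_equivalence C D Fo Fa"

definition equivalent_quantaloids :: "('o, 'a) quant \<Rightarrow> ('p, 'b) quant \<Rightarrow> bool" where
  "equivalent_quantaloids C D \<longleftrightarrow> (\<exists>Fo Fa. quantaloid_equivalence C D Fo Fa)"

definition dually_equivalent :: "('o, 'a) quant \<Rightarrow> ('p, 'b) quant \<Rightarrow> bool" where
  "dually_equivalent C D \<longleftrightarrow> equivalent_quantaloids (op_quant C) D"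

section \<open>Chu connections and back diagonals\<close>

text \<open>An arrow of \<open>C\<close> is a triple \<open>(X, Y, f)\<close> with \<open>f : X \<rightarrow> Y\<close>.\<close>

type_synonym ('o, 'a) arr = "'o \<times> 'o \<times> 'a"

definition arrows :: "('o, 'a) quant \<Rightarrow> ('o, 'a) arr set" where
  "arrows C = (SIGMA X : Ob C. SIGMA Y : Ob C. Hom C X Y)"

definition ChuCon :: "('o, 'a) quant \<Rightarrow> (('o, 'a) arr, 'a \<times> 'a) quant" where
  "ChuCon C = \<lparr>Ob = arrows C,
     Hom = (\<lambda>(X1, Y1, f) (X2, Y2, g). {(u, v). u \<in> Hom C X1 X2 \<and> v \<in> Hom C Y1 Y2 \<and>
       limp C X1 X2 Y1 f u = rimp C X2 Y1 Y2 v g}),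
     Comp = (\<lambda>(X1, Y1, f) (X2, Y2, g) (X3, Y3, h) (u', v') (u, v).
       (Comp C X1 X2 X3 u' u, Comp C Y1 Y2 Y3 v' v)),
     Ident = (\<lambda>(X, Y, f). (Ident C X, Ident C Y)),
     Leq = (\<lambda>(X1, Y1, f) (X2, Y2, g) (u, v) (u', v'). Leq C X1 X2 u u' \<and> Leq C Y1 Y2 v v')\<rparr>"

text \<open>
  The quotient of \<open>C\<close> by a congruence \<open>R\<close>. For a congruence the unions below are single classes.
  The order is the one determined by the induced joins: \<open>[f] \<le> [g]\<close> iff \<open>[f \<squnion> g] = [g]\<close>.
\<close>

definition quotient_quant ::
  "('o, 'a) quant \<Rightarrow> ('o \<Rightarrow> 'o \<Rightarrow> ('a \<times> 'a) set) \<Rightarrow> ('o, 'a set) quant" where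
  "quotient_quant C R = \<lparr>Ob = Ob C,
     Hom = (\<lambda>X Y. Hom C X Y // R X Y),
     Comp = (\<lambda>X Y Z G F. \<Union>g\<in>G. \<Union>f\<in>F. R X Z `` {Comp C X Y Z g f}),
     Ident = (\<lambda>X. R X X `` {Ident C X}),
     Leq = (\<lambda>X Y F G. \<exists>f\<in>F. \<exists>g\<in>G. f \<squnion>\<^bsub>hom_order C X Y\<^esub> g \<in> G)\<rparr>"

definition back_cong ::
  "('o, 'a) quant \<Rightarrow> ('o, 'a) arr \<Rightarrow> ('o, 'a) arr \<Rightarrow> (('a \<times> 'a) \<times> ('a \<times> 'a)) set" where
  "back_cong C = (\<lambda>(X1, Y1, f) (X2, Y2, g). {((u, v), (u', v')).
     (u, v) \<in> Hom (ChuCon C) (X1, Y1, f) (X2, Y2, g) \<and>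
     (u', v') \<in> Hom (ChuCon C) (X1, Y1, f) (X2, Y2, g) \<and>
     limp C X1 X2 Y1 f u = limp C X1 X2 Y1 f u'})"

definition back_diagonals :: "('o, 'a) quant \<Rightarrow> (('o, 'a) arr, ('a \<times> 'a) set) quant" where
  "back_diagonals C = quotient_quant (ChuCon C) (back_cong C)"

section \<open>Smallness\<close>

text \<open>
  The universe of small sets is rendered by a cardinal \<open>\<kappa>\<close>: a set, over any type, is small if it has
  fewer than \<open>\<kappa>\<close> elements. Intended is an arbitrary strong limit cardinal \<open>\<kappa>\<close> (every Grothendieck universe
  provides one). The carriers of the objects of \<open>QDist \<kappa> Q\<close> and \<open>QCCat \<kappa> Q\<close> below are the small subsets of a
  type that may differ between the two; only the cardinal \<open>\<kappa>\<close> is shared.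
\<close>

definition small :: "'k rel \<Rightarrow> 'x set \<Rightarrow> bool" where
  "small \<kappa> S \<longleftrightarrow> |S| <o \<kappa>"

definition small_quantaloid :: "'k rel \<Rightarrow> ('o, 'a) quant \<Rightarrow> bool" where
  "small_quantaloid \<kappa> Q \<longleftrightarrow> quantaloid Q \<and> small \<kappa> (Ob Q) \<and> small \<kappa> (arrows Q)"

section \<open>Enriched categories, functors and distributors\<close>

text \<open>
  Functions on carriers are extensional (\<open>undefined\<close> outside their domain), so that the
  HOL equality of \<open>\<Q>\<close>-categories, \<open>\<Q>\<close>-functors and \<open>\<Q>\<close>-distributors is the intended one.
\<close>

record ('x, 'o, 'a) qcat =
  obj :: "'x set"
  ty :: "'x \<Rightarrow> 'o"
  qhom :: "'x \<times> 'x \<Rightarrow> 'a"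

definition qcategory :: "('o, 'a) quant \<Rightarrow> ('x, 'o, 'a) qcat \<Rightarrow> bool" where
  "qcategory Q A \<longleftrightarrow>
     ty A \<in> obj A \<rightarrow>\<^sub>E Ob Q \<and>
     qhom A \<in> (\<Pi>\<^sub>E (x, y)\<in>obj A \<times> obj A. Hom Q (ty A x) (ty A y)) \<and>
     (\<forall>x\<in>obj A. Leq Q (ty A x) (ty A x) (Ident Q (ty A x)) (qhom A (x, x))) \<and>
     (\<forall>x\<in>obj A. \<forall>y\<in>obj A. \<forall>z\<in>obj A. Leq Q (ty A x) (ty A z)
        (Comp Q (ty A x) (ty A y) (ty A z) (qhom A (y, z)) (qhom A (x, y))) (qhom A (x, z)))"

definition under_le :: "('o, 'a) quant \<Rightarrow> ('x, 'o, 'a) qcat \<Rightarrow> 'x \<Rightarrow> 'x \<Rightarrow> bool" where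
  "under_le Q A x y \<longleftrightarrow>
     ty A x = ty A y \<and> Leq Q (ty A x) (ty A x) (Ident Q (ty A x)) (qhom A (x, y))"

definition skeletal :: "('o, 'a) quant \<Rightarrow> ('x, 'o, 'a) qcat \<Rightarrow> bool" where
  "skeletal Q A \<longleftrightarrow>
     (\<forall>x\<in>obj A. \<forall>y\<in>obj A. under_le Q A x y \<longrightarrow> under_le Q A y x \<longrightarrow> x = y)"

definition qfunctor ::
  "('o, 'a) quant \<Rightarrow> ('x, 'o, 'a) qcat \<Rightarrow> ('y, 'o, 'a) qcat \<Rightarrow> ('x \<Rightarrow> 'y) \<Rightarrow> bool" where
  "qfunctor Q A B F \<longleftrightarrow>
     F \<in> obj A \<rightarrow>\<^sub>E obj B \<and>
     (\<forall>x\<in>obj A. ty B (F x) = ty A x) \<and>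
     (\<forall>x\<in>obj A. \<forall>y\<in>obj A. Leq Q (ty A x) (ty A y) (qhom A (x, y)) (qhom B (F x, F y)))"

definition qfunctor_le ::
  "('o, 'a) quant \<Rightarrow> ('x, 'o, 'a) qcat \<Rightarrow> ('y, 'o, 'a) qcat \<Rightarrow> ('x \<Rightarrow> 'y) \<Rightarrow> ('x \<Rightarrow> 'y) \<Rightarrow> bool"
  where
  "qfunctor_le Q A B F G \<longleftrightarrow> (\<forall>x\<in>obj A. under_le Q B (F x) (G x))"

definition qadjoint ::
  "('o, 'a) quant \<Rightarrow> ('x, 'o, 'a) qcat \<Rightarrow> ('y, 'o, 'a) qcat \<Rightarrow> ('x \<Rightarrow> 'y) \<Rightarrow> ('y \<Rightarrow> 'x) \<Rightarrow> bool"
  where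
  "qadjoint Q A B F G \<longleftrightarrow> qfunctor Q A B F \<and> qfunctor Q B A G \<and>
     qfunctor_le Q A A (\<lambda>x\<in>obj A. x) (compose (obj A) G F) \<and>
     qfunctor_le Q B B (compose (obj B) F G) (\<lambda>y\<in>obj B. y)"

definition distributors ::
  "('o, 'a) quant \<Rightarrow> ('x, 'o, 'a) qcat \<Rightarrow> ('y, 'o, 'a) qcat \<Rightarrow> ('x \<times> 'y \<Rightarrow> 'a) set" where
  "distributors Q A B =
     {\<phi> \<in> (\<Pi>\<^sub>E (x, y)\<in>obj A \<times> obj B. Hom Q (ty A x) (ty B y)).
        \<forall>x\<in>obj A. \<forall>x'\<in>obj A. \<forall>y\<in>obj B. \<forall>y'\<in>obj B. Leq Q (ty A x') (ty B y')
          (Comp Q (ty A x') (ty B y) (ty B y') (qhom B (y, y'))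
            (Comp Q (ty A x') (ty A x) (ty B y) (\<phi> (x, y)) (qhom A (x', x))))
          (\<phi> (x', y'))}"

definition QDist ::
  "'k rel \<Rightarrow> ('o, 'a) quant \<Rightarrow> (('x, 'o, 'a) qcat, 'x \<times> 'x \<Rightarrow> 'a) quant" where
  "QDist \<kappa> Q = \<lparr>Ob = {A. qcategory Q A \<and> small \<kappa> (obj A)},
     Hom = distributors Q,
     Comp = (\<lambda>A B C \<psi> \<phi>. \<lambda>(x, z)\<in>obj A \<times> obj C. \<Squnion>\<^bsub>hom_order Q (ty A x) (ty C z)\<^esub>
       ((\<lambda>y. Comp Q (ty A x) (ty B y) (ty C z) (\<psi> (y, z)) (\<phi> (x, y))) ` obj B)),
     Ident = qhom,
     Leq = (\<lambda>A B \<phi> \<psi>. \<forall>x\<in>obj A. \<forall>y\<in>obj B. Leq Q (ty A x) (ty B y) (\<phi> (x, y)) (\<psi> (x, y)))\<rparr>"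

section \<open>Presheaves and completeness\<close>

text \<open>
  The unique object of \<open>*\<^sub>X\<close> is an arbitrary fixed element of the carrier type, so that \<open>*\<^sub>X\<close> is an
  object of the same quantaloid as the \<open>\<Q>\<close>-categories it is related to by distributors.
\<close>

definition pt :: 'x where
  "pt = undefined"

definition star :: "('o, 'a) quant \<Rightarrow> 'o \<Rightarrow> ('x, 'o, 'a) qcat" where
  "star Q X = \<lparr>obj = {pt}, ty = (\<lambda>x\<in>{pt}. X), qhom = (\<lambda>p\<in>{pt} \<times> {pt}. Ident Q X)\<rparr>"

text \<open>
  An object \<open>(X, \<mu>)\<close> is a presheaf \<open>\<mu>\<close> together with its type \<open>X\<close>. The distributor
  \<open>\<mu>' \<swarrow> \<mu>\<close> from \<open>*\<^sub>X\<close> to \<open>*\<^sub>X\<^sub>'\<close> is identified with its only component.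
\<close>

type_synonym ('x, 'o, 'a) presheaf = "'o \<times> ('x \<times> 'x \<Rightarrow> 'a)"

definition presheaves ::
  "'k rel \<Rightarrow> ('o, 'a) quant \<Rightarrow> ('x, 'o, 'a) qcat \<Rightarrow> (('x, 'o, 'a) presheaf, 'o, 'a) qcat" where
  "presheaves \<kappa> Q A = (let P = (SIGMA X : Ob Q. Hom (QDist \<kappa> Q) A (star Q X)) in
     \<lparr>obj = P,
      ty = (\<lambda>(X, \<mu>)\<in>P. X),
      qhom = (\<lambda>((X, \<mu>), (X', \<mu>'))\<in>P \<times> P.
        limp (QDist \<kappa> Q) A (star Q X) (star Q X') \<mu>' \<mu> (pt, pt))\<rparr>)"

definition yoneda ::
  "('x, 'o, 'a) qcat \<Rightarrow> 'x \<Rightarrow> ('x, 'o, 'a) presheaf" where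
  "yoneda A = (\<lambda>x\<in>obj A. (ty A x, \<lambda>(z, p)\<in>obj A \<times> {pt}. qhom A (z, x)))"

definition qcomplete :: "'k rel \<Rightarrow> ('o, 'a) quant \<Rightarrow> ('x, 'o, 'a) qcat \<Rightarrow> bool" where
  "qcomplete \<kappa> Q A \<longleftrightarrow> (\<exists>S. qadjoint Q (presheaves \<kappa> Q A) A S (yoneda A))"

definition QCCat ::
  "'k rel \<Rightarrow> ('o, 'a) quant \<Rightarrow> (('x, 'o, 'a) qcat, 'x \<Rightarrow> 'x) quant" where
  "QCCat \<kappa> Q =
     \<lparr>Ob = {A. qcategory Q A \<and> small \<kappa> (obj A) \<and> skeletal Q A \<and> qcomplete \<kappa> Q A},
      Hom = (\<lambda>A B. {F. \<exists>G. qadjoint Q A B F G}),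
      Comp = (\<lambda>A B C G F. compose (obj A) G F),
      Ident = (\<lambda>A. \<lambda>x\<in>obj A. x),
      Leq = qfunctor_le Q\<rparr>"

section \<open>The functor of fixed points\<close>

type_synonym ('x, 'o, 'a) dist = "(('x, 'o, 'a) qcat, 'x \<times> 'x \<Rightarrow> 'a) arr"

definition up_arrow ::
  "'k rel \<Rightarrow> ('o, 'a) quant \<Rightarrow> ('x, 'o, 'a) dist \<Rightarrow> 'o \<times> ('x \<times> 'x \<Rightarrow> 'a) \<Rightarrow> 'o \<times> ('x \<times> 'x \<Rightarrow> 'a)"
  where
  "up_arrow \<kappa> Q = (\<lambda>(A, B, \<phi>) (X, \<mu>). (X, limp (QDist \<kappa> Q) A (star Q X) B \<phi> \<mu>))"

definition down_arrow ::
  "'k rel \<Rightarrow> ('o, 'a) quant \<Rightarrow> ('x, 'o, 'a) dist \<Rightarrow> 'o \<times> ('x \<times> 'x \<Rightarrow> 'a) \<Rightarrow> 'o \<times> ('x \<times> 'x \<Rightarrow> 'a)"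
  where
  "down_arrow \<kappa> Q = (\<lambda>(A, B, \<phi>) (X, \<nu>). (X, rimp (QDist \<kappa> Q) A (star Q X) B \<nu> \<phi>))"

definition full_sub :: "('x, 'o, 'a) qcat \<Rightarrow> 'x set \<Rightarrow> ('x, 'o, 'a) qcat" where
  "full_sub A S = \<lparr>obj = S, ty = restrict (ty A) S, qhom = restrict (qhom A) (S \<times> S)\<rparr>"

definition M_ob ::
  "'k rel \<Rightarrow> ('o, 'a) quant \<Rightarrow> ('x, 'o, 'a) dist \<Rightarrow> (('x, 'o, 'a) presheaf, 'o, 'a) qcat" where
  "M_ob \<kappa> Q = (\<lambda>(A, B, \<phi>). full_sub (presheaves \<kappa> Q A)
     {\<mu> \<in> obj (presheaves \<kappa> Q A). down_arrow \<kappa> Q (A, B, \<phi>) (up_arrow \<kappa> Q (A, B, \<phi>) \<mu>) = \<mu>})"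

text \<open>
  The argument order is that of the opposite quantaloid: a Chu connection \<open>(\<zeta>, \<eta>)\<close> from
  \<open>\<phi>\<close> to \<open>\<psi>\<close> is an arrow from \<open>\<psi>\<close> to \<open>\<phi>\<close> there.
\<close>

definition M_arr ::
  "'k rel \<Rightarrow> ('o, 'a) quant \<Rightarrow> ('x, 'o, 'a) dist \<Rightarrow> ('x, 'o, 'a) dist
    \<Rightarrow> ('x \<times> 'x \<Rightarrow> 'a) \<times> ('x \<times> 'x \<Rightarrow> 'a) \<Rightarrow> ('x, 'o, 'a) presheaf \<Rightarrow> ('x, 'o, 'a) presheaf" where
  "M_arr \<kappa> Q = (\<lambda>(A', B', \<psi>) (A, B, \<phi>) (\<zeta>, \<eta>).
     \<lambda>(X, \<mu>')\<in>obj (M_ob \<kappa> Q (A', B', \<psi>)).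
       down_arrow \<kappa> Q (A, B, \<phi>) (up_arrow \<kappa> Q (A, B, \<phi>)
         (X, Comp (QDist \<kappa> Q) A A' (star Q X) \<mu>' \<zeta>)))"

text \<open>The functor induced on equivalence classes, on which \<open>M_arr\<close> is constant.\<close>

definition Mb_arr ::
  "'k rel \<Rightarrow> ('o, 'a) quant \<Rightarrow> ('x, 'o, 'a) dist \<Rightarrow> ('x, 'o, 'a) dist
    \<Rightarrow> (('x \<times> 'x \<Rightarrow> 'a) \<times> ('x \<times> 'x \<Rightarrow> 'a)) set \<Rightarrow> ('x, 'o, 'a) presheaf \<Rightarrow> ('x, 'o, 'a) presheaf" where
  "Mb_arr \<kappa> Q \<psi> \<phi> c = the_elem (M_arr \<kappa> Q \<psi> \<phi> ` c)"

end

theory Submission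
  imports Defs
begin

text \<open>
  For a distributor \<open>\<phi>\<close> from \<open>A\<close> to \<open>B\<close>, the objects of \<open>\<M>\<phi>\<close> are the presheaves fixed by the
  closure \<open>\<mu> \<mapsto> (\<phi> \<swarrow> \<mu>) \<searrow> \<phi>\<close>. For a Chu connection \<open>(\<zeta>, \<eta>)\<close> from \<open>\<phi>\<close> to \<open>\<psi>\<close> everything is governed by
  its diagonal \<open>\<theta> = \<phi> \<swarrow> \<zeta> = \<eta> \<searrow> \<psi>\<close>. It determines the \<open>\<sim>\<close>-class of \<open>(\<zeta>, \<eta>)\<close> by definition, and it
  determines the functor \<open>\<M>(\<zeta>, \<eta>)\<close>, because \<open>\<phi> \<swarrow> (\<mu>' \<circ> \<zeta>) = \<theta> \<swarrow> \<mu>'\<close>. Conversely \<open>\<theta>\<close> can be read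
  off from \<open>\<M>(\<zeta>, \<eta>)\<close> by evaluating at the closures of the representable presheaves of the domain of
  \<open>\<psi>\<close>. Since a larger Chu connection has a smaller diagonal, the order on back diagonals is the
  reversed order of the diagonals, and the same holds for the functors (\<open>M_arr_le_iff\<close>).

  Every left adjoint \<open>F : \<M>\<psi> \<rightarrow> \<M>\<phi>\<close> arises in this way (\<open>M_arr_full\<close>). Let \<open>G\<close> be its right adjoint,
  and let the columns of \<open>\<zeta>\<close> be the values of \<open>F\<close> at the closed representables. The adjunction says
  exactly that the columns of \<open>\<theta> = \<phi> \<swarrow> \<zeta>\<close> are the values of \<open>G\<close> at the columns of \<open>\<phi>\<close>. These are
  fixed points for \<open>\<psi>\<close>, so \<open>\<theta> = \<eta> \<searrow> \<psi>\<close> with \<open>\<eta> = \<psi> \<swarrow> \<theta>\<close>, which makes \<open>(\<zeta>, \<eta>)\<close> a Chu connection;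
  and \<open>\<M>(\<zeta>, \<eta>)\<close> agrees with \<open>F\<close> because both have the same image under \<open>\<phi>\<^sub>\<up>\<close>.

  A skeletal complete \<open>E\<close> is isomorphic to \<open>\<M>\<close> of its identity distributor by the Yoneda embedding
  (\<open>yoneda_qiso\<close>): for a presheaf \<open>\<mu>\<close> on \<open>E\<close> with supremum \<open>s\<close>, the co-presheaf \<open>E \<swarrow> \<mu>\<close> is represented
  by \<open>s\<close>, so a fixed \<open>\<mu>\<close> is itself represented by \<open>s\<close>.

  Hence \<open>\<M>\<^sub>b\<close> is full, an order embedding on hom-sets, and essentially surjective on objects. A functor
  with these properties from a quantaloid to an order-enriched category forces the latter to be a
  quantaloid and is an equivalence of quantaloids (\<open>order_equivalence.is_quantaloid_equivalence\<close>), so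
  joins of left adjoints never have to be computed.

  The strong limit property makes the set of presheaves on a small category small. Therefore \<open>\<M>\<phi>\<close> has
  an isomorphic copy with carrier in the universe, and conversely every small category over any type
  has such a copy; this is how essential surjectivity is obtained, and how the equivalence is carried
  over from categories of presheaves to categories with carrier in the universe.
\<close>

section \<open>Quantaloids as order-enriched categories with stable joins\<close>

text \<open>
  The relation \<open>leq\<close> is a parameter because the same notion is needed for a preorder that is not the
  order of \<open>C\<close>: for back diagonals, joins are formed before passing to equivalence classes.
\<close>

definition stable_join ::
  "('o, 'a) quant \<Rightarrow> ('o \<Rightarrow> 'o \<Rightarrow> 'a \<Rightarrow> 'a \<Rightarrow> bool) \<Rightarrow> 'o \<Rightarrow> 'o \<Rightarrow> 'a set \<Rightarrow> 'a \<Rightarrow> bool" where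
  "stable_join C leq X Y S s \<longleftrightarrow> s \<in> Hom C X Y \<and>
     (\<forall>h\<in>Hom C X Y. leq X Y s h \<longleftrightarrow> (\<forall>f\<in>S. leq X Y f h)) \<and>
     (\<forall>Z\<in>Ob C. \<forall>g\<in>Hom C Y Z. \<forall>h\<in>Hom C X Z.
        leq X Z (Comp C X Y Z g s) h \<longleftrightarrow> (\<forall>f\<in>S. leq X Z (Comp C X Y Z g f) h)) \<and>
     (\<forall>W\<in>Ob C. \<forall>e\<in>Hom C W X. \<forall>h\<in>Hom C W Y.
        leq W Y (Comp C W X Y s e) h \<longleftrightarrow> (\<forall>f\<in>S. leq W Y (Comp C W X Y f e) h))"

lemma stable_joinD:
  assumes "stable_join C leq X Y S s"
  shows "s \<in> Hom C X Y"
    and "h \<in> Hom C X Y \<Longrightarrow> leq X Y s h \<longleftrightarrow> (\<forall>f\<in>S. leq X Y f h)"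
    and "\<lbrakk>Z \<in> Ob C; g \<in> Hom C Y Z; h' \<in> Hom C X Z\<rbrakk> \<Longrightarrow>
      leq X Z (Comp C X Y Z g s) h' \<longleftrightarrow> (\<forall>f\<in>S. leq X Z (Comp C X Y Z g f) h')"
    and "\<lbrakk>W \<in> Ob C; e \<in> Hom C W X; k \<in> Hom C W Y\<rbrakk> \<Longrightarrow>
      leq W Y (Comp C W X Y s e) k \<longleftrightarrow> (\<forall>f\<in>S. leq W Y (Comp C W X Y f e) k)"
  using assms by (simp_all add: stable_join_def)

lemma op_quant_simps [simp]:
  "Ob (op_quant C) = Ob C" "Hom (op_quant C) X Y = Hom C Y X"
  "Comp (op_quant C) X Y Z g f = Comp C Z Y X f g" "Ident (op_quant C) = Ident C"
  "Leq (op_quant C) X Y = Leq C Y X"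
  "hom_order (op_quant C) X Y = hom_order C Y X"
  by (simp_all add: op_quant_def hom_order_def)

lemma quantaloid_op_quant:
  assumes "quantaloid C"
  shows "quantaloid (op_quant C)"
proof -
  interpret quantaloid C by fact
  show ?thesis
    by (rule quantaloid.intro)
      (simp_all add: ident_in comp_in comp_assoc comp_ident_left comp_ident_right
        hom_complete_lattice comp_sup_left comp_sup_right)
qed

text \<open>
  A category enriched in posets. Distributors, back diagonals and complete categories with left adjoints
  are first recognised as such; stable joins are added in a second step.
\<close>

locale ordered_category =
  fixes C :: "('o, 'a) quant"
  assumes Ident_hom: "X \<in> Ob C \<Longrightarrow> Ident C X \<in> Hom C X X"
    and Comp_hom: "\<lbrakk>X \<in> Ob C; Y \<in> Ob C; Z \<in> Ob C; f \<in> Hom C X Y; g \<in> Hom C Y Z\<rbrakk>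
      \<Longrightarrow> Comp C X Y Z g f \<in> Hom C X Z"
    and Comp_assoc: "\<lbrakk>W \<in> Ob C; X \<in> Ob C; Y \<in> Ob C; Z \<in> Ob C;
        f \<in> Hom C W X; g \<in> Hom C X Y; h \<in> Hom C Y Z\<rbrakk>
      \<Longrightarrow> Comp C W Y Z h (Comp C W X Y g f) = Comp C W X Z (Comp C X Y Z h g) f"
    and Comp_Ident: "\<lbrakk>X \<in> Ob C; Y \<in> Ob C; f \<in> Hom C X Y\<rbrakk> \<Longrightarrow> Comp C X X Y f (Ident C X) = f"
    and Ident_Comp: "\<lbrakk>X \<in> Ob C; Y \<in> Ob C; f \<in> Hom C X Y\<rbrakk> \<Longrightarrow> Comp C X Y Y (Ident C Y) f = f"
    and Leq_refl: "\<lbrakk>X \<in> Ob C; Y \<in> Ob C; f \<in> Hom C X Y\<rbrakk> \<Longrightarrow> Leq C X Y f f"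
    and Leq_trans: "\<lbrakk>Leq C X Y f g; Leq C X Y g h; X \<in> Ob C; Y \<in> Ob C;
        f \<in> Hom C X Y; g \<in> Hom C X Y; h \<in> Hom C X Y\<rbrakk> \<Longrightarrow> Leq C X Y f h"
    and Leq_antisym: "\<lbrakk>Leq C X Y f g; Leq C X Y g f; X \<in> Ob C; Y \<in> Ob C;
        f \<in> Hom C X Y; g \<in> Hom C X Y\<rbrakk> \<Longrightarrow> f = g"
    and Comp_mono: "\<lbrakk>Leq C X Y f f'; Leq C Y Z g g'; X \<in> Ob C; Y \<in> Ob C; Z \<in> Ob C;
        f \<in> Hom C X Y; f' \<in> Hom C X Y; g \<in> Hom C Y Z; g' \<in> Hom C Y Z\<rbrakk>
      \<Longrightarrow> Leq C X Z (Comp C X Y Z g f) (Comp C X Y Z g' f')"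
begin

text \<open>
  The usual way to prove that two arrows are equal: both sides are characterised by the arrows below
  them.
\<close>

lemma Leq_below_ext:
  assumes "X \<in> Ob C" "Y \<in> Ob C" "f \<in> Hom C X Y" "g \<in> Hom C X Y"
    and "\<And>k. k \<in> Hom C X Y \<Longrightarrow> Leq C X Y k f \<longleftrightarrow> Leq C X Y k g"
  shows "f = g"
  using assms Leq_refl Leq_antisym by blast

lemma Leq_above_ext:
  assumes "X \<in> Ob C" "Y \<in> Ob C" "f \<in> Hom C X Y" "g \<in> Hom C X Y"
    and "\<And>h. h \<in> Hom C X Y \<Longrightarrow> Leq C X Y f h \<longleftrightarrow> Leq C X Y g h"
  shows "f = g"
  using assms Leq_refl Leq_antisym by blast

lemma hom_order_partial: "\<lbrakk>X \<in> Ob C; Y \<in> Ob C\<rbrakk> \<Longrightarrow> partial_order (hom_order C X Y)"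
  by unfold_locales
    (auto simp: hom_order_def intro: Leq_refl Leq_trans Leq_antisym)

lemma hom_order_least_iff:
  assumes "X \<in> Ob C" "Y \<in> Ob C" "S \<subseteq> Hom C X Y"
  shows "least (hom_order C X Y) s (Upper (hom_order C X Y) S) \<longleftrightarrow>
    s \<in> Hom C X Y \<and> (\<forall>h\<in>Hom C X Y. Leq C X Y s h \<longleftrightarrow> (\<forall>f\<in>S. Leq C X Y f h))"
proof
  assume "least (hom_order C X Y) s (Upper (hom_order C X Y) S)"
  then have s: "s \<in> Hom C X Y" "\<And>f. f \<in> S \<Longrightarrow> Leq C X Y f s"
    "\<And>h. h \<in> Hom C X Y \<Longrightarrow> \<forall>f\<in>S. Leq C X Y f h \<Longrightarrow> Leq C X Y s h"
    using assms(3) by (auto simp: least_def Upper_def hom_order_def)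
  then show "s \<in> Hom C X Y \<and> (\<forall>h\<in>Hom C X Y. Leq C X Y s h \<longleftrightarrow> (\<forall>f\<in>S. Leq C X Y f h))"
    using assms Leq_trans by (meson subsetD)
next
  assume "s \<in> Hom C X Y \<and> (\<forall>h\<in>Hom C X Y. Leq C X Y s h \<longleftrightarrow> (\<forall>f\<in>S. Leq C X Y f h))"
  then show "least (hom_order C X Y) s (Upper (hom_order C X Y) S)"
    using assms Leq_refl[of X Y s] by (auto simp: least_def Upper_def hom_order_def)
qed

lemma sup_eqI:
  assumes "X \<in> Ob C" "Y \<in> Ob C" "S \<subseteq> Hom C X Y" "s \<in> Hom C X Y"
    and "\<And>h. h \<in> Hom C X Y \<Longrightarrow> Leq C X Y s h \<longleftrightarrow> (\<forall>f\<in>S. Leq C X Y f h)"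
  shows "\<Squnion>\<^bsub>hom_order C X Y\<^esub> S = s"
  unfolding Lattice.sup_def
proof (rule some_equality)
  show "least (hom_order C X Y) s (Upper (hom_order C X Y) S)"
    using assms by (simp add: hom_order_least_iff)
next
  fix t assume "least (hom_order C X Y) t (Upper (hom_order C X Y) S)"
  then have "t \<in> Hom C X Y" "\<forall>h\<in>Hom C X Y. Leq C X Y t h \<longleftrightarrow> (\<forall>f\<in>S. Leq C X Y f h)"
    using assms by (simp_all add: hom_order_least_iff)
  then show "t = s"
    using assms Leq_refl by (intro Leq_above_ext) auto
qed

text \<open>
  Infima come for free as suprema of lower bounds, and preservation of joins by composition can be
  tested on upper bounds.
\<close>

lemma quantaloidI:
  assumes sup: "\<And>X Y S. \<lbrakk>X \<in> Ob C; Y \<in> Ob C; S \<subseteq> Hom C X Y\<rbrakk> \<Longrightarrow> \<exists>s. stable_join C (Leq C) X Y S s"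
  shows "quantaloid C"
proof (rule quantaloid.intro)
  fix X Y assume XY: "X \<in> Ob C" "Y \<in> Ob C"
  have car: "carrier (hom_order C X Y) = Hom C X Y"
    by (simp add: hom_order_def)
  show "complete_lattice (hom_order C X Y)"
  proof (intro complete_lattice.intro complete_lattice_axioms.intro hom_order_partial XY)
    fix S assume "S \<subseteq> carrier (hom_order C X Y)"
    then have S: "S \<subseteq> Hom C X Y" by (simp add: car)
    from sup[OF XY S] show "\<exists>s. least (hom_order C X Y) s (Upper (hom_order C X Y) S)"
      unfolding hom_order_least_iff[OF XY S] stable_join_def by blast
  next
    fix S assume "S \<subseteq> carrier (hom_order C X Y)"
    then have S: "S \<subseteq> Hom C X Y" by (simp add: car)
    \<comment> \<open>The infimum of \<open>S\<close> is the supremum of its lower bounds.\<close>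
    define L where "L = {l \<in> Hom C X Y. \<forall>f\<in>S. Leq C X Y l f}"
    have "L \<subseteq> Hom C X Y" by (auto simp: L_def)
    from sup[OF XY this] obtain i where i': "stable_join C (Leq C) X Y L i" ..
    note i = stable_joinD(1,2)[OF i']
    have "\<forall>f\<in>S. Leq C X Y i f" using i(2) S by (auto simp: L_def)
    moreover have "Leq C X Y l i" if "l \<in> L" for l
      using i Leq_refl[OF XY i(1)] that by blast
    ultimately show "\<exists>i. greatest (hom_order C X Y) i (Lower (hom_order C X Y) S)"
      using i(1) S unfolding greatest_def Lower_def L_def hom_order_def
      by (intro exI[of _ i]) auto
  qed
next
  fix X Y Z S g
  assume *: "X \<in> Ob C" "Y \<in> Ob C" "Z \<in> Ob C" "S \<subseteq> Hom C X Y" "g \<in> Hom C Y Z"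
  from sup[OF *(1,2,4)] obtain s where "stable_join C (Leq C) X Y S s" ..
  note s = stable_joinD[OF this]
  have "\<Squnion>\<^bsub>hom_order C X Y\<^esub> S = s"
    using * s by (intro sup_eqI) auto
  moreover have "\<Squnion>\<^bsub>hom_order C X Z\<^esub> ((\<lambda>f. Comp C X Y Z g f) ` S) = Comp C X Y Z g s"
    using * s Comp_hom by (intro sup_eqI) auto
  ultimately show "Comp C X Y Z g (\<Squnion>\<^bsub>hom_order C X Y\<^esub> S)
    = \<Squnion>\<^bsub>hom_order C X Z\<^esub> ((\<lambda>f. Comp C X Y Z g f) ` S)" by simp
next
  fix X Y Z f S
  assume *: "X \<in> Ob C" "Y \<in> Ob C" "Z \<in> Ob C" "f \<in> Hom C X Y" "S \<subseteq> Hom C Y Z"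
  from sup[OF *(2,3,5)] obtain s where "stable_join C (Leq C) Y Z S s" ..
  note s = stable_joinD[OF this]
  have "\<Squnion>\<^bsub>hom_order C Y Z\<^esub> S = s"
    using * s by (intro sup_eqI) auto
  moreover have "\<Squnion>\<^bsub>hom_order C X Z\<^esub> ((\<lambda>g. Comp C X Y Z g f) ` S) = Comp C X Y Z s f"
    using * s Comp_hom by (intro sup_eqI) auto
  ultimately show "Comp C X Y Z (\<Squnion>\<^bsub>hom_order C Y Z\<^esub> S) f
    = \<Squnion>\<^bsub>hom_order C X Z\<^esub> ((\<lambda>g. Comp C X Y Z g f) ` S)" by simp
qed (rule Ident_hom Comp_hom Comp_assoc Comp_Ident Ident_Comp; assumption)+

text \<open>
  Stable joins can be computed upstairs along a family of surjections \<open>\<Phi>\<close> that respects composition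
  and reflects a relation on \<open>K\<close> to the order of \<open>C\<close>. There are two applications: to a quotient of
  \<open>K\<close>, with \<open>G\<close> the identity on objects, and to an equivalence with \<open>K\<close>, with \<open>G\<close> the inverse on
  objects.
\<close>

lemma quantaloid_by_surjection:
  fixes K :: "('p, 'b) quant" and le :: "'p \<Rightarrow> 'p \<Rightarrow> 'b \<Rightarrow> 'b \<Rightarrow> bool"
  assumes G: "\<And>X. X \<in> Ob C \<Longrightarrow> G X \<in> Ob K"
    and K_comp: "\<And>X Y Z f g. \<lbrakk>X \<in> Ob K; Y \<in> Ob K; Z \<in> Ob K; f \<in> Hom K X Y; g \<in> Hom K Y Z\<rbrakk>
      \<Longrightarrow> Comp K X Y Z g f \<in> Hom K X Z"
    and hom: "\<And>X Y. \<lbrakk>X \<in> Ob C; Y \<in> Ob C\<rbrakk> \<Longrightarrow> Hom C X Y = \<Phi> X Y ` Hom K (G X) (G Y)"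
    and comp: "\<And>X Y Z f g. \<lbrakk>X \<in> Ob C; Y \<in> Ob C; Z \<in> Ob C;
        f \<in> Hom K (G X) (G Y); g \<in> Hom K (G Y) (G Z)\<rbrakk>
      \<Longrightarrow> Comp C X Y Z (\<Phi> Y Z g) (\<Phi> X Y f) = \<Phi> X Z (Comp K (G X) (G Y) (G Z) g f)"
    and leq: "\<And>X Y f g. \<lbrakk>X \<in> Ob C; Y \<in> Ob C; f \<in> Hom K (G X) (G Y); g \<in> Hom K (G X) (G Y)\<rbrakk>
      \<Longrightarrow> Leq C X Y (\<Phi> X Y f) (\<Phi> X Y g) \<longleftrightarrow> le (G X) (G Y) f g"
    and sup: "\<And>X Y S. \<lbrakk>X \<in> Ob K; Y \<in> Ob K; S \<subseteq> Hom K X Y\<rbrakk> \<Longrightarrow> \<exists>s. stable_join K le X Y S s"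
  shows "quantaloid C"
proof (rule quantaloidI)
  fix X Y S assume XY: "X \<in> Ob C" "Y \<in> Ob C" and S: "S \<subseteq> Hom C X Y"
  define T where "T = {f \<in> Hom K (G X) (G Y). \<Phi> X Y f \<in> S}"
  have T: "T \<subseteq> Hom K (G X) (G Y)" by (auto simp: T_def)
  have ST: "(\<forall>F\<in>S. P F) \<longleftrightarrow> (\<forall>f\<in>T. P (\<Phi> X Y f))" for P
    using S XY by (auto simp: T_def hom)
  from sup[OF G[OF XY(1)] G[OF XY(2)] T] obtain s where "stable_join K le (G X) (G Y) T s" ..
  note s = stable_joinD[OF this]
  have T': "f \<in> T \<Longrightarrow> f \<in> Hom K (G X) (G Y)" for f by (simp add: T_def)
  have "stable_join C (Leq C) X Y S (\<Phi> X Y s)"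
    unfolding stable_join_def ST
  proof (intro conjI ballI)
    show "\<Phi> X Y s \<in> Hom C X Y" using XY s(1) by (simp add: hom)
  next
    fix h assume "h \<in> Hom C X Y"
    then show "Leq C X Y (\<Phi> X Y s) h \<longleftrightarrow> (\<forall>f\<in>T. Leq C X Y (\<Phi> X Y f) h)"
      using XY s(1,2) T' by (auto simp: hom leq)
  next
    fix Z g h assume "Z \<in> Ob C" "g \<in> Hom C Y Z" "h \<in> Hom C X Z"
    then show "Leq C X Z (Comp C X Y Z g (\<Phi> X Y s)) h \<longleftrightarrow> (\<forall>f\<in>T. Leq C X Z (Comp C X Y Z g (\<Phi> X Y f)) h)"
      using XY s(1,3) T' by (auto simp: hom comp leq K_comp G)
  next
    fix Z g h assume "Z \<in> Ob C" "g \<in> Hom C Z X" "h \<in> Hom C Z Y"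
    then show "Leq C Z Y (Comp C Z X Y (\<Phi> X Y s) g) h \<longleftrightarrow> (\<forall>f\<in>T. Leq C Z Y (Comp C Z X Y (\<Phi> X Y f) g) h)"
      using XY s(1,4) T' by (auto simp: hom comp leq K_comp G)
  qed
  then show "\<exists>s. stable_join C (Leq C) X Y S s" ..
qed

end

context quantaloid
begin

lemma hom_order_refl_trans_antisym:
  assumes "X \<in> Ob C" "Y \<in> Ob C"
  shows "f \<in> Hom C X Y \<Longrightarrow> Leq C X Y f f"
    and "\<lbrakk>Leq C X Y f g; Leq C X Y g h; f \<in> Hom C X Y; g \<in> Hom C X Y; h \<in> Hom C X Y\<rbrakk> \<Longrightarrow> Leq C X Y f h"
    and "\<lbrakk>Leq C X Y f g; Leq C X Y g f; f \<in> Hom C X Y; g \<in> Hom C X Y\<rbrakk> \<Longrightarrow> f = g"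
proof -
  interpret complete_lattice "hom_order C X Y" using hom_complete_lattice assms .
  show "f \<in> Hom C X Y \<Longrightarrow> Leq C X Y f f"
    using le_refl[of f] by (simp add: hom_order_def)
  show "\<lbrakk>Leq C X Y f g; Leq C X Y g h; f \<in> Hom C X Y; g \<in> Hom C X Y; h \<in> Hom C X Y\<rbrakk> \<Longrightarrow> Leq C X Y f h"
    using le_trans[of f g h] by (simp add: hom_order_def)
  show "\<lbrakk>Leq C X Y f g; Leq C X Y g f; f \<in> Hom C X Y; g \<in> Hom C X Y\<rbrakk> \<Longrightarrow> f = g"
    using weak_le_antisym[of f g] by (simp add: hom_order_def)
qed

lemma sup_hom:
  assumes "X \<in> Ob C" "Y \<in> Ob C" "S \<subseteq> Hom C X Y"
  shows "\<Squnion>\<^bsub>hom_order C X Y\<^esub> S \<in> Hom C X Y"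
  using complete_lattice.sup_exists[OF hom_complete_lattice[OF assms(1,2)], of S] assms(3)
    someI_ex[of "\<lambda>s. least (hom_order C X Y) s (Upper (hom_order C X Y) S)"]
  unfolding Lattice.sup_def by (auto simp: hom_order_def least_def)

lemma sup_le_iff:
  assumes "X \<in> Ob C" "Y \<in> Ob C" "S \<subseteq> Hom C X Y" "h \<in> Hom C X Y"
  shows "Leq C X Y (\<Squnion>\<^bsub>hom_order C X Y\<^esub> S) h \<longleftrightarrow> (\<forall>f\<in>S. Leq C X Y f h)"
proof -
  let ?s = "\<Squnion>\<^bsub>hom_order C X Y\<^esub> S"
  have "least (hom_order C X Y) ?s (Upper (hom_order C X Y) S)"
    using complete_lattice.sup_exists[OF hom_complete_lattice[OF assms(1,2)], of S] assms(3)
      someI_ex[of "\<lambda>s. least (hom_order C X Y) s (Upper (hom_order C X Y) S)"]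
    unfolding Lattice.sup_def by (auto simp: hom_order_def)
  then have "\<And>f. f \<in> S \<Longrightarrow> Leq C X Y f ?s"
    "\<forall>f\<in>S. Leq C X Y f h \<Longrightarrow> Leq C X Y ?s h"
    using assms by (auto simp: least_def Upper_def hom_order_def)
  then show ?thesis
    using assms sup_hom[OF assms(1-3)] hom_order_refl_trans_antisym(2)[OF assms(1,2)] by (meson subsetD)
qed

lemma sup_upper:
  assumes "X \<in> Ob C" "Y \<in> Ob C" "S \<subseteq> Hom C X Y" "f \<in> S"
  shows "Leq C X Y f (\<Squnion>\<^bsub>hom_order C X Y\<^esub> S)"
  using sup_le_iff[OF assms(1-3) sup_hom[OF assms(1-3)]] assms
    hom_order_refl_trans_antisym(1) sup_hom by blast

lemma comp_sup_le_iff: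
  assumes "X \<in> Ob C" "Y \<in> Ob C" "Z \<in> Ob C" "S \<subseteq> Hom C X Y" "g \<in> Hom C Y Z" "h \<in> Hom C X Z"
  shows "Leq C X Z (Comp C X Y Z g (\<Squnion>\<^bsub>hom_order C X Y\<^esub> S)) h \<longleftrightarrow>
    (\<forall>f\<in>S. Leq C X Z (Comp C X Y Z g f) h)"
proof -
  have "(\<lambda>f. Comp C X Y Z g f) ` S \<subseteq> Hom C X Z" using assms by (auto intro: comp_in)
  then show ?thesis using assms by (simp add: comp_sup_right sup_le_iff)
qed

lemma sup_comp_le_iff:
  assumes "X \<in> Ob C" "Y \<in> Ob C" "Z \<in> Ob C" "S \<subseteq> Hom C Y Z" "f \<in> Hom C X Y" "h \<in> Hom C X Z"
  shows "Leq C X Z (Comp C X Y Z (\<Squnion>\<^bsub>hom_order C Y Z\<^esub> S) f) h \<longleftrightarrow>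
    (\<forall>g\<in>S. Leq C X Z (Comp C X Y Z g f) h)"
proof -
  interpret op: quantaloid "op_quant C" by (rule quantaloid_op_quant) unfold_locales
  show ?thesis using assms op.comp_sup_le_iff[of Z Y X S f h] by simp
qed

text \<open>
  Monotonicity is a special case of preservation of joins: if \<open>f \<le> f'\<close> then \<open>f'\<close> is the join of
  \<open>{f, f'}\<close>.
\<close>

lemma comp_mono_right:
  assumes "X \<in> Ob C" "Y \<in> Ob C" "Z \<in> Ob C" "f \<in> Hom C X Y" "f' \<in> Hom C X Y" "g \<in> Hom C Y Z"
    and "Leq C X Y f f'"
  shows "Leq C X Z (Comp C X Y Z g f) (Comp C X Y Z g f')"
proof -
  let ?s = "\<Squnion>\<^bsub>hom_order C X Y\<^esub> {f, f'}"
  have "?s = f'"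
    using assms sup_hom[of X Y "{f, f'}"] sup_le_iff[of X Y "{f, f'}" f'] sup_upper[of X Y "{f, f'}" f']
    by (intro hom_order_refl_trans_antisym(3)[of X Y]) (auto intro: hom_order_refl_trans_antisym(1))
  then show ?thesis
    using comp_sup_le_iff[of X Y Z "{f, f'}" g "Comp C X Y Z g f'"] assms comp_in
      hom_order_refl_trans_antisym(1)[of X Z "Comp C X Y Z g f'"] by auto
qed

lemma comp_mono_left:
  assumes "X \<in> Ob C" "Y \<in> Ob C" "Z \<in> Ob C" "f \<in> Hom C X Y" "g \<in> Hom C Y Z" "g' \<in> Hom C Y Z"
    and "Leq C Y Z g g'"
  shows "Leq C X Z (Comp C X Y Z g f) (Comp C X Y Z g' f)"
proof -
  interpret op: quantaloid "op_quant C" by (rule quantaloid_op_quant) unfold_locales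
  show ?thesis using assms op.comp_mono_right[of Z Y X g g' f] by simp
qed

end

sublocale quantaloid \<subseteq> ordered_category C
proof
  fix X Y Z f f' g g'
  assume *: "Leq C X Y f f'" "Leq C Y Z g g'" "X \<in> Ob C" "Y \<in> Ob C" "Z \<in> Ob C"
    "f \<in> Hom C X Y" "f' \<in> Hom C X Y" "g \<in> Hom C Y Z" "g' \<in> Hom C Y Z"
  show "Leq C X Z (Comp C X Y Z g f) (Comp C X Y Z g' f')"
    using * comp_in
    by (intro hom_order_refl_trans_antisym(2)[OF _ _
          comp_mono_right[of X Y Z f f' g] comp_mono_left[of X Y Z f' g g']]) auto
qed (fact ident_in comp_in comp_assoc comp_ident_right comp_ident_left
    hom_order_refl_trans_antisym(1) | (rule hom_order_refl_trans_antisym; assumption))+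

section \<open>Implications and the closure operator of an arrow\<close>

context quantaloid
begin

text \<open>
  The implication is the join of all solutions \<open>g\<close> of \<open>g \<circ> f \<le> h\<close>; it is itself a solution because
  composition preserves this join.
\<close>

lemma limp_unique_ex:
  assumes "X \<in> Ob C" "Y \<in> Ob C" "Z \<in> Ob C" "f \<in> Hom C X Y" "h \<in> Hom C X Z"
  shows "\<exists>!k. k \<in> Hom C Y Z \<and> (\<forall>g\<in>Hom C Y Z. Leq C X Z (Comp C X Y Z g f) h \<longleftrightarrow> Leq C Y Z g k)"
proof (rule ex_ex1I)
  define S where "S = {g \<in> Hom C Y Z. Leq C X Z (Comp C X Y Z g f) h}"
  let ?k = "\<Squnion>\<^bsub>hom_order C Y Z\<^esub> S"
  have S: "S \<subseteq> Hom C Y Z" by (auto simp: S_def)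
  have k: "?k \<in> Hom C Y Z" using assms S by (simp add: sup_hom)
  have kf: "Leq C X Z (Comp C X Y Z ?k f) h"
    using sup_comp_le_iff[OF assms(1-3) S assms(4,5)] by (simp add: S_def)
  have "Leq C X Z (Comp C X Y Z g f) h \<longleftrightarrow> Leq C Y Z g ?k" if g: "g \<in> Hom C Y Z" for g
  proof
    assume "Leq C X Z (Comp C X Y Z g f) h"
    then show "Leq C Y Z g ?k" using g assms S by (intro sup_upper) (auto simp: S_def)
  next
    assume "Leq C Y Z g ?k"
    then have "Leq C X Z (Comp C X Y Z g f) (Comp C X Y Z ?k f)"
      using assms g k by (intro comp_mono_left)
    then show "Leq C X Z (Comp C X Y Z g f) h"
      by (rule Leq_trans[OF _ kf]) (use assms g k in \<open>auto intro: comp_in\<close>)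
  qed
  then show "\<exists>k. k \<in> Hom C Y Z \<and> (\<forall>g\<in>Hom C Y Z. Leq C X Z (Comp C X Y Z g f) h \<longleftrightarrow> Leq C Y Z g k)"
    using k by blast
next
  fix k k'
  assume "k \<in> Hom C Y Z \<and> (\<forall>g\<in>Hom C Y Z. Leq C X Z (Comp C X Y Z g f) h \<longleftrightarrow> Leq C Y Z g k)"
    "k' \<in> Hom C Y Z \<and> (\<forall>g\<in>Hom C Y Z. Leq C X Z (Comp C X Y Z g f) h \<longleftrightarrow> Leq C Y Z g k')"
  then show "k = k'" using assms by (intro Leq_below_ext[of Y Z]) auto
qed

lemma
  assumes "X \<in> Ob C" "Y \<in> Ob C" "Z \<in> Ob C" "f \<in> Hom C X Y" "h \<in> Hom C X Z"
  shows limp_hom: "limp C X Y Z h f \<in> Hom C Y Z"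
    and le_limp_iff: "g \<in> Hom C Y Z \<Longrightarrow>
      Leq C Y Z g (limp C X Y Z h f) \<longleftrightarrow> Leq C X Z (Comp C X Y Z g f) h"
  using theI'[OF limp_unique_ex[OF assms]] unfolding limp_def[symmetric] by auto

lemma
  assumes "X \<in> Ob C" "Y \<in> Ob C" "Z \<in> Ob C" "g \<in> Hom C Y Z" "h \<in> Hom C X Z"
  shows rimp_hom: "rimp C X Y Z g h \<in> Hom C X Y"
    and le_rimp_iff: "f \<in> Hom C X Y \<Longrightarrow>
      Leq C X Y f (rimp C X Y Z g h) \<longleftrightarrow> Leq C X Z (Comp C X Y Z g f) h"
proof -
  interpret op: quantaloid "op_quant C" by (rule quantaloid_op_quant) unfold_locales
  have eq: "rimp C X Y Z g h = limp (op_quant C) Z Y X h g"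
    by (simp add: rimp_def limp_def)
  show "rimp C X Y Z g h \<in> Hom C X Y"
    "f \<in> Hom C X Y \<Longrightarrow> Leq C X Y f (rimp C X Y Z g h) \<longleftrightarrow> Leq C X Z (Comp C X Y Z g f) h"
    using assms op.limp_hom[of Z Y X g h] op.le_limp_iff[of Z Y X g h f] by (simp_all add: eq)
qed

lemmas hom_closed = ident_in comp_in limp_hom rimp_hom

text \<open>
  The three exchange laws for implications are associativity of composition, read through the adjunctions.
\<close>

lemma limp_comp:
  assumes "X \<in> Ob C" "X' \<in> Ob C" "P \<in> Ob C" "Y \<in> Ob C"
    and "f \<in> Hom C X Y" "u \<in> Hom C X X'" "m \<in> Hom C X' P"
  shows "limp C X P Y f (Comp C X X' P m u) = limp C X' P Y (limp C X X' Y f u) m"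
  using assms by (intro Leq_below_ext[of P Y]) (auto simp: hom_closed le_limp_iff comp_assoc)

lemma rimp_comp:
  assumes "X \<in> Ob C" "P \<in> Ob C" "Y \<in> Ob C" "Y' \<in> Ob C"
    and "g \<in> Hom C X Y'" "v \<in> Hom C Y Y'" "n \<in> Hom C P Y"
  shows "rimp C X P Y' (Comp C P Y Y' v n) g = rimp C X P Y n (rimp C X Y Y' v g)"
  using assms by (intro Leq_below_ext[of X P]) (auto simp: hom_closed le_rimp_iff comp_assoc)

lemma limp_rimp:
  assumes "X \<in> Ob C" "P \<in> Ob C" "Y \<in> Ob C" "Y' \<in> Ob C"
    and "g \<in> Hom C X Y'" "v \<in> Hom C Y Y'" "m \<in> Hom C X P"
  shows "limp C X P Y (rimp C X Y Y' v g) m = rimp C P Y Y' v (limp C X P Y' g m)"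
  using assms by (intro Leq_below_ext[of P Y])
    (auto simp: hom_closed le_rimp_iff le_limp_iff comp_assoc)

lemma limp_ident:
  assumes "X \<in> Ob C" "Y \<in> Ob C" "f \<in> Hom C X Y"
  shows "limp C X X Y f (Ident C X) = f"
  using assms by (intro Leq_below_ext[of X Y]) (auto simp: hom_closed le_limp_iff comp_ident_right)

lemma rimp_ident:
  assumes "X \<in> Ob C" "Y \<in> Ob C" "f \<in> Hom C X Y"
  shows "rimp C X Y Y (Ident C Y) f = f"
  using assms by (intro Leq_below_ext[of X Y]) (auto simp: hom_closed le_rimp_iff comp_ident_left)

text \<open>
  The closure \<open>m \<mapsto> (f \<swarrow> m) \<searrow> f\<close> of the Galois connection between \<open>m : X \<rightarrow> P\<close> and \<open>n : P \<rightarrow> Y\<close>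
  induced by \<open>f : X \<rightarrow> Y\<close>. For a distributor \<open>f\<close> and \<open>P = *\<^sub>X\<close> it is \<open>\<phi>\<^sup>\<down>\<phi>\<^sub>\<up>\<close>; keeping \<open>P\<close> arbitrary
  allows the closure to be applied to whole distributors, that is to all their columns at once.
\<close>

definition clos :: "'o \<Rightarrow> 'o \<Rightarrow> 'a \<Rightarrow> 'o \<Rightarrow> 'a \<Rightarrow> 'a" where
  "clos X Y f P m = rimp C X P Y (limp C X P Y f m) f"

lemma clos_hom:
  "\<lbrakk>X \<in> Ob C; Y \<in> Ob C; P \<in> Ob C; f \<in> Hom C X Y; m \<in> Hom C X P\<rbrakk> \<Longrightarrow> clos X Y f P m \<in> Hom C X P"
  unfolding clos_def by (intro hom_closed)

context
  fixes X Y P f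
  assumes ob [simp]: "X \<in> Ob C" "Y \<in> Ob C" "P \<in> Ob C" and f [simp]: "f \<in> Hom C X Y"
begin

lemma le_rimp_limp_swap:
  assumes "m \<in> Hom C X P" "n \<in> Hom C P Y"
  shows "Leq C X P m (rimp C X P Y n f) \<longleftrightarrow> Leq C P Y n (limp C X P Y f m)"
  using assms by (simp add: le_rimp_iff le_limp_iff)

lemma le_clos: "m \<in> Hom C X P \<Longrightarrow> Leq C X P m (clos X Y f P m)"
  unfolding clos_def by (simp add: le_rimp_limp_swap limp_hom Leq_refl)

lemma le_limp_rimp: "n \<in> Hom C P Y \<Longrightarrow> Leq C P Y n (limp C X P Y f (rimp C X P Y n f))"
  by (simp add: le_rimp_limp_swap[symmetric] rimp_hom Leq_refl)

lemma limp_antimono: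
  "\<lbrakk>Leq C X P m m'; m \<in> Hom C X P; m' \<in> Hom C X P\<rbrakk> \<Longrightarrow> Leq C P Y (limp C X P Y f m') (limp C X P Y f m)"
  by (subst le_rimp_limp_swap[symmetric])
    (auto simp: limp_hom rimp_hom clos_hom intro!: Leq_trans[OF _ le_clos[of m', unfolded clos_def]])

lemma rimp_antimono:
  "\<lbrakk>Leq C P Y n n'; n \<in> Hom C P Y; n' \<in> Hom C P Y\<rbrakk> \<Longrightarrow> Leq C X P (rimp C X P Y n' f) (rimp C X P Y n f)"
  by (subst le_rimp_limp_swap)
    (auto simp: limp_hom rimp_hom clos_hom intro!: Leq_trans[OF _ le_limp_rimp[of n']])

lemma limp_clos: "m \<in> Hom C X P \<Longrightarrow> limp C X P Y f (clos X Y f P m) = limp C X P Y f m"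
  unfolding clos_def
  by (rule Leq_antisym[OF limp_antimono[OF le_clos[unfolded clos_def]] le_limp_rimp])
    (auto simp: limp_hom rimp_hom)

lemma clos_rimp: "n \<in> Hom C P Y \<Longrightarrow> clos X Y f P (rimp C X P Y n f) = rimp C X P Y n f"
  by (rule Leq_antisym[OF rimp_antimono[OF le_limp_rimp, folded clos_def] le_clos])
    (auto simp: clos_hom limp_hom rimp_hom)

lemma clos_eq_iff:
  assumes "m \<in> Hom C X P" "m' \<in> Hom C X P"
  shows "clos X Y f P m = clos X Y f P m' \<longleftrightarrow> limp C X P Y f m = limp C X P Y f m'"
  using limp_clos[OF assms(1)] limp_clos[OF assms(2)] unfolding clos_def by metis

lemma clos_le_iff:
  assumes "m \<in> Hom C X P" "m' \<in> Hom C X P"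
  shows "Leq C X P (clos X Y f P m) (clos X Y f P m') \<longleftrightarrow>
    Leq C P Y (limp C X P Y f m') (limp C X P Y f m)"
  using limp_antimono[of "clos X Y f P m" "clos X Y f P m'"] rimp_antimono[of "limp C X P Y f m'" "limp C X P Y f m"]
    assms by (auto simp: limp_clos clos_hom limp_hom clos_def[symmetric])

end

text \<open>
  A fixed point \<open>l\<close> is of the form \<open>n \<searrow> f\<close>, and \<open>(n \<searrow> f) \<swarrow> m = n \<searrow> (f \<swarrow> m)\<close> only sees \<open>f \<swarrow> m\<close>,
  which is the same for \<open>m\<close> and its closure.
\<close>

lemma limp_fixed_clos:
  assumes "X \<in> Ob C" "Y \<in> Ob C" "P \<in> Ob C" "R \<in> Ob C"
    and "f \<in> Hom C X Y" "m \<in> Hom C X P" "l \<in> Hom C X R" "clos X Y f R l = l"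
  shows "limp C X P R l (clos X Y f P m) = limp C X P R l m"
proof -
  let ?n = "limp C X R Y f l"
  have n: "?n \<in> Hom C R Y" and l: "l = rimp C X R Y ?n f"
    using assms by (auto simp: limp_hom clos_def)
  have "limp C X P R l m' = rimp C P R Y ?n (limp C X P Y f m')" if "m' \<in> Hom C X P" for m'
    by (subst l, rule limp_rimp) (use assms n that in auto)
  then show ?thesis using assms by (simp add: clos_hom limp_clos)
qed

text \<open>
  This holds because \<open>f = 1 \<searrow> f\<close>.
\<close>

lemma clos_self:
  assumes "X \<in> Ob C" "Y \<in> Ob C" "f \<in> Hom C X Y"
  shows "clos X Y f Y f = f"
  using clos_rimp[OF assms(1,2,2,3) ident_in[OF assms(2)]] assms by (simp add: rimp_ident)

end

section \<open>Quotients by ordered congruences and back diagonals\<close>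

text \<open>
  A congruence that comes from a preorder on hom-sets. The preorder carries more information than
  the congruence: it describes the order of the quotient.
\<close>

locale ordered_congruence = ordered_category K for K :: "('o, 'a) quant" +
  fixes le :: "'o \<Rightarrow> 'o \<Rightarrow> 'a \<Rightarrow> 'a \<Rightarrow> bool"
    and R :: "'o \<Rightarrow> 'o \<Rightarrow> ('a \<times> 'a) set"
  assumes R_eq: "\<lbrakk>X \<in> Ob K; Y \<in> Ob K\<rbrakk> \<Longrightarrow>
      R X Y = {(f, g). f \<in> Hom K X Y \<and> g \<in> Hom K X Y \<and> le X Y f g \<and> le X Y g f}"
    and le_refl: "\<lbrakk>X \<in> Ob K; Y \<in> Ob K; f \<in> Hom K X Y\<rbrakk> \<Longrightarrow> le X Y f f"
    and le_trans: "\<lbrakk>le X Y f g; le X Y g h; X \<in> Ob K; Y \<in> Ob K;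
      f \<in> Hom K X Y; g \<in> Hom K X Y; h \<in> Hom K X Y\<rbrakk> \<Longrightarrow> le X Y f h"
    and le_Comp: "\<lbrakk>le X Y f f'; le Y Z g g'; X \<in> Ob K; Y \<in> Ob K; Z \<in> Ob K;
        f \<in> Hom K X Y; f' \<in> Hom K X Y; g \<in> Hom K Y Z; g' \<in> Hom K Y Z\<rbrakk>
      \<Longrightarrow> le X Z (Comp K X Y Z g f) (Comp K X Y Z g' f')"
    and join_hom: "\<lbrakk>X \<in> Ob K; Y \<in> Ob K; f \<in> Hom K X Y; g \<in> Hom K X Y\<rbrakk> \<Longrightarrow>
      f \<squnion>\<^bsub>hom_order K X Y\<^esub> g \<in> Hom K X Y"
    and join_le_iff: "\<lbrakk>X \<in> Ob K; Y \<in> Ob K; f \<in> Hom K X Y; g \<in> Hom K X Y; h \<in> Hom K X Y\<rbrakk> \<Longrightarrow>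
      le X Y (f \<squnion>\<^bsub>hom_order K X Y\<^esub> g) h \<longleftrightarrow> le X Y f h \<and> le X Y g h"
    and le_sup: "\<lbrakk>X \<in> Ob K; Y \<in> Ob K; S \<subseteq> Hom K X Y\<rbrakk> \<Longrightarrow> \<exists>s. stable_join K le X Y S s"
begin

definition cls :: "'o \<Rightarrow> 'o \<Rightarrow> 'a \<Rightarrow> 'a set" where
  "cls X Y f = R X Y `` {f}"

abbreviation "B \<equiv> quotient_quant K R"

lemma mem_cls_iff:
  "\<lbrakk>X \<in> Ob K; Y \<in> Ob K; f \<in> Hom K X Y\<rbrakk> \<Longrightarrow>
    g \<in> cls X Y f \<longleftrightarrow> g \<in> Hom K X Y \<and> le X Y f g \<and> le X Y g f"
  by (auto simp: cls_def R_eq)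

lemma cls_self: "\<lbrakk>X \<in> Ob K; Y \<in> Ob K; f \<in> Hom K X Y\<rbrakk> \<Longrightarrow> f \<in> cls X Y f"
  by (simp add: mem_cls_iff le_refl)

lemma cls_eq_iff:
  assumes "X \<in> Ob K" "Y \<in> Ob K" "f \<in> Hom K X Y" "g \<in> Hom K X Y"
  shows "cls X Y f = cls X Y g \<longleftrightarrow> le X Y f g \<and> le X Y g f"
proof
  show "le X Y f g \<and> le X Y g f" if "cls X Y f = cls X Y g"
    using that assms cls_self[of X Y g] mem_cls_iff by blast
  show "cls X Y f = cls X Y g" if "le X Y f g \<and> le X Y g f"
  proof (intro Set.set_eqI iffI)
    fix h
    show "h \<in> cls X Y f \<Longrightarrow> h \<in> cls X Y g" "h \<in> cls X Y g \<Longrightarrow> h \<in> cls X Y f"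
      using that assms le_trans[of X Y g f h] le_trans[of X Y h f g] le_trans[of X Y f g h] le_trans[of X Y h g f]
      by (simp_all add: mem_cls_iff)
  qed
qed

lemma Ob_B: "Ob B = Ob K"
  by (simp add: quotient_quant_def)

lemma Hom_B: "Hom B X Y = cls X Y ` Hom K X Y"
  by (auto simp: quotient_quant_def quotient_def cls_def)

lemma Ident_B: "Ident B X = cls X X (Ident K X)"
  by (simp add: quotient_quant_def cls_def)

lemma Comp_B:
  assumes "X \<in> Ob K" "Y \<in> Ob K" "Z \<in> Ob K" "f \<in> Hom K X Y" "g \<in> Hom K Y Z"
  shows "Comp B X Y Z (cls Y Z g) (cls X Y f) = cls X Z (Comp K X Y Z g f)"
proof -
  have "cls X Z (Comp K X Y Z g' f') = cls X Z (Comp K X Y Z g f)"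
    if "g' \<in> cls Y Z g" "f' \<in> cls X Y f" for f' g'
    using that assms by (auto simp: cls_eq_iff mem_cls_iff Comp_hom intro!: le_Comp)
  moreover have "g \<in> cls Y Z g" "f \<in> cls X Y f" using assms by (simp_all add: cls_self)
  ultimately have "(\<Union>g'\<in>cls Y Z g. \<Union>f'\<in>cls X Y f. cls X Z (Comp K X Y Z g' f')) = cls X Z (Comp K X Y Z g f)"
    by blast
  then show ?thesis by (simp add: quotient_quant_def cls_def)
qed

text \<open>
  The order of the quotient is defined by \<open>[f] \<le> [g]\<close> iff \<open>[f \<squnion> g] = [g]\<close>; as \<open>f \<squnion> g\<close> is also a join for
  the preorder, this says that \<open>f\<close> lies below \<open>g\<close> in the preorder.
\<close>

lemma Leq_B:
  assumes "X \<in> Ob K" "Y \<in> Ob K" "f \<in> Hom K X Y" "g \<in> Hom K X Y"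
  shows "Leq B X Y (cls X Y f) (cls X Y g) \<longleftrightarrow> le X Y f g"
proof
  assume "Leq B X Y (cls X Y f) (cls X Y g)"
  then obtain f' g' where *: "f' \<in> cls X Y f" "g' \<in> cls X Y g" "f' \<squnion>\<^bsub>hom_order K X Y\<^esub> g' \<in> cls X Y g"
    by (auto simp: quotient_quant_def)
  then have mem: "f' \<in> Hom K X Y" "g' \<in> Hom K X Y" "le X Y f f'"
    and "le X Y (f' \<squnion>\<^bsub>hom_order K X Y\<^esub> g') g"
    using assms by (simp_all add: mem_cls_iff)
  then have "le X Y f' g" using assms by (simp add: join_le_iff)
  then show "le X Y f g" using le_trans mem assms by blast
next
  assume "le X Y f g"
  then have "f \<squnion>\<^bsub>hom_order K X Y\<^esub> g \<in> cls X Y g"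
    using assms join_le_iff[of X Y f g "f \<squnion>\<^bsub>hom_order K X Y\<^esub> g"]
    by (auto simp: mem_cls_iff join_hom join_le_iff le_refl)
  then show "Leq B X Y (cls X Y f) (cls X Y g)"
    using assms cls_self unfolding quotient_quant_def by fastforce
qed

lemma ordered_category_B: "ordered_category B"
proof (unfold_locales, unfold Ob_B)
  fix X Y Z f f' g g'
  assume *: "Leq B X Y f f'" "Leq B Y Z g g'" "X \<in> Ob K" "Y \<in> Ob K" "Z \<in> Ob K"
    "f \<in> Hom B X Y" "f' \<in> Hom B X Y" "g \<in> Hom B Y Z" "g' \<in> Hom B Y Z"
  then show "Leq B X Z (Comp B X Y Z g f) (Comp B X Y Z g' f')"
    by (auto simp: Hom_B Comp_B Leq_B Comp_hom intro: le_Comp)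
next
  fix X Y f g h
  assume "Leq B X Y f g" "Leq B X Y g h" "X \<in> Ob K" "Y \<in> Ob K"
    "f \<in> Hom B X Y" "g \<in> Hom B X Y" "h \<in> Hom B X Y"
  then show "Leq B X Y f h" by (auto simp: Hom_B Leq_B elim: le_trans)
next
  fix X Y f g
  assume "Leq B X Y f g" "Leq B X Y g f" "X \<in> Ob K" "Y \<in> Ob K" "f \<in> Hom B X Y" "g \<in> Hom B X Y"
  moreover from this obtain f' g' where "f' \<in> Hom K X Y" "g' \<in> Hom K X Y" "f = cls X Y f'" "g = cls X Y g'"
    by (auto simp: Hom_B)
  ultimately show "f = g" by (simp add: Leq_B cls_eq_iff)
qed (auto simp: Hom_B Ident_B Comp_B Leq_B Ident_hom Comp_hom Comp_assoc Comp_Ident Ident_Comp le_refl)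

lemma quantaloid_B: "quantaloid B"
  by (rule ordered_category.quantaloid_by_surjection[where G = "\<lambda>X. X" and K = K and \<Phi> = cls and le = le,
        OF ordered_category_B]; (unfold Ob_B)?)
    (simp_all add: Comp_hom Hom_B Comp_B Leq_B le_sup)

end

section \<open>The quantaloid of back diagonals\<close>

context quantaloid
begin

lemma ChuCon_simps:
  "Ob (ChuCon C) = arrows C"
  "Hom (ChuCon C) (X1, Y1, f) (X2, Y2, g) = {(u, v). u \<in> Hom C X1 X2 \<and> v \<in> Hom C Y1 Y2 \<and>
       limp C X1 X2 Y1 f u = rimp C X2 Y1 Y2 v g}"
  "Comp (ChuCon C) (X1, Y1, f) (X2, Y2, g) (X3, Y3, h) (u', v') (u, v) =
     (Comp C X1 X2 X3 u' u, Comp C Y1 Y2 Y3 v' v)"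
  "Ident (ChuCon C) (X, Y, f) = (Ident C X, Ident C Y)"
  "Leq (ChuCon C) (X1, Y1, f) (X2, Y2, g) (u, v) (u', v') \<longleftrightarrow> Leq C X1 X2 u u' \<and> Leq C Y1 Y2 v v'"
  by (simp_all add: ChuCon_def)

lemma arrows_iff: "(X, Y, f) \<in> arrows C \<longleftrightarrow> X \<in> Ob C \<and> Y \<in> Ob C \<and> f \<in> Hom C X Y"
  by (simp add: arrows_def)

lemma chu_comp:
  assumes "X1 \<in> Ob C" "Y1 \<in> Ob C" "X2 \<in> Ob C" "Y2 \<in> Ob C" "X3 \<in> Ob C" "Y3 \<in> Ob C"
    and "f \<in> Hom C X1 Y1" "g \<in> Hom C X2 Y2" "h \<in> Hom C X3 Y3"
    and "u \<in> Hom C X1 X2" "v \<in> Hom C Y1 Y2" "u' \<in> Hom C X2 X3" "v' \<in> Hom C Y2 Y3"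
    and "limp C X1 X2 Y1 f u = rimp C X2 Y1 Y2 v g" "limp C X2 X3 Y2 g u' = rimp C X3 Y2 Y3 v' h"
  shows "limp C X1 X3 Y1 f (Comp C X1 X2 X3 u' u) = rimp C X3 Y1 Y3 (Comp C Y1 Y2 Y3 v' v) h"
  using assms by (simp add: limp_comp limp_rimp rimp_comp)

lemma ordered_category_ChuCon: "ordered_category (ChuCon C)"
proof
  fix X Y f g h
  assume "Leq (ChuCon C) X Y f g" "Leq (ChuCon C) X Y g h" "X \<in> Ob (ChuCon C)" "Y \<in> Ob (ChuCon C)"
    "f \<in> Hom (ChuCon C) X Y" "g \<in> Hom (ChuCon C) X Y" "h \<in> Hom (ChuCon C) X Y"
  then show "Leq (ChuCon C) X Y f h"
    by (cases X; cases Y; cases f; cases g; cases h) (auto simp: ChuCon_simps arrows_iff elim: Leq_trans)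
qed (auto simp: ChuCon_simps arrows_iff ident_in comp_in comp_assoc comp_ident_left comp_ident_right
      limp_ident rimp_ident chu_comp Leq_refl intro: Leq_antisym Comp_mono)

text \<open>
  The preorder on Chu connections whose induced equivalence is \<open>\<sim>\<close>: larger Chu connections have
  smaller diagonals \<open>f \<swarrow> u\<close>.
\<close>

definition back_le :: "('o, 'a) arr \<Rightarrow> ('o, 'a) arr \<Rightarrow> 'a \<times> 'a \<Rightarrow> 'a \<times> 'a \<Rightarrow> bool" where
  "back_le = (\<lambda>(X1, Y1, f) (X2, Y2, g) (u, v) (u', v').
     Leq C X2 Y1 (limp C X1 X2 Y1 f u') (limp C X1 X2 Y1 f u))"

lemma back_le_iff: "back_le (X1, Y1, f) (X2, Y2, g) (u, v) (u', v') \<longleftrightarrow>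
    Leq C X2 Y1 (limp C X1 X2 Y1 f u') (limp C X1 X2 Y1 f u)"
  by (simp add: back_le_def)

text \<open>
  Comparing diagonals through the arrows \<open>k\<close> below them removes the implications, so that
  compatibility with joins and with precomposition reduces to properties of composition in \<open>C\<close>.
\<close>

lemma back_le_iff_below:
  assumes "X1 \<in> Ob C" "Y1 \<in> Ob C" "X2 \<in> Ob C" "f \<in> Hom C X1 Y1" "u \<in> Hom C X1 X2" "u' \<in> Hom C X1 X2"
  shows "back_le (X1, Y1, f) (X2, Y2, g) (u, v) (u', v') \<longleftrightarrow>
    (\<forall>k\<in>Hom C X2 Y1. Leq C X1 Y1 (Comp C X1 X2 Y1 k u') f \<longrightarrow> Leq C X1 Y1 (Comp C X1 X2 Y1 k u) f)"
proof -
  let ?r = "limp C X1 X2 Y1 f u" and ?r' = "limp C X1 X2 Y1 f u'"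
  have r: "?r \<in> Hom C X2 Y1" "?r' \<in> Hom C X2 Y1" using assms by (simp_all add: limp_hom)
  have "Leq C X2 Y1 ?r' ?r \<longleftrightarrow> (\<forall>k\<in>Hom C X2 Y1. Leq C X2 Y1 k ?r' \<longrightarrow> Leq C X2 Y1 k ?r)"
    using r assms Leq_refl Leq_trans[of X2 Y1] by blast
  then show ?thesis using assms by (simp add: back_le_iff le_limp_iff)
qed

text \<open>
  Joins are componentwise, since \<open>f \<swarrow> \<Squnion>u\<^sub>i\<close> and \<open>\<Squnion>v\<^sub>i \<searrow> g\<close> are the meets of the common diagonals
  \<open>f \<swarrow> u\<^sub>i = v\<^sub>i \<searrow> g\<close>.
\<close>

lemma chu_sup:
  assumes "X1 \<in> Ob C" "Y1 \<in> Ob C" "X2 \<in> Ob C" "Y2 \<in> Ob C" "f \<in> Hom C X1 Y1" "g \<in> Hom C X2 Y2"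
    and S: "S \<subseteq> Hom (ChuCon C) (X1, Y1, f) (X2, Y2, g)"
  defines "s \<equiv> (\<Squnion>\<^bsub>hom_order C X1 X2\<^esub> (fst ` S), \<Squnion>\<^bsub>hom_order C Y1 Y2\<^esub> (snd ` S))"
  shows "s \<in> Hom (ChuCon C) (X1, Y1, f) (X2, Y2, g)"
    and "\<Squnion>\<^bsub>hom_order (ChuCon C) (X1, Y1, f) (X2, Y2, g)\<^esub> S = s"
proof -
  let ?u = "\<Squnion>\<^bsub>hom_order C X1 X2\<^esub> (fst ` S)" and ?v = "\<Squnion>\<^bsub>hom_order C Y1 Y2\<^esub> (snd ` S)"
  have sub: "fst ` S \<subseteq> Hom C X1 X2" "snd ` S \<subseteq> Hom C Y1 Y2"
    using S by (auto simp: ChuCon_simps)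
  have uv: "?u \<in> Hom C X1 X2" "?v \<in> Hom C Y1 Y2" using sub assms by (simp_all add: sup_hom)
  have "limp C X1 X2 Y1 f ?u = rimp C X2 Y1 Y2 ?v g"
  proof (rule Leq_below_ext[of X2 Y1])
    fix k assume k: "k \<in> Hom C X2 Y1"
    have "Leq C X1 Y1 (Comp C X1 X2 Y1 k (fst c)) f \<longleftrightarrow> Leq C X2 Y2 (Comp C X2 Y1 Y2 (snd c) k) g"
      if "c \<in> S" for c
    proof -
      obtain u v where c: "c = (u, v)" by fastforce
      then have "u \<in> Hom C X1 X2" "v \<in> Hom C Y1 Y2" "limp C X1 X2 Y1 f u = rimp C X2 Y1 Y2 v g"
        using S that by (auto simp: ChuCon_simps)
      then show ?thesis
        using le_limp_iff[of X1 X2 Y1 u f k] le_rimp_iff[of X2 Y1 Y2 v g k] assms k c by simp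
    qed
    then show "Leq C X2 Y1 k (limp C X1 X2 Y1 f ?u) \<longleftrightarrow> Leq C X2 Y1 k (rimp C X2 Y1 Y2 ?v g)"
      using assms k uv sub by (simp add: le_limp_iff le_rimp_iff comp_sup_le_iff sup_comp_le_iff)
  qed (use assms uv in \<open>auto intro: limp_hom rimp_hom\<close>)
  then show s: "s \<in> Hom (ChuCon C) (X1, Y1, f) (X2, Y2, g)"
    using uv by (simp add: s_def ChuCon_simps)
  show "\<Squnion>\<^bsub>hom_order (ChuCon C) (X1, Y1, f) (X2, Y2, g)\<^esub> S = s"
  proof (rule ordered_category.sup_eqI[OF ordered_category_ChuCon])
    fix h assume "h \<in> Hom (ChuCon C) (X1, Y1, f) (X2, Y2, g)"
    then obtain u v where h: "h = (u, v)" "u \<in> Hom C X1 X2" "v \<in> Hom C Y1 Y2"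
      by (auto simp: ChuCon_simps)
    show "Leq (ChuCon C) (X1, Y1, f) (X2, Y2, g) s h \<longleftrightarrow>
      (\<forall>c\<in>S. Leq (ChuCon C) (X1, Y1, f) (X2, Y2, g) c h)"
      using assms(1-6) sub h by (fastforce simp: s_def sup_le_iff ChuCon_simps)
  qed (use assms s in \<open>auto simp: ChuCon_simps arrows_iff\<close>)
qed

lemma back_le_comp_left:
  assumes "X1 \<in> Ob C" "Y1 \<in> Ob C" "X2 \<in> Ob C" "X3 \<in> Ob C" "f \<in> Hom C X1 Y1"
    and "u \<in> Hom C X1 X2" "u' \<in> Hom C X1 X2" "w \<in> Hom C X2 X3"
    and le: "back_le (X1, Y1, f) (X2, Y2, g) (u, v) (u', v')"
  shows "back_le (X1, Y1, f) (X3, Y3, h) (Comp C X1 X2 X3 w u, x) (Comp C X1 X2 X3 w u', x')"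
  using le assms(1-8) by (auto simp: back_le_iff_below comp_in comp_assoc)

text \<open>
  The diagonal of a composite is \<open>f \<swarrow> (w \<circ> u) = (v \<searrow> g) \<swarrow> w = v \<searrow> (g \<swarrow> w)\<close>, which is monotone in the
  diagonal \<open>g \<swarrow> w\<close> of the second factor. This is where the Chu condition on the first factor enters.
\<close>

lemma back_le_comp_right:
  assumes "X1 \<in> Ob C" "Y1 \<in> Ob C" "X2 \<in> Ob C" "Y2 \<in> Ob C" "X3 \<in> Ob C"
    and "f \<in> Hom C X1 Y1" "g \<in> Hom C X2 Y2"
    and "u \<in> Hom C X1 X2" "v \<in> Hom C Y1 Y2" "w \<in> Hom C X2 X3" "w' \<in> Hom C X2 X3"
    and chu: "limp C X1 X2 Y1 f u = rimp C X2 Y1 Y2 v g"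
    and le: "back_le (X2, Y2, g) (X3, Y3, h) (w, z) (w', z')"
  shows "back_le (X1, Y1, f) (X3, Y3, h) (Comp C X1 X2 X3 w u, x) (Comp C X1 X2 X3 w' u, x')"
proof -
  have "limp C X1 X3 Y1 f (Comp C X1 X2 X3 w u) = rimp C X3 Y1 Y2 v (limp C X2 X3 Y2 g w)"
    if "w \<in> Hom C X2 X3" for w
    using assms that by (simp add: limp_comp limp_rimp)
  moreover have "Leq C X3 Y1 (rimp C X3 Y1 Y2 v (limp C X2 X3 Y2 g w')) (rimp C X3 Y1 Y2 v (limp C X2 X3 Y2 g w))"
  proof -
    let ?n = "limp C X2 X3 Y2 g w" and ?n' = "limp C X2 X3 Y2 g w'"
    have "?n \<in> Hom C X3 Y2" "?n' \<in> Hom C X3 Y2" "Leq C X3 Y2 ?n' ?n"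
      using assms le by (auto simp: back_le_iff limp_hom)
    moreover from this have r: "rimp C X3 Y1 Y2 v ?n' \<in> Hom C X3 Y1" using assms by (simp add: rimp_hom)
    moreover have "Leq C X3 Y2 (Comp C X3 Y1 Y2 v (rimp C X3 Y1 Y2 v ?n')) ?n'"
      using assms calculation by (subst le_rimp_iff[symmetric]) (auto intro: Leq_refl)
    ultimately show ?thesis
      using assms by (subst le_rimp_iff) (auto intro: comp_in elim: Leq_trans)
  qed
  ultimately show ?thesis using assms by (simp add: back_le_iff)
qed

lemma ordered_congruence_back: "ordered_congruence (ChuCon C) back_le (back_cong C)"
proof (intro ordered_congruence.intro ordered_category_ChuCon ordered_congruence_axioms.intro)
  fix X Y assume "X \<in> Ob (ChuCon C)" "Y \<in> Ob (ChuCon C)"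
  then show "back_cong C X Y = {(f, g). f \<in> Hom (ChuCon C) X Y \<and> g \<in> Hom (ChuCon C) X Y \<and>
      back_le X Y f g \<and> back_le X Y g f}"
    by (cases X; cases Y) (auto simp: back_cong_def back_le_iff ChuCon_simps arrows_iff rimp_hom Leq_refl
        intro!: Leq_antisym[OF _ _ _ _ rimp_hom rimp_hom])
next
  fix X Y f assume "X \<in> Ob (ChuCon C)" "Y \<in> Ob (ChuCon C)" "f \<in> Hom (ChuCon C) X Y"
  then show "back_le X Y f f"
    by (cases X; cases Y; cases f) (auto simp: back_le_iff_below ChuCon_simps arrows_iff)
next
  fix X Y f g h
  assume "back_le X Y f g" "back_le X Y g h" "X \<in> Ob (ChuCon C)" "Y \<in> Ob (ChuCon C)"
    "f \<in> Hom (ChuCon C) X Y" "g \<in> Hom (ChuCon C) X Y" "h \<in> Hom (ChuCon C) X Y"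
  then show "back_le X Y f h"
    by (cases X; cases Y; cases f; cases g; cases h)
      (auto simp: back_le_iff_below ChuCon_simps arrows_iff)
next
  fix X Y Z c c' d d'
  assume *: "back_le X Y c c'" "back_le Y Z d d'"
    "X \<in> Ob (ChuCon C)" "Y \<in> Ob (ChuCon C)" "Z \<in> Ob (ChuCon C)"
    "c \<in> Hom (ChuCon C) X Y" "c' \<in> Hom (ChuCon C) X Y" "d \<in> Hom (ChuCon C) Y Z" "d' \<in> Hom (ChuCon C) Y Z"
  obtain X1 Y1 f X2 Y2 g X3 Y3 h u v u' v' w z w' z' where eq: "X = (X1, Y1, f)" "Y = (X2, Y2, g)"
    "Z = (X3, Y3, h)" "c = (u, v)" "c' = (u', v')" "d = (w, z)" "d' = (w', z')"
    by (metis surj_pair)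
  have "back_le X Z (Comp (ChuCon C) X Y Z d c) (Comp (ChuCon C) X Y Z d c')"
    using * unfolding eq ChuCon_simps arrows_iff
    by (intro back_le_comp_left[of X1 Y1 X2 X3 f u u' w Y2 g v v']) auto
  moreover have "back_le X Z (Comp (ChuCon C) X Y Z d c') (Comp (ChuCon C) X Y Z d' c')"
    using * unfolding eq ChuCon_simps arrows_iff
    by (intro back_le_comp_right[of X1 Y1 X2 Y2 X3 f g u' v' w w' Y3 h z z']) auto
  ultimately show "back_le X Z (Comp (ChuCon C) X Y Z d c) (Comp (ChuCon C) X Y Z d' c')"
    using * unfolding eq ChuCon_simps arrows_iff by (auto simp: back_le_iff_below comp_in)
next
  fix X Y c d assume *: "X \<in> Ob (ChuCon C)" "Y \<in> Ob (ChuCon C)" "c \<in> Hom (ChuCon C) X Y" "d \<in> Hom (ChuCon C) X Y"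
  obtain X1 Y1 f X2 Y2 g u v u' v' where eq: "X = (X1, Y1, f)" "Y = (X2, Y2, g)" "c = (u, v)" "d = (u', v')"
    by (metis surj_pair)
  have S: "{c, d} \<subseteq> Hom (ChuCon C) (X1, Y1, f) (X2, Y2, g)" using * eq by simp
  have mem: "X1 \<in> Ob C" "Y1 \<in> Ob C" "X2 \<in> Ob C" "Y2 \<in> Ob C" "f \<in> Hom C X1 Y1" "g \<in> Hom C X2 Y2"
    "u \<in> Hom C X1 X2" "u' \<in> Hom C X1 X2"
    using * eq by (auto simp: ChuCon_simps arrows_iff)
  note sup = chu_sup[OF mem(1-6) S]
  show "c \<squnion>\<^bsub>hom_order (ChuCon C) X Y\<^esub> d \<in> Hom (ChuCon C) X Y"
    using sup eq by (simp add: join_def)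
  fix h assume "h \<in> Hom (ChuCon C) X Y"
  then obtain w z where h: "h = (w, z)" "w \<in> Hom C X1 X2" using eq by (auto simp: ChuCon_simps)
  show "back_le X Y (c \<squnion>\<^bsub>hom_order (ChuCon C) X Y\<^esub> d) h \<longleftrightarrow> back_le X Y c h \<and> back_le X Y d h"
    using sup(2) mem h(2) by (auto simp: join_def eq h(1) back_le_iff_below sup_hom comp_sup_le_iff)
next
  fix X Y S assume *: "X \<in> Ob (ChuCon C)" "Y \<in> Ob (ChuCon C)" "S \<subseteq> Hom (ChuCon C) X Y"
  obtain X1 Y1 f X2 Y2 g where eq: "X = (X1, Y1, f)" "Y = (X2, Y2, g)" by (metis surj_pair)
  have mem: "X1 \<in> Ob C" "Y1 \<in> Ob C" "X2 \<in> Ob C" "Y2 \<in> Ob C" "f \<in> Hom C X1 Y1" "g \<in> Hom C X2 Y2"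
    using * eq by (auto simp: ChuCon_simps arrows_iff)
  let ?u = "\<Squnion>\<^bsub>hom_order C X1 X2\<^esub> (fst ` S)" and ?v = "\<Squnion>\<^bsub>hom_order C Y1 Y2\<^esub> (snd ` S)"
  have s: "(?u, ?v) \<in> Hom (ChuCon C) X Y" using chu_sup(1)[OF mem, of S] * eq by simp
  have sub: "fst ` S \<subseteq> Hom C X1 X2" using * eq by (auto simp: ChuCon_simps)
  have uv: "?u \<in> Hom C X1 X2" using s eq by (simp add: ChuCon_simps)
  show "\<exists>s. stable_join (ChuCon C) back_le X Y S s"
    unfolding stable_join_def
  proof (intro exI[of _ "(?u, ?v)"] conjI ballI s)
    fix h assume "h \<in> Hom (ChuCon C) X Y"
    then obtain w z where h: "h = (w, z)" "w \<in> Hom C X1 X2" using eq by (auto simp: ChuCon_simps)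
    have "back_le X Y c h \<longleftrightarrow> (\<forall>k\<in>Hom C X2 Y1. Leq C X1 Y1 (Comp C X1 X2 Y1 k w) f \<longrightarrow>
      Leq C X1 Y1 (Comp C X1 X2 Y1 k (fst c)) f)" if "fst c \<in> Hom C X1 X2" for c
      using mem h that by (cases c) (simp add: eq back_le_iff_below)
    then show "back_le X Y (?u, ?v) h \<longleftrightarrow> (\<forall>c\<in>S. back_le X Y c h)"
      using mem sub h uv by (auto simp: comp_sup_le_iff image_subset_iff)
  next
    fix Z d h assume Z: "Z \<in> Ob (ChuCon C)" "d \<in> Hom (ChuCon C) Y Z" "h \<in> Hom (ChuCon C) X Z"
    then obtain X3 Y3 q w z a b where eq': "Z = (X3, Y3, q)" "d = (w, z)" "h = (a, b)" "X3 \<in> Ob C"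
      "w \<in> Hom C X2 X3" "a \<in> Hom C X1 X3" using eq by (cases Z) (auto simp: ChuCon_simps arrows_iff)
    have "back_le X Z (Comp (ChuCon C) X Y Z d c) h \<longleftrightarrow> (\<forall>k\<in>Hom C X3 Y1. Leq C X1 Y1 (Comp C X1 X3 Y1 k a) f \<longrightarrow>
      Leq C X1 Y1 (Comp C X1 X2 Y1 (Comp C X2 X3 Y1 k w) (fst c)) f)" if "fst c \<in> Hom C X1 X2" for c
      using mem eq' that by (cases c) (simp add: eq back_le_iff_below ChuCon_simps comp_in comp_assoc)
    then show "back_le X Z (Comp (ChuCon C) X Y Z d (?u, ?v)) h \<longleftrightarrow>
        (\<forall>c\<in>S. back_le X Z (Comp (ChuCon C) X Y Z d c) h)"
      using mem sub eq' uv by (auto simp: comp_sup_le_iff image_subset_iff comp_in)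
  next
    fix Z d h assume Z: "Z \<in> Ob (ChuCon C)" "d \<in> Hom (ChuCon C) Z X" "h \<in> Hom (ChuCon C) Z Y"
    then obtain X3 Y3 q w z a b where eq': "Z = (X3, Y3, q)" "d = (w, z)" "h = (a, b)" "X3 \<in> Ob C"
      "Y3 \<in> Ob C" "q \<in> Hom C X3 Y3"
      "w \<in> Hom C X3 X1" "a \<in> Hom C X3 X2" using eq by (cases Z) (auto simp: ChuCon_simps arrows_iff)
    let ?n = "limp C X3 X1 Y3 q w"
    have n: "?n \<in> Hom C X1 Y3" using eq' mem by (simp add: limp_hom)
    have "back_le Z Y (Comp (ChuCon C) Z X Y c d) h \<longleftrightarrow> (\<forall>k\<in>Hom C X2 Y3. Leq C X3 Y3 (Comp C X3 X2 Y3 k a) q \<longrightarrow>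
      Leq C X1 Y3 (Comp C X1 X2 Y3 k (fst c)) ?n)" if "fst c \<in> Hom C X1 X2" for c
      using mem eq' that by (cases c) (simp add: eq back_le_iff_below ChuCon_simps comp_in comp_assoc le_limp_iff)
    then show "back_le Z Y (Comp (ChuCon C) Z X Y (?u, ?v) d) h \<longleftrightarrow>
        (\<forall>c\<in>S. back_le Z Y (Comp (ChuCon C) Z X Y c d) h)"
      using mem sub eq' uv n by (auto simp: comp_sup_le_iff image_subset_iff comp_in)
  qed
qed

sublocale bdiag: ordered_congruence "ChuCon C" back_le "back_cong C"
  by (rule ordered_congruence_back)

lemma quantaloid_back_diagonals: "quantaloid (back_diagonals C)"
  unfolding back_diagonals_def by (rule bdiag.quantaloid_B)

end

section \<open>Equivalences of quantaloids from order isomorphisms on hom-sets\<close>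

definition order_fully_faithful ::
  "('o, 'a) quant \<Rightarrow> ('p, 'b) quant \<Rightarrow> ('o \<Rightarrow> 'p) \<Rightarrow> ('o \<Rightarrow> 'o \<Rightarrow> 'a \<Rightarrow> 'b) \<Rightarrow> bool" where
  "order_fully_faithful C D Fo Fa \<longleftrightarrow> is_functor C D Fo Fa \<and>
     (\<forall>X\<in>Ob C. \<forall>Y\<in>Ob C. Fa X Y ` Hom C X Y = Hom D (Fo X) (Fo Y) \<and>
        (\<forall>f\<in>Hom C X Y. \<forall>g\<in>Hom C X Y. Leq D (Fo X) (Fo Y) (Fa X Y f) (Fa X Y g) \<longleftrightarrow> Leq C X Y f g))"

text \<open>
  The codomain \<open>D\<close> is only assumed to be enriched in posets; that it is a quantaloid is a conclusion.
\<close>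

locale order_equivalence = C: quantaloid C + D: ordered_category D
  for C :: "('o, 'a) quant" and D :: "('p, 'b) quant" +
  fixes Fo :: "'o \<Rightarrow> 'p" and Fa :: "'o \<Rightarrow> 'o \<Rightarrow> 'a \<Rightarrow> 'b"
  assumes F: "order_fully_faithful C D Fo Fa"
    and surj: "E \<in> Ob D \<Longrightarrow> \<exists>X\<in>Ob C. \<exists>e. is_iso D (Fo X) E e"
begin

lemma Fo_ob: "X \<in> Ob C \<Longrightarrow> Fo X \<in> Ob D"
  and Fa_hom: "\<lbrakk>X \<in> Ob C; Y \<in> Ob C; f \<in> Hom C X Y\<rbrakk> \<Longrightarrow> Fa X Y f \<in> Hom D (Fo X) (Fo Y)"
  and Fa_ident: "X \<in> Ob C \<Longrightarrow> Fa X X (Ident C X) = Ident D (Fo X)"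
  and Fa_comp: "\<lbrakk>X \<in> Ob C; Y \<in> Ob C; Z \<in> Ob C; f \<in> Hom C X Y; g \<in> Hom C Y Z\<rbrakk> \<Longrightarrow>
    Fa X Z (Comp C X Y Z g f) = Comp D (Fo X) (Fo Y) (Fo Z) (Fa Y Z g) (Fa X Y f)"
  and Fa_surj: "\<lbrakk>X \<in> Ob C; Y \<in> Ob C; h \<in> Hom D (Fo X) (Fo Y)\<rbrakk> \<Longrightarrow> \<exists>f\<in>Hom C X Y. Fa X Y f = h"
  and Fa_leq: "\<lbrakk>X \<in> Ob C; Y \<in> Ob C; f \<in> Hom C X Y; g \<in> Hom C X Y\<rbrakk> \<Longrightarrow>
    Leq D (Fo X) (Fo Y) (Fa X Y f) (Fa X Y g) \<longleftrightarrow> Leq C X Y f g"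
proof -
  note F' = F[unfolded order_fully_faithful_def is_functor_def]
  show "X \<in> Ob C \<Longrightarrow> Fo X \<in> Ob D"
    "\<lbrakk>X \<in> Ob C; Y \<in> Ob C; f \<in> Hom C X Y\<rbrakk> \<Longrightarrow> Fa X Y f \<in> Hom D (Fo X) (Fo Y)"
    "X \<in> Ob C \<Longrightarrow> Fa X X (Ident C X) = Ident D (Fo X)"
    "\<lbrakk>X \<in> Ob C; Y \<in> Ob C; Z \<in> Ob C; f \<in> Hom C X Y; g \<in> Hom C Y Z\<rbrakk> \<Longrightarrow>
      Fa X Z (Comp C X Y Z g f) = Comp D (Fo X) (Fo Y) (Fo Z) (Fa Y Z g) (Fa X Y f)"
    "\<lbrakk>X \<in> Ob C; Y \<in> Ob C; f \<in> Hom C X Y; g \<in> Hom C X Y\<rbrakk> \<Longrightarrow>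
      Leq D (Fo X) (Fo Y) (Fa X Y f) (Fa X Y g) \<longleftrightarrow> Leq C X Y f g"
    using F' by (auto simp: Pi_iff)
  assume "X \<in> Ob C" "Y \<in> Ob C" "h \<in> Hom D (Fo X) (Fo Y)"
  then have "h \<in> Fa X Y ` Hom C X Y" using F' by blast
  then show "\<exists>f\<in>Hom C X Y. Fa X Y f = h" by blast
qed

lemma Fa_inj:
  "\<lbrakk>X \<in> Ob C; Y \<in> Ob C; f \<in> Hom C X Y; g \<in> Hom C X Y; Fa X Y f = Fa X Y g\<rbrakk> \<Longrightarrow> f = g"
  by (metis C.Leq_antisym C.Leq_refl Fa_leq)

text \<open>
  A pseudo-inverse on objects, with chosen isomorphisms \<open>into E\<close> from \<open>Fo (G E)\<close> to \<open>E\<close> and inverse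
  \<open>out E\<close>.
\<close>

definition G :: "'p \<Rightarrow> 'o" where
  "G E = (SOME X. X \<in> Ob C \<and> (\<exists>e. is_iso D (Fo X) E e))"

definition into :: "'p \<Rightarrow> 'b" where
  "into E = (SOME e. is_iso D (Fo (G E)) E e)"

definition out :: "'p \<Rightarrow> 'b" where
  "out E = (SOME e. e \<in> Hom D E (Fo (G E)) \<and>
     Comp D (Fo (G E)) E (Fo (G E)) e (into E) = Ident D (Fo (G E)) \<and>
     Comp D E (Fo (G E)) E (into E) e = Ident D E)"

lemma
  assumes "E \<in> Ob D"
  shows G_ob: "G E \<in> Ob C"
    and into_hom: "into E \<in> Hom D (Fo (G E)) E"
    and out_hom: "out E \<in> Hom D E (Fo (G E))"
    and out_into: "Comp D (Fo (G E)) E (Fo (G E)) (out E) (into E) = Ident D (Fo (G E))"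
    and into_out: "Comp D E (Fo (G E)) E (into E) (out E) = Ident D E"
proof -
  have G: "G E \<in> Ob C \<and> (\<exists>e. is_iso D (Fo (G E)) E e)"
    unfolding G_def by (rule someI_ex) (use surj[OF assms] in blast)
  then have e: "is_iso D (Fo (G E)) E (into E)"
    unfolding into_def using someI_ex[of "is_iso D (Fo (G E)) E"] by blast
  have "out E \<in> Hom D E (Fo (G E)) \<and>
     Comp D (Fo (G E)) E (Fo (G E)) (out E) (into E) = Ident D (Fo (G E)) \<and>
     Comp D E (Fo (G E)) E (into E) (out E) = Ident D E"
    unfolding out_def by (rule someI_ex) (use e in \<open>unfold is_iso_def, blast\<close>)
  then show "G E \<in> Ob C" "into E \<in> Hom D (Fo (G E)) E" "out E \<in> Hom D E (Fo (G E))"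
    "Comp D (Fo (G E)) E (Fo (G E)) (out E) (into E) = Ident D (Fo (G E))"
    "Comp D E (Fo (G E)) E (into E) (out E) = Ident D E"
    using G e unfolding is_iso_def by blast+
qed

definition Ga :: "'p \<Rightarrow> 'p \<Rightarrow> 'b \<Rightarrow> 'a" where
  "Ga E E' h = (SOME f. f \<in> Hom C (G E) (G E') \<and> Fa (G E) (G E') f =
     Comp D (Fo (G E)) E' (Fo (G E')) (out E') (Comp D (Fo (G E)) E E' h (into E)))"

text \<open>
  Conjugating with the chosen isomorphisms makes the functor act between hom-sets of arbitrary objects
  of \<open>D\<close>. The map \<open>\<Phi> E E'\<close> is an order isomorphism inverse to \<open>Ga E E'\<close>, and it is functorial, so
  \<open>Ga\<close> is functorial as well.
\<close>

definition \<Phi> :: "'p \<Rightarrow> 'p \<Rightarrow> 'a \<Rightarrow> 'b" where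
  "\<Phi> E E' f = Comp D E (Fo (G E')) E' (into E') (Comp D E (Fo (G E)) (Fo (G E')) (Fa (G E) (G E') f) (out E))"

lemmas mem = G_ob Fo_ob into_hom out_hom Fa_hom D.Comp_hom D.Ident_hom

lemma
  assumes E: "E \<in> Ob D" "E' \<in> Ob D" and h: "h \<in> Hom D E E'"
  shows Ga_hom: "Ga E E' h \<in> Hom C (G E) (G E')"
    and Fa_Ga: "Fa (G E) (G E') (Ga E E' h) =
      Comp D (Fo (G E)) E' (Fo (G E')) (out E') (Comp D (Fo (G E)) E E' h (into E))"
proof -
  have "\<exists>f. f \<in> Hom C (G E) (G E') \<and> Fa (G E) (G E') f =
     Comp D (Fo (G E)) E' (Fo (G E')) (out E') (Comp D (Fo (G E)) E E' h (into E))"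
    using Fa_surj[of "G E" "G E'"] assms by (simp add: mem Bex_def)
  from someI_ex[OF this] show "Ga E E' h \<in> Hom C (G E) (G E')"
    "Fa (G E) (G E') (Ga E E' h) =
      Comp D (Fo (G E)) E' (Fo (G E')) (out E') (Comp D (Fo (G E)) E E' h (into E))"
    unfolding Ga_def by auto
qed

lemma \<Phi>_hom: "\<lbrakk>E \<in> Ob D; E' \<in> Ob D; f \<in> Hom C (G E) (G E')\<rbrakk> \<Longrightarrow> \<Phi> E E' f \<in> Hom D E E'"
  by (simp add: \<Phi>_def mem)

lemma \<Phi>_into:
  assumes "E \<in> Ob D" "E' \<in> Ob D" "f \<in> Hom C (G E) (G E')"
  shows "Comp D (Fo (G E)) E E' (\<Phi> E E' f) (into E)
    = Comp D (Fo (G E)) (Fo (G E')) E' (into E') (Fa (G E) (G E') f)"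
proof -
  have "Comp D (Fo (G E)) E E' (\<Phi> E E' f) (into E) =
    Comp D (Fo (G E)) (Fo (G E')) E' (into E') (Comp D (Fo (G E)) (Fo (G E)) (Fo (G E'))
      (Fa (G E) (G E') f) (Comp D (Fo (G E)) E (Fo (G E)) (out E) (into E)))"
    using assms by (simp add: \<Phi>_def D.Comp_assoc mem)
  then show ?thesis using assms by (simp add: out_into mem D.Comp_Ident)
qed

text \<open>
  Isomorphisms are epimorphisms. Together with \<open>\<Phi>_into\<close>, this proves \<open>\<Phi>_Ga\<close> and \<open>\<Phi>_comp\<close>:
  after composing with \<open>into E\<close>, the conjugation disappears.
\<close>

lemma into_cancel:
  assumes "E \<in> Ob D" "E' \<in> Ob D" "h \<in> Hom D E E'" "h' \<in> Hom D E E'"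
    and "Comp D (Fo (G E)) E E' h (into E) = Comp D (Fo (G E)) E E' h' (into E)"
  shows "h = h'"
proof -
  have "h = Comp D E (Fo (G E)) E' (Comp D (Fo (G E)) E E' h (into E)) (out E)" if "h \<in> Hom D E E'" for h
    using assms(1,2) that
    by (simp add: D.Comp_assoc[symmetric] mem into_out D.Comp_Ident)
  then show ?thesis using assms(3-5) by metis
qed

lemma \<Phi>_Ga:
  assumes E: "E \<in> Ob D" "E' \<in> Ob D" and h: "h \<in> Hom D E E'"
  shows "\<Phi> E E' (Ga E E' h) = h"
proof (rule into_cancel)
  show "Comp D (Fo (G E)) E E' (\<Phi> E E' (Ga E E' h)) (into E) = Comp D (Fo (G E)) E E' h (into E)"
    using assms by (simp add: \<Phi>_into Ga_hom Fa_Ga D.Comp_assoc mem into_out D.Ident_Comp)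
qed (use assms in \<open>simp_all add: Ga_hom \<Phi>_hom\<close>)

lemma \<Phi>_comp:
  assumes "E \<in> Ob D" "E' \<in> Ob D" "E'' \<in> Ob D" "f \<in> Hom C (G E) (G E')" "g \<in> Hom C (G E') (G E'')"
  shows "Comp D E E' E'' (\<Phi> E' E'' g) (\<Phi> E E' f) = \<Phi> E E'' (Comp C (G E) (G E') (G E'') g f)"
proof (rule into_cancel[of E E''])
  have "Comp D (Fo (G E)) E E'' (Comp D E E' E'' (\<Phi> E' E'' g) (\<Phi> E E' f)) (into E)
    = Comp D (Fo (G E)) E' E'' (\<Phi> E' E'' g) (Comp D (Fo (G E)) E E' (\<Phi> E E' f) (into E))"
    using assms by (simp add: D.Comp_assoc mem \<Phi>_hom)
  also have "\<dots> = Comp D (Fo (G E)) (Fo (G E')) E'' (Comp D (Fo (G E')) E' E'' (\<Phi> E' E'' g) (into E')) (Fa (G E) (G E') f)"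
    using assms by (simp add: \<Phi>_into D.Comp_assoc mem \<Phi>_hom)
  also have "\<dots> = Comp D (Fo (G E)) E E'' (\<Phi> E E'' (Comp C (G E) (G E') (G E'') g f)) (into E)"
    using assms by (simp add: \<Phi>_into D.Comp_assoc mem \<Phi>_hom C.Comp_hom Fa_comp)
  finally show "Comp D (Fo (G E)) E E'' (Comp D E E' E'' (\<Phi> E' E'' g) (\<Phi> E E' f)) (into E)
    = Comp D (Fo (G E)) E E'' (\<Phi> E E'' (Comp C (G E) (G E') (G E'') g f)) (into E)" .
qed (use assms in \<open>simp_all add: \<Phi>_hom mem C.Comp_hom\<close>)

lemma \<Phi>_ident: "E \<in> Ob D \<Longrightarrow> \<Phi> E E (Ident C (G E)) = Ident D E"
  by (simp add: \<Phi>_def Fa_ident mem D.Ident_Comp into_out)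

lemma \<Phi>_leq:
  assumes E: "E \<in> Ob D" "E' \<in> Ob D" and f: "f \<in> Hom C (G E) (G E')" "g \<in> Hom C (G E) (G E')"
  shows "Leq D E E' (\<Phi> E E' f) (\<Phi> E E' g) \<longleftrightarrow> Leq C (G E) (G E') f g"
proof
  assume "Leq C (G E) (G E') f g"
  then have "Leq D (Fo (G E)) (Fo (G E')) (Fa (G E) (G E') f) (Fa (G E) (G E') g)"
    using assms by (simp add: Fa_leq mem)
  then show "Leq D E E' (\<Phi> E E' f) (\<Phi> E E' g)"
    using assms unfolding \<Phi>_def by (intro D.Comp_mono) (auto simp: mem D.Leq_refl)
next
  assume le: "Leq D E E' (\<Phi> E E' f) (\<Phi> E E' g)"
  have eq: "Comp D (Fo (G E)) E' (Fo (G E')) (out E') (Comp D (Fo (G E)) E E' (\<Phi> E E' k) (into E))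
    = Fa (G E) (G E') k" if "k \<in> Hom C (G E) (G E')" for k
    using assms that by (simp add: \<Phi>_into D.Comp_assoc mem out_into D.Ident_Comp)
  have "Leq D (Fo (G E)) (Fo (G E'))
    (Comp D (Fo (G E)) E' (Fo (G E')) (out E') (Comp D (Fo (G E)) E E' (\<Phi> E E' f) (into E)))
    (Comp D (Fo (G E)) E' (Fo (G E')) (out E') (Comp D (Fo (G E)) E E' (\<Phi> E E' g) (into E)))"
    using assms le by (intro D.Comp_mono) (auto simp: mem \<Phi>_hom D.Leq_refl)
  then show "Leq C (G E) (G E') f g" using assms by (simp add: eq Fa_leq mem)
qed

lemma Ga_\<Phi>:
  assumes "E \<in> Ob D" "E' \<in> Ob D" "f \<in> Hom C (G E) (G E')"
  shows "Ga E E' (\<Phi> E E' f) = f"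
  using \<Phi>_leq[of E E' f "Ga E E' (\<Phi> E E' f)"] \<Phi>_leq[of E E' "Ga E E' (\<Phi> E E' f)" f] assms
    C.Leq_antisym[of "G E" "G E'" f "Ga E E' (\<Phi> E E' f)"]
  by (simp add: \<Phi>_Ga \<Phi>_hom Ga_hom D.Leq_refl mem)

lemma quantaloid_D: "quantaloid D"
proof (rule D.quantaloid_by_surjection[where G = G and K = C and \<Phi> = \<Phi> and le = "Leq C"])
  show "Hom D E E' = \<Phi> E E' ` Hom C (G E) (G E')" if "E \<in> Ob D" "E' \<in> Ob D" for E E'
    using that Ga_hom \<Phi>_Ga \<Phi>_hom by (auto simp: image_iff) metis
next
  fix X Y S assume *: "X \<in> Ob C" "Y \<in> Ob C" "S \<subseteq> Hom C X Y"
  have "stable_join C (Leq C) X Y S (\<Squnion>\<^bsub>hom_order C X Y\<^esub> S)"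
    using * by (simp add: stable_join_def C.sup_hom C.sup_le_iff C.comp_sup_le_iff C.sup_comp_le_iff)
  then show "\<exists>s. stable_join C (Leq C) X Y S s" ..
qed (simp_all add: mem C.Comp_hom \<Phi>_comp \<Phi>_leq)

lemma Fa_sup:
  assumes "X \<in> Ob C" "Y \<in> Ob C" "S \<subseteq> Hom C X Y"
  shows "Fa X Y (\<Squnion>\<^bsub>hom_order C X Y\<^esub> S) = \<Squnion>\<^bsub>hom_order D (Fo X) (Fo Y)\<^esub> (Fa X Y ` S)"
proof (rule D.sup_eqI[symmetric])
  fix h assume "h \<in> Hom D (Fo X) (Fo Y)"
  then obtain k where k: "k \<in> Hom C X Y" "h = Fa X Y k" using Fa_surj assms by blast
  show "Leq D (Fo X) (Fo Y) (Fa X Y (\<Squnion>\<^bsub>hom_order C X Y\<^esub> S)) h \<longleftrightarrow>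
    (\<forall>f\<in>Fa X Y ` S. Leq D (Fo X) (Fo Y) f h)"
    using assms k by (auto simp: Fa_leq C.sup_hom C.sup_le_iff subset_iff)
qed (use assms in \<open>auto simp: Fo_ob intro!: Fa_hom C.sup_hom\<close>)

lemma Ga_functor: "is_functor D C G Ga"
proof -
  have "Ga E E (Ident D E) = Ident C (G E)" if "E \<in> Ob D" for E
    using Ga_\<Phi>[of E E "Ident C (G E)"] that by (simp add: \<Phi>_ident mem C.Ident_hom)
  moreover have "Ga E E'' (Comp D E E' E'' h' h) = Comp C (G E) (G E') (G E'') (Ga E' E'' h') (Ga E E' h)"
    if "E \<in> Ob D" "E' \<in> Ob D" "E'' \<in> Ob D" "h \<in> Hom D E E'" "h' \<in> Hom D E' E''" for E E' E'' h h'
    using Ga_\<Phi>[of E E'' "Comp C (G E) (G E') (G E'') (Ga E' E'' h') (Ga E E' h)"]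
      \<Phi>_comp[of E E' E'' "Ga E E' h" "Ga E' E'' h'"] that
    by (simp add: \<Phi>_Ga Ga_hom C.Comp_hom mem)
  ultimately show ?thesis by (auto simp: is_functor_def mem Ga_hom)
qed

text \<open>
  The component at \<open>X\<close> is the arrow that the functor sends to \<open>out (Fo X)\<close>; its properties hold because
  they hold after applying the faithful functor.
\<close>

lemma unit_iso:
  "naturally_isomorphic C C (\<lambda>X. X) (\<lambda>X Y f. f) (\<lambda>X. G (Fo X)) (\<lambda>X Y f. Ga (Fo X) (Fo Y) (Fa X Y f))"
proof -
  define \<alpha> where "\<alpha> X = (SOME a. a \<in> Hom C X (G (Fo X)) \<and> Fa X (G (Fo X)) a = out (Fo X))" for X
  have \<alpha>: "\<alpha> X \<in> Hom C X (G (Fo X))" "Fa X (G (Fo X)) (\<alpha> X) = out (Fo X)" if X: "X \<in> Ob C" for X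
  proof -
    have "\<exists>a. a \<in> Hom C X (G (Fo X)) \<and> Fa X (G (Fo X)) a = out (Fo X)"
      using Fa_surj[of X "G (Fo X)" "out (Fo X)"] X by (auto simp: mem)
    from someI_ex[OF this] show "\<alpha> X \<in> Hom C X (G (Fo X))" "Fa X (G (Fo X)) (\<alpha> X) = out (Fo X)"
      by (simp_all add: \<alpha>_def)
  qed
  have "is_iso C X (G (Fo X)) (\<alpha> X)" if X: "X \<in> Ob C" for X
  proof -
    obtain b where b: "b \<in> Hom C (G (Fo X)) X" "Fa (G (Fo X)) X b = into (Fo X)"
      using Fa_surj[of "G (Fo X)" X "into (Fo X)"] X by (auto simp: mem)
    have "Comp C X (G (Fo X)) X b (\<alpha> X) = Ident C X"
      using X b \<alpha>[OF X]
      by (intro Fa_inj[of X X]) (simp_all add: Fa_comp Fa_ident mem into_out C.Comp_hom C.Ident_hom)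
    moreover have "Comp C (G (Fo X)) X (G (Fo X)) (\<alpha> X) b = Ident C (G (Fo X))"
      using X b \<alpha>[OF X]
      by (intro Fa_inj[of "G (Fo X)" "G (Fo X)"])
        (simp_all add: Fa_comp Fa_ident mem out_into C.Comp_hom C.Ident_hom)
    ultimately show ?thesis using \<alpha>[OF X] b by (auto simp: is_iso_def)
  qed
  moreover have "Comp C X Y (G (Fo Y)) (\<alpha> Y) f =
      Comp C X (G (Fo X)) (G (Fo Y)) (Ga (Fo X) (Fo Y) (Fa X Y f)) (\<alpha> X)"
    if "X \<in> Ob C" "Y \<in> Ob C" "f \<in> Hom C X Y" for X Y f
  proof (rule Fa_inj[of X "G (Fo Y)"])
    show "Fa X (G (Fo Y)) (Comp C X Y (G (Fo Y)) (\<alpha> Y) f) =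
      Fa X (G (Fo Y)) (Comp C X (G (Fo X)) (G (Fo Y)) (Ga (Fo X) (Fo Y) (Fa X Y f)) (\<alpha> X))"
      using that \<alpha>[OF that(1)] \<alpha>[OF that(2)]
      by (simp add: Fa_comp mem Ga_hom Fa_Ga D.Comp_assoc[symmetric] into_out D.Comp_Ident)
  qed (use that \<alpha>[OF that(1)] \<alpha>[OF that(2)] in \<open>simp_all add: mem Ga_hom C.Comp_hom\<close>)
  ultimately show ?thesis unfolding naturally_isomorphic_def by blast
qed

lemma counit_iso:
  "naturally_isomorphic D D (\<lambda>E. Fo (G E)) (\<lambda>E E' h. Fa (G E) (G E') (Ga E E' h)) (\<lambda>E. E) (\<lambda>E E' h. h)"
  unfolding naturally_isomorphic_def
proof (intro exI[of _ into] conjI ballI)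
  show "is_iso D (Fo (G E)) E (into E)" if "E \<in> Ob D" for E
    using that by (auto simp: is_iso_def into_hom intro!: bexI[OF _ out_hom] out_into into_out)
next
  fix E E' h assume "E \<in> Ob D" "E' \<in> Ob D" "h \<in> Hom D E E'"
  then show "Comp D (Fo (G E)) (Fo (G E')) E' (into E') (Fa (G E) (G E') (Ga E E' h)) =
    Comp D (Fo (G E)) E E' h (into E)"
    using \<Phi>_into[of E E' "Ga E E' h"] by (simp add: Ga_hom \<Phi>_Ga)
qed

lemma is_quantaloid_equivalence: "quantaloid_equivalence C D Fo Fa"
  unfolding quantaloid_equivalence_def quantaloid_hom_def category_equivalence_def
  using C.quantaloid_axioms quantaloid_D F Fa_sup Ga_functor unit_iso counit_iso
  by (auto simp: order_fully_faithful_def intro!: exI[of _ G] exI[of _ Ga])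

end

section \<open>Small sets\<close>

lemma card_of_less_iff_card_less:
  assumes "finite A" "finite B"
  shows "|A| <o |B| \<longleftrightarrow> card A < card B"
  using card_of_ordLess[of B A] inj_on_iff_card_le[OF assms(2,1)] by auto

locale universe =
  fixes Q :: "('o, 'a) quant" and \<kappa> :: "'u rel"
  assumes universe: "\<kappa> = |UNIV :: 'u set|"
    and strong_limit: "\<And>S :: 'u set. small \<kappa> S \<Longrightarrow> small \<kappa> (Pow S)"
    and Q: "small_quantaloid \<kappa> Q"
begin

sublocale quantaloid Q
  using Q by (simp add: small_quantaloid_def)

text \<open>
  If the universe had \<open>n\<close> elements, a subset with \<open>n - 1\<close> elements would be small, but its power set
  has \<open>2 ^ (n - 1) \<ge> n\<close> elements.
\<close>

lemma infinite_universe: "infinite (UNIV :: 'u set)"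
proof
  assume fin: "finite (UNIV :: 'u set)"
  define S where "S = UNIV - {undefined :: 'u}"
  have card: "card S < card (UNIV :: 'u set)" using fin by (intro psubset_card_mono) (auto simp: S_def)
  then have "small \<kappa> S"
    using fin by (simp add: small_def universe card_of_less_iff_card_less S_def)
  then have "card (Pow S) < card (UNIV :: 'u set)"
    using strong_limit[of S] fin by (simp add: small_def universe card_of_less_iff_card_less S_def)
  moreover have "card (UNIV :: 'u set) = Suc (card S)"
    using card.remove[OF fin UNIV_I] unfolding S_def .
  moreover have "card S < 2 ^ card S" by simp
  moreover have "card (Pow S) = 2 ^ card S" using fin by (intro card_Pow) (simp add: S_def)
  ultimately show False by linarith
qed

lemma small_finite: "finite S \<Longrightarrow> small \<kappa> S"
  
  using infinite_universe finite_ordLess_infinite[OF card_of_Well_order[of S] card_of_Well_order[of "UNIV :: 'u set"]]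
  by (simp add: small_def universe Field_card_of)

lemma small_subset: "small \<kappa> S \<Longrightarrow> T \<subseteq> S \<Longrightarrow> small \<kappa> T"
  unfolding small_def using card_of_mono1 ordLeq_ordLess_trans by blast

lemma small_image: "small \<kappa> S \<Longrightarrow> small \<kappa> (f ` S)"
  unfolding small_def using card_of_image ordLeq_ordLess_trans by blast

lemma small_Times:
  fixes S :: "'s set" and T :: "'t set"
  assumes "small \<kappa> S" "small \<kappa> T"
  shows "small \<kappa> (S \<times> T)"
proof (cases "finite S \<and> finite T \<or> S = {} \<or> T = {}")
  case True
  then show ?thesis by (auto intro: small_finite)
next
  case False
  consider "|S| \<le>o |T|" | "|T| \<le>o |S|"
    using ordLeq_total[OF card_of_Well_order card_of_Well_order] by blast
  then show ?thesis
  proof cases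
    case 1
    then have "infinite T" using False card_of_ordLeq_infinite[OF 1] by auto
    then have "|S \<times> T| =o |T|" using card_of_Times_infinite[of T S] 1 False by auto
    then show ?thesis using assms(2) unfolding small_def by (rule ordIso_ordLess_trans)
  next
    case 2
    then have "infinite S" using False card_of_ordLeq_infinite[OF 2] by auto
    then have "|S \<times> T| =o |S|" using card_of_Times_infinite[of S T] 2 False by auto
    then show ?thesis using assms(1) unfolding small_def by (rule ordIso_ordLess_trans)
  qed
qed

lemma small_inj:
  fixes S :: "'s set"
  assumes "small \<kappa> S"
  obtains h :: "'s \<Rightarrow> 'u" where "inj_on h S"
  using assms ordLess_imp_ordLeq[of "|S|" "|UNIV :: 'u set|"] card_of_ordLeq[of S "UNIV :: 'u set"]
  by (auto simp: small_def universe)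

text \<open>
  The strong limit property is only assumed for subsets of the universe; a small set over any type
  has a copy there.
\<close>

lemma small_Pow:
  fixes S :: "'s set"
  assumes "small \<kappa> S"
  shows "small \<kappa> (Pow S)"
proof -
  obtain h :: "'s \<Rightarrow> 'u" where h: "inj_on h S" using small_inj[OF assms] .
  have "Pow S \<subseteq> image (inv_into S h) ` Pow (h ` S)"
  proof
    fix T assume T: "T \<in> Pow S"
    then have "T = inv_into S h ` (h ` T)" using h by (simp add: inv_into_image_cancel)
    then show "T \<in> image (inv_into S h) ` Pow (h ` S)" using T by blast
  qed
  moreover have "small \<kappa> (image (inv_into S h) ` Pow (h ` S))"
    by (intro small_image strong_limit assms)
  ultimately show ?thesis using small_subset by blast
qed

section \<open>The quantaloid of distributors\<close>

abbreviation D :: "(('x, 'o, 'a) qcat, 'x \<times> 'x \<Rightarrow> 'a) quant" where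
  "D \<equiv> QDist \<kappa> Q"

lemma QDist_simps:
  "A \<in> Ob D \<longleftrightarrow> qcategory Q A \<and> small \<kappa> (obj A)"
  "Hom D A B = distributors Q A B"
  "Ident D = qhom"
  "Leq D A B \<phi> \<psi> \<longleftrightarrow> (\<forall>x\<in>obj A. \<forall>y\<in>obj B. Leq Q (ty A x) (ty B y) (\<phi> (x, y)) (\<psi> (x, y)))"
  by (simp_all add: QDist_def)

lemma
  assumes "qcategory Q A"
  shows ty_ob: "x \<in> obj A \<Longrightarrow> ty A x \<in> Ob Q"
    and qhom_ext: "qhom A \<in> extensional (obj A \<times> obj A)"
    and qhom_hom: "\<lbrakk>x \<in> obj A; y \<in> obj A\<rbrakk> \<Longrightarrow> qhom A (x, y) \<in> Hom Q (ty A x) (ty A y)"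
    and qhom_ident: "x \<in> obj A \<Longrightarrow> Leq Q (ty A x) (ty A x) (Ident Q (ty A x)) (qhom A (x, x))"
    and qhom_comp: "\<lbrakk>x \<in> obj A; y \<in> obj A; z \<in> obj A\<rbrakk> \<Longrightarrow> Leq Q (ty A x) (ty A z)
        (Comp Q (ty A x) (ty A y) (ty A z) (qhom A (y, z)) (qhom A (x, y))) (qhom A (x, z))"
  using assms unfolding qcategory_def by (auto simp: PiE_def Pi_def)

text \<open>
  The two-sided action condition splits into a condition on each side, by inserting identities on the
  other side.
\<close>

lemma distributors_iff:
  assumes A: "qcategory Q A" and B: "qcategory Q B"
  shows "\<phi> \<in> distributors Q A B \<longleftrightarrow> \<phi> \<in> extensional (obj A \<times> obj B) \<and>
    (\<forall>x\<in>obj A. \<forall>y\<in>obj B. \<phi> (x, y) \<in> Hom Q (ty A x) (ty B y)) \<and>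
    (\<forall>x\<in>obj A. \<forall>x'\<in>obj A. \<forall>y\<in>obj B. Leq Q (ty A x') (ty B y)
      (Comp Q (ty A x') (ty A x) (ty B y) (\<phi> (x, y)) (qhom A (x', x))) (\<phi> (x', y))) \<and>
    (\<forall>x\<in>obj A. \<forall>y\<in>obj B. \<forall>y'\<in>obj B. Leq Q (ty A x) (ty B y')
      (Comp Q (ty A x) (ty B y) (ty B y') (qhom B (y, y')) (\<phi> (x, y))) (\<phi> (x, y')))"
    (is "_ \<longleftrightarrow> ?E \<and> ?H \<and> ?L \<and> ?R")
proof (intro iffI conjI)
  assume *: "\<phi> \<in> distributors Q A B"
  then show ?E and H: ?H by (auto simp: distributors_def PiE_def Pi_def)
  have d: "Leq Q (ty A x') (ty B y') (Comp Q (ty A x') (ty B y) (ty B y') (qhom B (y, y'))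
            (Comp Q (ty A x') (ty A x) (ty B y) (\<phi> (x, y)) (qhom A (x', x)))) (\<phi> (x', y'))"
    if "x \<in> obj A" "x' \<in> obj A" "y \<in> obj B" "y' \<in> obj B" for x x' y y'
    using * that by (auto simp: distributors_def)
  note m = ty_ob[OF A] ty_ob[OF B] qhom_hom[OF A] qhom_hom[OF B] H[rule_format] comp_in ident_in
  show ?L
  proof (intro ballI)
    fix x x' y assume x: "x \<in> obj A" "x' \<in> obj A" "y \<in> obj B"
    let ?c = "Comp Q (ty A x') (ty A x) (ty B y) (\<phi> (x, y)) (qhom A (x', x))"
    have "Leq Q (ty A x') (ty B y) (Comp Q (ty A x') (ty B y) (ty B y) (Ident Q (ty B y)) ?c)
      (Comp Q (ty A x') (ty B y) (ty B y) (qhom B (y, y)) ?c)"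
      using x by (intro Comp_mono qhom_ident[OF B] Leq_refl) (auto simp: m)
    then show "Leq Q (ty A x') (ty B y) ?c (\<phi> (x', y))"
      using x by (intro Leq_trans[OF _ d[of x x' y y]]) (auto simp: m Ident_Comp)
  qed
  show ?R
  proof (intro ballI)
    fix x y y' assume x: "x \<in> obj A" "y \<in> obj B" "y' \<in> obj B"
    have "Leq Q (ty A x) (ty B y) (Comp Q (ty A x) (ty A x) (ty B y) (\<phi> (x, y)) (Ident Q (ty A x)))
      (Comp Q (ty A x) (ty A x) (ty B y) (\<phi> (x, y)) (qhom A (x, x)))"
      using x by (intro Comp_mono qhom_ident[OF A] Leq_refl) (auto simp: m)
    then have "Leq Q (ty A x) (ty B y') (Comp Q (ty A x) (ty B y) (ty B y') (qhom B (y, y')) (\<phi> (x, y)))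
      (Comp Q (ty A x) (ty B y) (ty B y') (qhom B (y, y'))
        (Comp Q (ty A x) (ty A x) (ty B y) (\<phi> (x, y)) (qhom A (x, x))))"
      using x by (intro Comp_mono Leq_refl) (auto simp: m Comp_Ident)
    then show "Leq Q (ty A x) (ty B y') (Comp Q (ty A x) (ty B y) (ty B y') (qhom B (y, y')) (\<phi> (x, y)))
        (\<phi> (x, y'))"
      using x by (intro Leq_trans[OF _ d[of x x y y']]) (auto simp: m)
  qed
next
  assume *: "?E \<and> ?H \<and> ?L \<and> ?R"
  then have H: "\<And>x y. x\<in>obj A \<Longrightarrow> y\<in>obj B \<Longrightarrow> \<phi> (x, y) \<in> Hom Q (ty A x) (ty B y)" by blast
  note m = ty_ob[OF A] ty_ob[OF B] qhom_hom[OF A] qhom_hom[OF B] H comp_in ident_in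
  have "Leq Q (ty A x') (ty B y') (Comp Q (ty A x') (ty B y) (ty B y') (qhom B (y, y'))
            (Comp Q (ty A x') (ty A x) (ty B y) (\<phi> (x, y)) (qhom A (x', x)))) (\<phi> (x', y'))"
    if x: "x \<in> obj A" "x' \<in> obj A" "y \<in> obj B" "y' \<in> obj B" for x x' y y'
  proof (rule Leq_trans)
    show "Leq Q (ty A x') (ty B y') (Comp Q (ty A x') (ty B y) (ty B y') (qhom B (y, y'))
            (Comp Q (ty A x') (ty A x) (ty B y) (\<phi> (x, y)) (qhom A (x', x))))
       (Comp Q (ty A x') (ty B y) (ty B y') (qhom B (y, y')) (\<phi> (x', y)))"
      using x * by (intro Comp_mono Leq_refl) (auto simp: m)
    show "Leq Q (ty A x') (ty B y') (Comp Q (ty A x') (ty B y) (ty B y') (qhom B (y, y')) (\<phi> (x', y))) (\<phi> (x', y'))"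
      using x * by blast
  qed (use x in \<open>auto simp: m\<close>)
  then show "\<phi> \<in> distributors Q A B"
    using * by (auto simp: distributors_def PiE_def)
qed

lemma
  assumes "A \<in> Ob D" "B \<in> Ob D" "\<phi> \<in> Hom D A B"
  shows dist_hom: "\<lbrakk>x \<in> obj A; y \<in> obj B\<rbrakk> \<Longrightarrow> \<phi> (x, y) \<in> Hom Q (ty A x) (ty B y)"
    and dist_right: "\<lbrakk>x \<in> obj A; x' \<in> obj A; y \<in> obj B\<rbrakk> \<Longrightarrow> Leq Q (ty A x') (ty B y)
      (Comp Q (ty A x') (ty A x) (ty B y) (\<phi> (x, y)) (qhom A (x', x))) (\<phi> (x', y))"
    and dist_left: "\<lbrakk>x \<in> obj A; y \<in> obj B; y' \<in> obj B\<rbrakk> \<Longrightarrow> Leq Q (ty A x) (ty B y')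
      (Comp Q (ty A x) (ty B y) (ty B y') (qhom B (y, y')) (\<phi> (x, y))) (\<phi> (x, y'))"
    and dist_ext: "\<phi> \<in> extensional (obj A \<times> obj B)"
  using assms distributors_iff[of A B \<phi>] unfolding QDist_simps by auto

lemma dist_eqI:
  assumes "A \<in> Ob D" "B \<in> Ob D" "\<phi> \<in> Hom D A B" "\<psi> \<in> Hom D A B"
    and "\<And>x y. \<lbrakk>x \<in> obj A; y \<in> obj B\<rbrakk> \<Longrightarrow> \<phi> (x, y) = \<psi> (x, y)"
  shows "\<phi> = \<psi>"
  by (rule extensionalityI[OF dist_ext[OF assms(1-3)] dist_ext[OF assms(1,2,4)]]) (use assms(5) in auto)

lemma Dty_ob: "A \<in> Ob D \<Longrightarrow> x \<in> obj A \<Longrightarrow> ty A x \<in> Ob Q"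
  and Dqhom_hom: "A \<in> Ob D \<Longrightarrow> x \<in> obj A \<Longrightarrow> y \<in> obj A \<Longrightarrow> qhom A (x, y) \<in> Hom Q (ty A x) (ty A y)"
  by (simp_all add: QDist_simps ty_ob qhom_hom)

lemmas obj_elt = Dty_ob Dqhom_hom

lemmas elt = obj_elt dist_hom comp_in ident_in

context
  fixes A B Z :: "('x, 'o, 'a) qcat" and \<phi> \<psi>
  assumes ob [simp]: "A \<in> Ob D" "B \<in> Ob D" "Z \<in> Ob D"
    and [simp]: "\<phi> \<in> Hom D A B" "\<psi> \<in> Hom D B Z"
begin

lemma
  assumes "x \<in> obj A" "z \<in> obj Z"
  shows Comp_D_elt: "Comp D A B Z \<psi> \<phi> (x, z) \<in> Hom Q (ty A x) (ty Z z)"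
    and Comp_D_le_iff: "h \<in> Hom Q (ty A x) (ty Z z) \<Longrightarrow>
      Leq Q (ty A x) (ty Z z) (Comp D A B Z \<psi> \<phi> (x, z)) h \<longleftrightarrow>
      (\<forall>y\<in>obj B. Leq Q (ty A x) (ty Z z) (Comp Q (ty A x) (ty B y) (ty Z z) (\<psi> (y, z)) (\<phi> (x, y))) h)"
    and comp_Comp_D_le_iff: "\<lbrakk>W \<in> Ob Q; g \<in> Hom Q (ty Z z) W; h \<in> Hom Q (ty A x) W\<rbrakk> \<Longrightarrow>
      Leq Q (ty A x) W (Comp Q (ty A x) (ty Z z) W g (Comp D A B Z \<psi> \<phi> (x, z))) h \<longleftrightarrow>
      (\<forall>y\<in>obj B. Leq Q (ty A x) W (Comp Q (ty A x) (ty Z z) W g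
        (Comp Q (ty A x) (ty B y) (ty Z z) (\<psi> (y, z)) (\<phi> (x, y)))) h)"
    and Comp_D_comp_le_iff: "\<lbrakk>W \<in> Ob Q; f \<in> Hom Q W (ty A x); h \<in> Hom Q W (ty Z z)\<rbrakk> \<Longrightarrow>
      Leq Q W (ty Z z) (Comp Q W (ty A x) (ty Z z) (Comp D A B Z \<psi> \<phi> (x, z)) f) h \<longleftrightarrow>
      (\<forall>y\<in>obj B. Leq Q W (ty Z z) (Comp Q W (ty A x) (ty Z z)
        (Comp Q (ty A x) (ty B y) (ty Z z) (\<psi> (y, z)) (\<phi> (x, y))) f) h)"
proof -
  let ?S = "(\<lambda>y. Comp Q (ty A x) (ty B y) (ty Z z) (\<psi> (y, z)) (\<phi> (x, y))) ` obj B"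
  have eq: "Comp D A B Z \<psi> \<phi> (x, z) = \<Squnion>\<^bsub>hom_order Q (ty A x) (ty Z z)\<^esub> ?S"
    using assms by (simp add: QDist_def)
  have t: "ty A x \<in> Ob Q" "ty Z z \<in> Ob Q" using assms by (auto intro: Dty_ob)
  have S: "?S \<subseteq> Hom Q (ty A x) (ty Z z)" using assms by (auto intro!: elt)
  note [simp] = t S
  show "Comp D A B Z \<psi> \<phi> (x, z) \<in> Hom Q (ty A x) (ty Z z)"
    unfolding eq using assms by (intro sup_hom) simp_all
  show "h \<in> Hom Q (ty A x) (ty Z z) \<Longrightarrow>
      Leq Q (ty A x) (ty Z z) (Comp D A B Z \<psi> \<phi> (x, z)) h \<longleftrightarrow>
      (\<forall>y\<in>obj B. Leq Q (ty A x) (ty Z z) (Comp Q (ty A x) (ty B y) (ty Z z) (\<psi> (y, z)) (\<phi> (x, y))) h)"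
    unfolding eq using assms by (subst sup_le_iff) simp_all
  show "\<lbrakk>W \<in> Ob Q; g \<in> Hom Q (ty Z z) W; h \<in> Hom Q (ty A x) W\<rbrakk> \<Longrightarrow>
      Leq Q (ty A x) W (Comp Q (ty A x) (ty Z z) W g (Comp D A B Z \<psi> \<phi> (x, z))) h \<longleftrightarrow>
      (\<forall>y\<in>obj B. Leq Q (ty A x) W (Comp Q (ty A x) (ty Z z) W g
        (Comp Q (ty A x) (ty B y) (ty Z z) (\<psi> (y, z)) (\<phi> (x, y)))) h)"
    unfolding eq using assms by (subst comp_sup_le_iff) simp_all
  show "\<lbrakk>W \<in> Ob Q; f \<in> Hom Q W (ty A x); h \<in> Hom Q W (ty Z z)\<rbrakk> \<Longrightarrow>
      Leq Q W (ty Z z) (Comp Q W (ty A x) (ty Z z) (Comp D A B Z \<psi> \<phi> (x, z)) f) h \<longleftrightarrow>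
      (\<forall>y\<in>obj B. Leq Q W (ty Z z) (Comp Q W (ty A x) (ty Z z)
        (Comp Q (ty A x) (ty B y) (ty Z z) (\<psi> (y, z)) (\<phi> (x, y))) f) h)"
    unfolding eq using assms by (subst sup_comp_le_iff) simp_all
qed

lemma Comp_D_upper:
  assumes "x \<in> obj A" "y \<in> obj B" "z \<in> obj Z"
  shows "Leq Q (ty A x) (ty Z z) (Comp Q (ty A x) (ty B y) (ty Z z) (\<psi> (y, z)) (\<phi> (x, y)))
    (Comp D A B Z \<psi> \<phi> (x, z))"
  using Comp_D_le_iff[of x z "Comp D A B Z \<psi> \<phi> (x, z)"] assms
  by (auto simp: Comp_D_elt Leq_refl Dty_ob[OF ob(1)] Dty_ob[OF ob(3)])

lemma Comp_D_hom: "Comp D A B Z \<psi> \<phi> \<in> Hom D A Z"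
proof -
  have "\<phi> \<in> Hom D A B" "\<psi> \<in> Hom D B Z" by simp_all
  note m = obj_elt[OF ob(1)] obj_elt[OF ob(2)] obj_elt[OF ob(3)] dist_hom[OF ob(1,2) this(1)] dist_hom[OF ob(2,3) this(2)]
    comp_in Comp_D_elt
  show ?thesis unfolding QDist_simps(2)
  proof (subst distributors_iff, goal_cases)
    case 3
    have "Leq Q (ty A x') (ty Z z) (Comp Q (ty A x') (ty A x) (ty Z z) (Comp D A B Z \<psi> \<phi> (x, z)) (qhom A (x', x)))
      (Comp D A B Z \<psi> \<phi> (x', z))" if x: "x \<in> obj A" "x' \<in> obj A" "z \<in> obj Z" for x x' z
    proof (subst Comp_D_comp_le_iff, (use x in \<open>auto simp: m\<close>)[5], intro ballI)
      fix y assume y: "y \<in> obj B"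
      have "Leq Q (ty A x') (ty Z z) (Comp Q (ty A x') (ty B y) (ty Z z) (\<psi> (y, z))
          (Comp Q (ty A x') (ty A x) (ty B y) (\<phi> (x, y)) (qhom A (x', x))))
        (Comp Q (ty A x') (ty B y) (ty Z z) (\<psi> (y, z)) (\<phi> (x', y)))"
        using x y by (intro Comp_mono dist_right Leq_refl) (auto simp: m)
      from Leq_trans[OF this Comp_D_upper]
      show "Leq Q (ty A x') (ty Z z) (Comp Q (ty A x') (ty A x) (ty Z z)
          (Comp Q (ty A x) (ty B y) (ty Z z) (\<psi> (y, z)) (\<phi> (x, y))) (qhom A (x', x)))
        (Comp D A B Z \<psi> \<phi> (x', z))"
        using x y by (simp add: m comp_assoc)
    qed
    moreover have "Leq Q (ty A x) (ty Z z') (Comp Q (ty A x) (ty Z z) (ty Z z') (qhom Z (z, z')) (Comp D A B Z \<psi> \<phi> (x, z)))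
      (Comp D A B Z \<psi> \<phi> (x, z'))" if x: "x \<in> obj A" "z \<in> obj Z" "z' \<in> obj Z" for x z z'
    proof (subst comp_Comp_D_le_iff, (use x in \<open>auto simp: m\<close>)[5], intro ballI)
      fix y assume y: "y \<in> obj B"
      have "Leq Q (ty A x) (ty Z z') (Comp Q (ty A x) (ty B y) (ty Z z')
          (Comp Q (ty B y) (ty Z z) (ty Z z') (qhom Z (z, z')) (\<psi> (y, z))) (\<phi> (x, y)))
        (Comp Q (ty A x) (ty B y) (ty Z z') (\<psi> (y, z')) (\<phi> (x, y)))"
        using x y by (intro Comp_mono dist_left Leq_refl) (auto simp: m)
      from Leq_trans[OF this Comp_D_upper]
      show "Leq Q (ty A x) (ty Z z') (Comp Q (ty A x) (ty Z z) (ty Z z') (qhom Z (z, z'))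
          (Comp Q (ty A x) (ty B y) (ty Z z) (\<psi> (y, z)) (\<phi> (x, y))))
        (Comp D A B Z \<psi> \<phi> (x, z'))"
        using x y by (simp add: m comp_assoc)
    qed
    moreover have "Comp D A B Z \<psi> \<phi> \<in> extensional (obj A \<times> obj Z)"
      by (simp add: QDist_def)
    ultimately show ?case by (simp add: m)
  qed (use ob in \<open>simp_all add: QDist_simps\<close>)
qed

end

lemma Leq_D_iff:
  "Leq D A B \<phi> \<psi> \<longleftrightarrow> (\<forall>x\<in>obj A. \<forall>y\<in>obj B. Leq Q (ty A x) (ty B y) (\<phi> (x, y)) (\<psi> (x, y)))"
  by (simp add: QDist_simps)

lemma qhom_D: "A \<in> Ob D \<Longrightarrow> qhom A \<in> Hom D A A"
  by (simp add: QDist_simps distributors_iff qhom_ext qhom_hom qhom_comp)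

lemma Comp_D_assoc:
  assumes ob: "A \<in> Ob D" "B \<in> Ob D" "C \<in> Ob D" "E \<in> Ob D"
    and h: "\<phi> \<in> Hom D A B" "\<psi> \<in> Hom D B C" "\<chi> \<in> Hom D C E"
  shows "Comp D A C E \<chi> (Comp D A B C \<psi> \<phi>) = Comp D A B E (Comp D B C E \<chi> \<psi>) \<phi>"
proof (rule dist_eqI[OF ob(1,4)])
  fix x z assume x: "x \<in> obj A" "z \<in> obj E"
  note m = ob h Comp_D_hom Comp_D_elt
  note m2 = Dty_ob[OF ob(1)] Dty_ob[OF ob(2)] Dty_ob[OF ob(3)] Dty_ob[OF ob(4)] dist_hom[OF ob(1,2) h(1)]
    dist_hom[OF ob(2,3) h(2)] dist_hom[OF ob(3,4) h(3)] comp_in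
  show "Comp D A C E \<chi> (Comp D A B C \<psi> \<phi>) (x, z) = Comp D A B E (Comp D B C E \<chi> \<psi>) \<phi> (x, z)"
    by (rule Leq_above_ext[of "ty A x" "ty E z"])
      (use x in \<open>auto simp: m m2 Comp_D_le_iff comp_Comp_D_le_iff Comp_D_comp_le_iff comp_assoc\<close>)
qed (use ob h in \<open>auto intro!: Comp_D_hom\<close>)

lemma Comp_D_qhom:
  assumes ob: "A \<in> Ob D" "B \<in> Ob D" and h: "\<phi> \<in> Hom D A B"
  shows "Comp D A A B \<phi> (qhom A) = \<phi>"
proof (rule dist_eqI[OF ob])
  fix x y assume x: "x \<in> obj A" "y \<in> obj B"
  note m = ob h Comp_D_hom Comp_D_elt qhom_D Dty_ob[OF ob(1)] Dty_ob[OF ob(2)] dist_hom[OF ob h] obj_elt[OF ob(1)]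
  have "Leq Q (ty A x) (ty B y) (Comp D A A B \<phi> (qhom A) (x, y)) (\<phi> (x, y))"
    using x by (subst Comp_D_le_iff) (auto simp: m intro!: dist_right)
  moreover have "Leq Q (ty A x) (ty B y) (\<phi> (x, y)) (Comp D A A B \<phi> (qhom A) (x, y))"
  proof (rule Leq_trans)
    have "Leq Q (ty A x) (ty B y) (Comp Q (ty A x) (ty A x) (ty B y) (\<phi> (x, y)) (Ident Q (ty A x)))
      (Comp Q (ty A x) (ty A x) (ty B y) (\<phi> (x, y)) (qhom A (x, x)))"
      using x ob by (intro Comp_mono qhom_ident Leq_refl) (auto simp: m ident_in QDist_simps(1) ty_ob)
    then show "Leq Q (ty A x) (ty B y) (\<phi> (x, y)) (Comp Q (ty A x) (ty A x) (ty B y) (\<phi> (x, y)) (qhom A (x, x)))"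
      using x by (simp add: m Comp_Ident)
    show "Leq Q (ty A x) (ty B y) (Comp Q (ty A x) (ty A x) (ty B y) (\<phi> (x, y)) (qhom A (x, x)))
       (Comp D A A B \<phi> (qhom A) (x, y))"
      using x by (intro Comp_D_upper) (auto simp: m)
  qed (use x in \<open>simp_all add: m comp_in\<close>)
  ultimately show "Comp D A A B \<phi> (qhom A) (x, y) = \<phi> (x, y)"
    using x by (intro Leq_antisym) (auto simp: m)
qed (use ob h in \<open>auto intro!: Comp_D_hom qhom_D\<close>)

lemma qhom_Comp_D:
  assumes ob: "A \<in> Ob D" "B \<in> Ob D" and h: "\<phi> \<in> Hom D A B"
  shows "Comp D A B B (qhom B) \<phi> = \<phi>"
proof (rule dist_eqI[OF ob])
  fix x y assume x: "x \<in> obj A" "y \<in> obj B"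
  note m = ob h Comp_D_hom Comp_D_elt qhom_D Dty_ob[OF ob(1)] Dty_ob[OF ob(2)] dist_hom[OF ob h] obj_elt[OF ob(2)]
  have "Leq Q (ty A x) (ty B y) (Comp D A B B (qhom B) \<phi> (x, y)) (\<phi> (x, y))"
    using x by (subst Comp_D_le_iff) (auto simp: m intro!: dist_left)
  moreover have "Leq Q (ty A x) (ty B y) (\<phi> (x, y)) (Comp D A B B (qhom B) \<phi> (x, y))"
  proof (rule Leq_trans)
    have "Leq Q (ty A x) (ty B y) (Comp Q (ty A x) (ty B y) (ty B y) (Ident Q (ty B y)) (\<phi> (x, y)))
      (Comp Q (ty A x) (ty B y) (ty B y) (qhom B (y, y)) (\<phi> (x, y)))"
      using x ob by (intro Comp_mono qhom_ident Leq_refl) (auto simp: m ident_in QDist_simps(1) ty_ob)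
    then show "Leq Q (ty A x) (ty B y) (\<phi> (x, y)) (Comp Q (ty A x) (ty B y) (ty B y) (qhom B (y, y)) (\<phi> (x, y)))"
      using x by (simp add: m Ident_Comp)
    show "Leq Q (ty A x) (ty B y) (Comp Q (ty A x) (ty B y) (ty B y) (qhom B (y, y)) (\<phi> (x, y)))
       (Comp D A B B (qhom B) \<phi> (x, y))"
      using x by (intro Comp_D_upper) (auto simp: m)
  qed (use x in \<open>simp_all add: m comp_in\<close>)
  ultimately show "Comp D A B B (qhom B) \<phi> (x, y) = \<phi> (x, y)"
    using x by (intro Leq_antisym) (auto simp: m)
qed (use ob h in \<open>auto intro!: Comp_D_hom qhom_D\<close>)

lemma ordered_category_QDist: "ordered_category D"
proof (unfold_locales, goal_cases)
  case (1 A) then show ?case by (simp add: QDist_simps(3) qhom_D)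
next
  case (2 A B Z f g) then show ?case by (intro Comp_D_hom)
next
  case (3 A B C E f g h) then show ?case by (intro Comp_D_assoc)
next
  case (4 A B f) then show ?case by (simp add: QDist_simps(3) Comp_D_qhom)
next
  case (5 A B f) then show ?case by (simp add: QDist_simps(3) qhom_Comp_D)
next
  case (6 A B f) then show ?case by (auto simp: Leq_D_iff intro!: Leq_refl elt)
next
  case (7 A B f g h)
  then have "Leq Q (ty A x) (ty B y) (f (x, y)) (h (x, y))" if "x \<in> obj A" "y \<in> obj B" for x y
    using that 7 by (intro Leq_trans[of "ty A x" "ty B y" "f (x, y)" "g (x, y)" "h (x, y)"])
      (auto simp: Leq_D_iff intro: elt)
  then show ?case by (simp add: Leq_D_iff)
next
  case (8 A B f g)
  then show ?case by (intro dist_eqI[of A B f g] Leq_antisym) (auto simp: Leq_D_iff intro: elt)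
next
  case (9 A B f f' Z g g')
  have "Leq Q (ty A x) (ty Z z) (Comp D A B Z g f (x, z)) (Comp D A B Z g' f' (x, z))"
    if x: "x \<in> obj A" "z \<in> obj Z" for x z
  proof (subst Comp_D_le_iff, (use x 9 in \<open>auto simp: Comp_D_elt\<close>)[8], intro ballI)
    fix y assume y: "y \<in> obj B"
    have "Leq Q (ty A x) (ty Z z) (Comp Q (ty A x) (ty B y) (ty Z z) (g (y, z)) (f (x, y)))
      (Comp Q (ty A x) (ty B y) (ty Z z) (g' (y, z)) (f' (x, y)))"
      using 9 x y by (intro Comp_mono) (auto simp: Leq_D_iff intro: elt)
    then show "Leq Q (ty A x) (ty Z z) (Comp Q (ty A x) (ty B y) (ty Z z) (g (y, z)) (f (x, y)))
      (Comp D A B Z g' f' (x, z))"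
      by (rule Leq_trans[OF _ Comp_D_upper]) (use 9 x y in \<open>auto intro: elt Comp_D_elt\<close>)
  qed
  then show ?case by (simp add: Leq_D_iff)
qed

text \<open>
  Joins of distributors are pointwise, because the actions of \<open>A\<close> and \<open>B\<close> preserve joins.
\<close>

lemma pointwise_join_hom:
  assumes ob: "A \<in> Ob D" "B \<in> Ob D" and S: "S \<subseteq> Hom D A B"
  defines "s \<equiv> \<lambda>(x, y)\<in>obj A \<times> obj B. \<Squnion>\<^bsub>hom_order Q (ty A x) (ty B y)\<^esub> ((\<lambda>\<phi>. \<phi> (x, y)) ` S)"
  shows "s \<in> Hom D A B"
proof -
  have S': "(\<lambda>\<phi>. \<phi> (x, y)) ` S \<subseteq> Hom Q (ty A x) (ty B y)" if "x \<in> obj A" "y \<in> obj B" for x y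
    using S ob that by (auto intro!: elt(3)[of A B])
  have up: "Leq Q (ty A x) (ty B y) (\<phi> (x, y)) (s (x, y))" if "x \<in> obj A" "y \<in> obj B" "\<phi> \<in> S" for x y \<phi>
    using that S' ob by (auto simp: s_def intro!: sup_upper Dty_ob)
  have sh: "s (x, y) \<in> Hom Q (ty A x) (ty B y)" if "x \<in> obj A" "y \<in> obj B" for x y
    using that S' ob by (auto simp: s_def intro!: sup_hom Dty_ob)
  have "Leq Q (ty A x') (ty B y) (Comp Q (ty A x') (ty A x) (ty B y) (s (x, y)) (qhom A (x', x))) (s (x', y))"
    if x: "x \<in> obj A" "x' \<in> obj A" "y \<in> obj B" for x x' y
  proof -
    have "Leq Q (ty A x') (ty B y) (Comp Q (ty A x') (ty A x) (ty B y) (\<phi> (x, y)) (qhom A (x', x))) (s (x', y))"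
      if "\<phi> \<in> S" for \<phi>
      using x ob S that by (intro Leq_trans[OF dist_right[of A B \<phi> x x' y] up[of x' y \<phi>]]) (auto intro!: elt sh)
    then show ?thesis
      using x ob S' sh by (simp add: s_def sup_comp_le_iff elt)
  qed
  moreover have "Leq Q (ty A x) (ty B y') (Comp Q (ty A x) (ty B y) (ty B y') (qhom B (y, y')) (s (x, y))) (s (x, y'))"
    if x: "x \<in> obj A" "y \<in> obj B" "y' \<in> obj B" for x y y'
  proof -
    have "Leq Q (ty A x) (ty B y') (Comp Q (ty A x) (ty B y) (ty B y') (qhom B (y, y')) (\<phi> (x, y))) (s (x, y'))"
      if "\<phi> \<in> S" for \<phi>
      using x ob S that by (intro Leq_trans[OF dist_left[of A B \<phi> x y y'] up[of x y' \<phi>]]) (auto intro!: elt sh)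
    then show ?thesis
      using x ob S' sh by (simp add: s_def comp_sup_le_iff elt)
  qed
  moreover have "s \<in> extensional (obj A \<times> obj B)" by (simp add: s_def)
  ultimately show ?thesis
    using ob sh by (simp add: QDist_simps distributors_iff)
qed

lemma quantaloid_QDist: "quantaloid (D :: (('x, 'o, 'a) qcat, _) quant)"
proof (rule ordered_category.quantaloidI[OF ordered_category_QDist])
  fix A B :: "('x, 'o, 'a) qcat" and S assume ob: "A \<in> Ob D" "B \<in> Ob D" and S: "S \<subseteq> Hom D A B"
  define s where "s = (\<lambda>(x, y)\<in>obj A \<times> obj B. \<Squnion>\<^bsub>hom_order Q (ty A x) (ty B y)\<^esub> ((\<lambda>\<phi>. \<phi> (x, y)) ` S))"
  have s: "s \<in> Hom D A B" unfolding s_def by (rule pointwise_join_hom[OF ob S])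
  have S': "(\<lambda>\<phi>. \<phi> (x, y)) ` S \<subseteq> Hom Q (ty A x) (ty B y)" if "x \<in> obj A" "y \<in> obj B" for x y
    using S ob that by (auto intro!: elt(3)[of A B])
  have sD: "\<phi> \<in> S \<Longrightarrow> \<phi> \<in> Hom D A B" for \<phi> using S by blast
  have "stable_join D (Leq D) A B S s"
    unfolding stable_join_def
  proof (intro conjI ballI s)
    fix h assume h: "h \<in> Hom D A B"
    have "Leq Q (ty A x) (ty B y) (s (x, y)) (h (x, y)) \<longleftrightarrow> (\<forall>\<phi>\<in>S. Leq Q (ty A x) (ty B y) (\<phi> (x, y)) (h (x, y)))"
      if "x \<in> obj A" "y \<in> obj B" for x y
      using that ob h S' by (simp add: s_def sup_le_iff elt)
    then show "Leq D A B s h \<longleftrightarrow> (\<forall>f\<in>S. Leq D A B f h)" by (auto simp: Leq_D_iff)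
  next
    fix Z g h assume Z: "Z \<in> Ob D" "g \<in> Hom D B Z" "h \<in> Hom D A Z"
    have "Leq Q (ty A x) (ty Z z) (Comp Q (ty A x) (ty B y) (ty Z z) (g (y, z)) (s (x, y))) (h (x, z)) \<longleftrightarrow>
      (\<forall>\<phi>\<in>S. Leq Q (ty A x) (ty Z z) (Comp Q (ty A x) (ty B y) (ty Z z) (g (y, z)) (\<phi> (x, y))) (h (x, z)))"
      if "x \<in> obj A" "y \<in> obj B" "z \<in> obj Z" for x y z
      using that ob Z S' by (simp add: s_def comp_sup_le_iff elt)
    then show "Leq D A Z (Comp D A B Z g s) h \<longleftrightarrow> (\<forall>f\<in>S. Leq D A Z (Comp D A B Z g f) h)"
      using ob Z s sD by (auto simp: Leq_D_iff Comp_D_le_iff elt)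
  next
    fix W e h assume Z: "W \<in> Ob D" "e \<in> Hom D W A" "h \<in> Hom D W B"
    have "Leq Q (ty W x) (ty B z) (Comp Q (ty W x) (ty A y) (ty B z) (s (y, z)) (e (x, y))) (h (x, z)) \<longleftrightarrow>
      (\<forall>\<phi>\<in>S. Leq Q (ty W x) (ty B z) (Comp Q (ty W x) (ty A y) (ty B z) (\<phi> (y, z)) (e (x, y))) (h (x, z)))"
      if "x \<in> obj W" "y \<in> obj A" "z \<in> obj B" for x y z
      using that ob Z S' by (simp add: s_def sup_comp_le_iff elt)
    then show "Leq D W B (Comp D W A B s e) h \<longleftrightarrow> (\<forall>f\<in>S. Leq D W B (Comp D W A B f e) h)"
      using ob Z s sD by (auto simp: Leq_D_iff Comp_D_le_iff elt)
  qed
  then show "\<exists>s. stable_join D (Leq D) A B S s" by (rule exI[of _ s])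
qed

end

section \<open>Implications of distributors, entry by entry\<close>

context universe
begin

lemmas D_limp_hom = quantaloid.limp_hom[OF quantaloid_QDist]
  and D_rimp_hom = quantaloid.rimp_hom[OF quantaloid_QDist]
  and D_le_limp_iff = quantaloid.le_limp_iff[OF quantaloid_QDist]
  and D_le_rimp_iff = quantaloid.le_rimp_iff[OF quantaloid_QDist]
  and D_below_ext = ordered_category.Leq_below_ext[OF ordered_category_QDist]
  and D_limp_ident = quantaloid.limp_ident[OF quantaloid_QDist, unfolded QDist_simps(3)]

text \<open>
  The entries of \<open>h \<swarrow> f\<close> are the meets of \<open>h(x, z) \<swarrow> f(x, y)\<close> over \<open>x\<close>. In the proof, the matrix of these
  entries is called \<open>R\<close>; it is a distributor and has the universal property that characterises
  \<open>h \<swarrow> f\<close>.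
\<close>

lemma le_limp_elt_iff:
  assumes ob: "A \<in> Ob D" "B \<in> Ob D" "Z \<in> Ob D" and f: "f \<in> Hom D A B" and h: "h \<in> Hom D A Z"
    and yz: "y \<in> obj B" "z \<in> obj Z" and k: "k \<in> Hom Q (ty B y) (ty Z z)"
  shows "Leq Q (ty B y) (ty Z z) k (limp D A B Z h f (y, z)) \<longleftrightarrow>
    (\<forall>x\<in>obj A. Leq Q (ty A x) (ty Z z) (Comp Q (ty A x) (ty B y) (ty Z z) k (f (x, y))) (h (x, z)))"
proof -
  define S where "S y z = {k \<in> Hom Q (ty B y) (ty Z z). \<forall>x\<in>obj A. Leq Q (ty A x) (ty Z z)
    (Comp Q (ty A x) (ty B y) (ty Z z) k (f (x, y))) (h (x, z))}" for y z
  define R where "R = (\<lambda>(y, z)\<in>obj B \<times> obj Z. \<Squnion>\<^bsub>hom_order Q (ty B y) (ty Z z)\<^esub> (S y z))"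
  note [simp] = obj_elt[OF ob(1)] obj_elt[OF ob(2)] obj_elt[OF ob(3)] dist_hom[OF ob(1,2) f] dist_hom[OF ob(1,3) h]
    comp_in
  have S: "S y z \<subseteq> Hom Q (ty B y) (ty Z z)" for y z by (auto simp: S_def)
  have R [simp]: "R (y, z) \<in> Hom Q (ty B y) (ty Z z)" if "y \<in> obj B" "z \<in> obj Z" for y z
    using that S by (simp add: R_def sup_hom)
  have Rf: "Leq Q (ty A x) (ty Z z) (Comp Q (ty A x) (ty B y) (ty Z z) (R (y, z)) (f (x, y))) (h (x, z))"
    if "x \<in> obj A" "y \<in> obj B" "z \<in> obj Z" for x y z
    using that S by (simp add: R_def sup_comp_le_iff) (auto simp: S_def)
  have key: "Leq Q (ty B y) (ty Z z) k (R (y, z)) \<longleftrightarrow>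
    (\<forall>x\<in>obj A. Leq Q (ty A x) (ty Z z) (Comp Q (ty A x) (ty B y) (ty Z z) k (f (x, y))) (h (x, z)))"
    if yz: "y \<in> obj B" "z \<in> obj Z" and k: "k \<in> Hom Q (ty B y) (ty Z z)" for y z k
  proof
    assume le: "Leq Q (ty B y) (ty Z z) k (R (y, z))"
    show "\<forall>x\<in>obj A. Leq Q (ty A x) (ty Z z) (Comp Q (ty A x) (ty B y) (ty Z z) k (f (x, y))) (h (x, z))"
    proof
      fix x assume x: "x \<in> obj A"
      show "Leq Q (ty A x) (ty Z z) (Comp Q (ty A x) (ty B y) (ty Z z) k (f (x, y))) (h (x, z))"
        by (rule Leq_trans[OF comp_mono_left[OF _ _ _ _ _ _ le] Rf]) (use x yz k in auto)
    qed
  next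
    assume "\<forall>x\<in>obj A. Leq Q (ty A x) (ty Z z) (Comp Q (ty A x) (ty B y) (ty Z z) k (f (x, y))) (h (x, z))"
    then show "Leq Q (ty B y) (ty Z z) k (R (y, z))"
      using yz k S by (auto simp: R_def S_def intro!: sup_upper)
  qed
  have R_hom: "R \<in> Hom D B Z" unfolding QDist_simps(2)
  proof (subst distributors_iff, goal_cases)
    case 3
    have "Leq Q (ty B y') (ty Z z) (Comp Q (ty B y') (ty B y) (ty Z z) (R (y, z)) (qhom B (y', y))) (R (y', z))"
      if y: "y \<in> obj B" "y' \<in> obj B" "z \<in> obj Z" for y y' z
    proof (subst key, (use y in simp_all)[3], intro ballI)
      fix x assume x: "x \<in> obj A"
      have "Leq Q (ty A x) (ty Z z) (Comp Q (ty A x) (ty B y) (ty Z z) (R (y, z))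
          (Comp Q (ty A x) (ty B y') (ty B y) (qhom B (y', y)) (f (x, y')))) (h (x, z))"
        by (rule Leq_trans[OF comp_mono_right[OF _ _ _ _ _ _ dist_left[OF ob(1,2) f]] Rf])
          (use x y in auto)
      then show "Leq Q (ty A x) (ty Z z) (Comp Q (ty A x) (ty B y') (ty Z z)
        (Comp Q (ty B y') (ty B y) (ty Z z) (R (y, z)) (qhom B (y', y))) (f (x, y'))) (h (x, z))"
        using x y by (simp add: comp_assoc)
    qed
    moreover have "Leq Q (ty B y) (ty Z z') (Comp Q (ty B y) (ty Z z) (ty Z z') (qhom Z (z, z')) (R (y, z))) (R (y, z'))"
      if y: "y \<in> obj B" "z \<in> obj Z" "z' \<in> obj Z" for y z z'
    proof (subst key, (use y in simp_all)[3], intro ballI)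
      fix x assume x: "x \<in> obj A"
      have "Leq Q (ty A x) (ty Z z') (Comp Q (ty A x) (ty Z z) (ty Z z') (qhom Z (z, z'))
          (Comp Q (ty A x) (ty B y) (ty Z z) (R (y, z)) (f (x, y)))) (h (x, z'))"
        by (rule Leq_trans[OF comp_mono_right[OF _ _ _ _ _ _ Rf] dist_left[OF ob(1,3) h]])
          (use x y in auto)
      then show "Leq Q (ty A x) (ty Z z') (Comp Q (ty A x) (ty B y) (ty Z z')
        (Comp Q (ty B y) (ty Z z) (ty Z z') (qhom Z (z, z')) (R (y, z))) (f (x, y))) (h (x, z'))"
        using x y by (simp add: comp_assoc)
    qed
    moreover have "R \<in> extensional (obj B \<times> obj Z)" by (simp add: R_def)
    ultimately show ?case by simp
  qed (use ob in \<open>simp_all add: QDist_simps\<close>)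
  have "limp D A B Z h f = R"
  proof (rule D_below_ext[OF ob(2,3) _ R_hom])
    fix g assume g: "g \<in> Hom D B Z"
    have "Leq D B Z g (limp D A B Z h f) \<longleftrightarrow> Leq D A Z (Comp D A B Z g f) h"
      using ob f h g by (simp add: D_le_limp_iff)
    also have "\<dots> \<longleftrightarrow> Leq D B Z g R"
      using ob f h g dist_hom[OF ob(2,3) g] by (auto simp: Leq_D_iff Comp_D_le_iff key)
    finally show "Leq D B Z g (limp D A B Z h f) \<longleftrightarrow> Leq D B Z g R" .
  qed (use ob f h in \<open>auto intro: D_limp_hom\<close>)
  then show ?thesis using key yz k by simp
qed

text \<open>
  Dually, the entries of \<open>g \<searrow> h\<close> are the meets of \<open>g(y, z) \<searrow> h(x, z)\<close> over \<open>z\<close>.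
\<close>

lemma le_rimp_elt_iff:
  assumes ob: "A \<in> Ob D" "B \<in> Ob D" "Z \<in> Ob D" and g: "g \<in> Hom D B Z" and h: "h \<in> Hom D A Z"
    and xy: "x \<in> obj A" "y \<in> obj B" and k: "k \<in> Hom Q (ty A x) (ty B y)"
  shows "Leq Q (ty A x) (ty B y) k (rimp D A B Z g h (x, y)) \<longleftrightarrow>
    (\<forall>z\<in>obj Z. Leq Q (ty A x) (ty Z z) (Comp Q (ty A x) (ty B y) (ty Z z) (g (y, z)) k) (h (x, z)))"
proof -
  define S where "S x y = {k \<in> Hom Q (ty A x) (ty B y). \<forall>z\<in>obj Z. Leq Q (ty A x) (ty Z z)
    (Comp Q (ty A x) (ty B y) (ty Z z) (g (y, z)) k) (h (x, z))}" for x y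
  define R where "R = (\<lambda>(x, y)\<in>obj A \<times> obj B. \<Squnion>\<^bsub>hom_order Q (ty A x) (ty B y)\<^esub> (S x y))"
  note [simp] = obj_elt[OF ob(1)] obj_elt[OF ob(2)] obj_elt[OF ob(3)] dist_hom[OF ob(2,3) g] dist_hom[OF ob(1,3) h]
    comp_in
  have S: "S x y \<subseteq> Hom Q (ty A x) (ty B y)" for x y by (auto simp: S_def)
  have R [simp]: "R (x, y) \<in> Hom Q (ty A x) (ty B y)" if "x \<in> obj A" "y \<in> obj B" for x y
    using that S by (simp add: R_def sup_hom)
  have Rg: "Leq Q (ty A x) (ty Z z) (Comp Q (ty A x) (ty B y) (ty Z z) (g (y, z)) (R (x, y))) (h (x, z))"
    if "x \<in> obj A" "y \<in> obj B" "z \<in> obj Z" for x y z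
    using that S by (simp add: R_def comp_sup_le_iff) (auto simp: S_def)
  have key: "Leq Q (ty A x) (ty B y) k (R (x, y)) \<longleftrightarrow>
    (\<forall>z\<in>obj Z. Leq Q (ty A x) (ty Z z) (Comp Q (ty A x) (ty B y) (ty Z z) (g (y, z)) k) (h (x, z)))"
    if xy: "x \<in> obj A" "y \<in> obj B" and k: "k \<in> Hom Q (ty A x) (ty B y)" for x y k
  proof
    assume le: "Leq Q (ty A x) (ty B y) k (R (x, y))"
    show "\<forall>z\<in>obj Z. Leq Q (ty A x) (ty Z z) (Comp Q (ty A x) (ty B y) (ty Z z) (g (y, z)) k) (h (x, z))"
    proof
      fix z assume z: "z \<in> obj Z"
      show "Leq Q (ty A x) (ty Z z) (Comp Q (ty A x) (ty B y) (ty Z z) (g (y, z)) k) (h (x, z))"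
        by (rule Leq_trans[OF comp_mono_right[OF _ _ _ _ _ _ le] Rg]) (use z xy k in auto)
    qed
  next
    assume "\<forall>z\<in>obj Z. Leq Q (ty A x) (ty Z z) (Comp Q (ty A x) (ty B y) (ty Z z) (g (y, z)) k) (h (x, z))"
    then show "Leq Q (ty A x) (ty B y) k (R (x, y))"
      using xy k S by (auto simp: R_def S_def intro!: sup_upper)
  qed
  have R_hom: "R \<in> Hom D A B" unfolding QDist_simps(2)
  proof (subst distributors_iff, goal_cases)
    case 3
    have "Leq Q (ty A x') (ty B y) (Comp Q (ty A x') (ty A x) (ty B y) (R (x, y)) (qhom A (x', x))) (R (x', y))"
      if x: "x \<in> obj A" "x' \<in> obj A" "y \<in> obj B" for x x' y
    proof (subst key, (use x in simp_all)[3], intro ballI)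
      fix z assume z: "z \<in> obj Z"
      have "Leq Q (ty A x') (ty Z z) (Comp Q (ty A x') (ty A x) (ty Z z)
          (Comp Q (ty A x) (ty B y) (ty Z z) (g (y, z)) (R (x, y))) (qhom A (x', x))) (h (x', z))"
        by (rule Leq_trans[OF comp_mono_left[OF _ _ _ _ _ _ Rg] dist_right[OF ob(1,3) h]])
          (use x z in auto)
      then show "Leq Q (ty A x') (ty Z z) (Comp Q (ty A x') (ty B y) (ty Z z) (g (y, z))
        (Comp Q (ty A x') (ty A x) (ty B y) (R (x, y)) (qhom A (x', x)))) (h (x', z))"
        using x z by (simp add: comp_assoc)
    qed
    moreover have "Leq Q (ty A x) (ty B y') (Comp Q (ty A x) (ty B y) (ty B y') (qhom B (y, y')) (R (x, y))) (R (x, y'))"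
      if x: "x \<in> obj A" "y \<in> obj B" "y' \<in> obj B" for x y y'
    proof (subst key, (use x in simp_all)[3], intro ballI)
      fix z assume z: "z \<in> obj Z"
      have "Leq Q (ty A x) (ty Z z) (Comp Q (ty A x) (ty B y) (ty Z z)
          (Comp Q (ty B y) (ty B y') (ty Z z) (g (y', z)) (qhom B (y, y'))) (R (x, y))) (h (x, z))"
        by (rule Leq_trans[OF comp_mono_left[OF _ _ _ _ _ _ dist_right[OF ob(2,3) g]] Rg])
          (use x z in auto)
      then show "Leq Q (ty A x) (ty Z z) (Comp Q (ty A x) (ty B y') (ty Z z) (g (y', z))
        (Comp Q (ty A x) (ty B y) (ty B y') (qhom B (y, y')) (R (x, y)))) (h (x, z))"
        using x z by (simp add: comp_assoc)
    qed
    moreover have "R \<in> extensional (obj A \<times> obj B)" by (simp add: R_def)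
    ultimately show ?case by simp
  qed (use ob in \<open>simp_all add: QDist_simps\<close>)
  have "rimp D A B Z g h = R"
  proof (rule D_below_ext[OF ob(1,2) _ R_hom])
    fix f assume f: "f \<in> Hom D A B"
    have "Leq D A B f (rimp D A B Z g h) \<longleftrightarrow> Leq D A Z (Comp D A B Z g f) h"
      using ob f h g by (simp add: D_le_rimp_iff)
    also have "\<dots> \<longleftrightarrow> Leq D A B f R"
      using ob f h g dist_hom[OF ob(1,2) f] by (auto simp: Leq_D_iff Comp_D_le_iff key)
    finally show "Leq D A B f (rimp D A B Z g h) \<longleftrightarrow> Leq D A B f R" .
  qed (use ob g h in \<open>auto intro: D_rimp_hom\<close>)
  then show ?thesis using key xy k by simp
qed

lemma star_simps [simp]:
  "obj (star Q X) = {pt}" "ty (star Q X) pt = X" "qhom (star Q X) (pt, pt) = Ident Q X"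
  by (simp_all add: star_def)

lemma star_ob [simp]: "X \<in> Ob Q \<Longrightarrow> star Q X \<in> Ob D"
  by (auto simp: QDist_simps qcategory_def star_def small_finite ident_in comp_ident_left Leq_refl)

text \<open>
  The column of a distributor at \<open>y\<close>, as a presheaf. The columns of the identity distributor are the
  representable presheaves.
\<close>

definition col :: "('x, 'o, 'a) qcat \<Rightarrow> ('x \<times> 'x \<Rightarrow> 'a) \<Rightarrow> 'x \<Rightarrow> 'x \<times> 'x \<Rightarrow> 'a" where
  "col A \<rho> y = (\<lambda>(x, p)\<in>obj A \<times> {pt}. \<rho> (x, y))"

lemma col_elt [simp]: "x \<in> obj A \<Longrightarrow> col A \<rho> y (x, pt) = \<rho> (x, y)"
  by (simp add: col_def)

lemma presheaf_iff:
  fixes A :: "('x, 'o, 'a) qcat"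
  assumes "A \<in> Ob D" "X \<in> Ob Q"
  shows "\<mu> \<in> Hom D A (star Q X) \<longleftrightarrow> \<mu> \<in> extensional (obj A \<times> {pt}) \<and>
    (\<forall>x\<in>obj A. \<mu> (x, pt) \<in> Hom Q (ty A x) X) \<and>
    (\<forall>x\<in>obj A. \<forall>x'\<in>obj A. Leq Q (ty A x') X
      (Comp Q (ty A x') (ty A x) X (\<mu> (x, pt)) (qhom A (x', x))) (\<mu> (x', pt)))"
proof -
  have "qcategory Q A" "qcategory Q (star Q X :: ('x, 'o, 'a) qcat)"
    using assms star_ob[OF assms(2)] by (auto simp: QDist_simps)
  then show ?thesis using assms
    by (auto simp: QDist_simps distributors_iff comp_ident_left ty_ob Leq_refl)
qed

lemma col_hom [simp]:
  assumes "A \<in> Ob D" "B \<in> Ob D" "\<rho> \<in> Hom D A B" "y \<in> obj B"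
  shows "col A \<rho> y \<in> Hom D A (star Q (ty B y))"
  using assms dist_hom[OF assms(1-3)] dist_right[OF assms(1-3)]
  by (auto simp: presheaf_iff Dty_ob) (simp add: col_def)

lemma presheaf_eqI:
  assumes "A \<in> Ob D" "X \<in> Ob Q" "\<mu> \<in> Hom D A (star Q X)" "\<nu> \<in> Hom D A (star Q X)"
    and "\<And>x. x \<in> obj A \<Longrightarrow> \<mu> (x, pt) = \<nu> (x, pt)"
  shows "\<mu> = \<nu>"
  using assms by (intro dist_eqI[of A "star Q X"]) auto

text \<open>
  An entry of an implication depends on a single column of each argument (\<open>limp_col\<close>, \<open>limp_to_col\<close>).
  These two lemmas translate between implications of distributors and hom-arrows of presheaf categories.
\<close>

lemma limp_col:
  fixes A B Z :: "('x, 'o, 'a) qcat"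
  assumes "A \<in> Ob D" "B \<in> Ob D" "Z \<in> Ob D" "\<rho> \<in> Hom D A B" "h \<in> Hom D A Z" "y \<in> obj B" "z \<in> obj Z"
  shows "limp D A (star Q (ty B y)) Z h (col A \<rho> y) (pt, z) = limp D A B Z h \<rho> (y, z)"
proof (rule Leq_below_ext[of "ty B y" "ty Z z"])
  show "limp D A B Z h \<rho> (y, z) \<in> Hom Q (ty B y) (ty Z z)"
    using assms by (intro dist_hom[of B Z] D_limp_hom)
  have "limp D A (star Q (ty B y)) Z h (col A \<rho> y) (pt, z) \<in> Hom Q (ty (star Q (ty B y)) (pt :: 'x)) (ty Z z)"
    using assms by (intro dist_hom[of "star Q (ty B y)" Z] D_limp_hom) (auto simp: Dty_ob)
  then show "limp D A (star Q (ty B y)) Z h (col A \<rho> y) (pt, z) \<in> Hom Q (ty B y) (ty Z z)" by simp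
  fix k assume "k \<in> Hom Q (ty B y) (ty Z z)"
  then show "Leq Q (ty B y) (ty Z z) k (limp D A (star Q (ty B y)) Z h (col A \<rho> y) (pt, z)) \<longleftrightarrow>
    Leq Q (ty B y) (ty Z z) k (limp D A B Z h \<rho> (y, z))"
    using assms le_limp_elt_iff[of A "star Q (ty B y)" Z "col A \<rho> y" h pt z k]
      le_limp_elt_iff[of A B Z \<rho> h y z k] by (simp add: Dty_ob)
qed (use assms in \<open>auto simp: Dty_ob\<close>)

lemma limp_to_col:
  fixes A B Z :: "('x, 'o, 'a) qcat"
  assumes "A \<in> Ob D" "B \<in> Ob D" "Z \<in> Ob D" "\<rho> \<in> Hom D A B" "h \<in> Hom D A Z" "y \<in> obj B" "z \<in> obj Z"
  shows "limp D A B (star Q (ty Z z)) (col A h z) \<rho> (y, pt) = limp D A B Z h \<rho> (y, z)"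
proof (rule Leq_below_ext[of "ty B y" "ty Z z"])
  show "limp D A B Z h \<rho> (y, z) \<in> Hom Q (ty B y) (ty Z z)"
    using assms by (intro dist_hom[of B Z] D_limp_hom)
  have "limp D A B (star Q (ty Z z)) (col A h z) \<rho> (y, pt) \<in> Hom Q (ty B y) (ty (star Q (ty Z z)) (pt :: 'x))"
    using assms by (intro dist_hom[of B "star Q (ty Z z)"] D_limp_hom) (auto simp: Dty_ob)
  then show "limp D A B (star Q (ty Z z)) (col A h z) \<rho> (y, pt) \<in> Hom Q (ty B y) (ty Z z)" by simp
  fix k assume "k \<in> Hom Q (ty B y) (ty Z z)"
  then show "Leq Q (ty B y) (ty Z z) k (limp D A B (star Q (ty Z z)) (col A h z) \<rho> (y, pt)) \<longleftrightarrow>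
    Leq Q (ty B y) (ty Z z) k (limp D A B Z h \<rho> (y, z))"
    using assms le_limp_elt_iff[of A B "star Q (ty Z z)" \<rho> "col A h z" y pt k]
      le_limp_elt_iff[of A B Z \<rho> h y z k] by (simp add: Dty_ob)
qed (use assms in \<open>auto simp: Dty_ob\<close>)

abbreviation cl :: "('x, 'o, 'a) qcat \<Rightarrow> ('x, 'o, 'a) qcat \<Rightarrow> ('x \<times> 'x \<Rightarrow> 'a) \<Rightarrow> ('x, 'o, 'a) qcat
    \<Rightarrow> ('x \<times> 'x \<Rightarrow> 'a) \<Rightarrow> 'x \<times> 'x \<Rightarrow> 'a" where
  "cl \<equiv> quantaloid.clos D"

lemmas cl_def = quantaloid.clos_def[OF quantaloid_QDist]
  and cl_hom = quantaloid.clos_hom[OF quantaloid_QDist]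

text \<open>
  By the preceding lemmas, the closure acts on each column separately. Hence a distributor is a fixed
  point if and only if all its columns are.
\<close>

lemma col_cl:
  assumes "A \<in> Ob D" "B \<in> Ob D" "Z \<in> Ob D" "\<phi> \<in> Hom D A B" "\<rho> \<in> Hom D A Z" "z \<in> obj Z"
  shows "col A (cl A B \<phi> Z \<rho>) z = cl A B \<phi> (star Q (ty Z z)) (col A \<rho> z)"
proof (rule presheaf_eqI[of A "ty Z z"])
  have c: "cl A B \<phi> Z \<rho> \<in> Hom D A Z" using assms by (intro cl_hom)
  then show "col A (cl A B \<phi> Z \<rho>) z \<in> Hom D A (star Q (ty Z z))" using assms by simp
  show c': "cl A B \<phi> (star Q (ty Z z)) (col A \<rho> z) \<in> Hom D A (star Q (ty Z z))"
    using assms by (intro cl_hom) (auto simp: Dty_ob)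
  fix x assume x: "x \<in> obj A"
  have "cl A B \<phi> Z \<rho> (x, z) = cl A B \<phi> (star Q (ty Z z)) (col A \<rho> z) (x, pt)"
  proof (rule Leq_below_ext[of "ty A x" "ty Z z"])
    show "cl A B \<phi> Z \<rho> (x, z) \<in> Hom Q (ty A x) (ty Z z)"
      using assms x c by (intro dist_hom[of A Z])
    show "cl A B \<phi> (star Q (ty Z z)) (col A \<rho> z) (x, pt) \<in> Hom Q (ty A x) (ty Z z)"
      using c' assms x by (simp add: presheaf_iff Dty_ob)
    fix k assume k: "k \<in> Hom Q (ty A x) (ty Z z)"
    have "Leq Q (ty A x) (ty Z z) k (cl A B \<phi> Z \<rho> (x, z)) \<longleftrightarrow>
      (\<forall>y\<in>obj B. Leq Q (ty A x) (ty B y) (Comp Q (ty A x) (ty Z z) (ty B y) (limp D A Z B \<phi> \<rho> (z, y)) k) (\<phi> (x, y)))"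
      unfolding cl_def using assms x k by (intro le_rimp_elt_iff) (auto intro: D_limp_hom)
    moreover have "Leq Q (ty A x) (ty Z z) k (cl A B \<phi> (star Q (ty Z z)) (col A \<rho> z) (x, pt)) \<longleftrightarrow>
      (\<forall>y\<in>obj B. Leq Q (ty A x) (ty B y) (Comp Q (ty A x) (ty Z z) (ty B y)
        (limp D A (star Q (ty Z z)) B \<phi> (col A \<rho> z) (pt, y)) k) (\<phi> (x, y)))"
    proof -
      have "limp D A (star Q (ty Z z)) B \<phi> (col A \<rho> z) \<in> Hom D (star Q (ty Z z)) B"
        using assms by (intro D_limp_hom) (auto simp: Dty_ob)
      then show ?thesis
        unfolding cl_def
        using assms x k le_rimp_elt_iff[of A "star Q (ty Z z)" B "limp D A (star Q (ty Z z)) B \<phi> (col A \<rho> z)" \<phi> x pt k]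
        by (simp add: Dty_ob)
    qed
    ultimately show "Leq Q (ty A x) (ty Z z) k (cl A B \<phi> Z \<rho> (x, z)) \<longleftrightarrow>
      Leq Q (ty A x) (ty Z z) k (cl A B \<phi> (star Q (ty Z z)) (col A \<rho> z) (x, pt))"
      using assms by (simp add: limp_col)
  qed (use assms x in \<open>auto simp: Dty_ob\<close>)
  then show "col A (cl A B \<phi> Z \<rho>) z (x, pt) = cl A B \<phi> (star Q (ty Z z)) (col A \<rho> z) (x, pt)"
    using x by simp
qed (use assms in \<open>auto simp: Dty_ob\<close>)

end

section \<open>Isomorphic copies of enriched categories\<close>

text \<open>
  Isomorphisms of enriched categories whose carriers may have different types; there is no quantaloid
  in which both would be objects.
\<close>

definition qiso :: "('x, 'o, 'a) qcat \<Rightarrow> ('y, 'o, 'a) qcat \<Rightarrow> ('x \<Rightarrow> 'y) \<Rightarrow> bool" where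
  "qiso A B h \<longleftrightarrow> bij_betw h (obj A) (obj B) \<and> (\<forall>x\<in>obj A. ty B (h x) = ty A x) \<and>
     (\<forall>x\<in>obj A. \<forall>y\<in>obj A. qhom B (h x, h y) = qhom A (x, y))"

lemma qisoD:
  assumes "qiso A B h"
  shows "x \<in> obj A \<Longrightarrow> h x \<in> obj B" "x \<in> obj A \<Longrightarrow> ty B (h x) = ty A x"
    "\<lbrakk>x \<in> obj A; y \<in> obj A\<rbrakk> \<Longrightarrow> qhom B (h x, h y) = qhom A (x, y)"
    "obj B = h ` obj A" "inj_on h (obj A)"
  using assms by (auto simp: qiso_def bij_betw_def)

lemma qiso_inv: "qiso A B h \<Longrightarrow> qiso B A (inv_into (obj A) h)"
  unfolding qiso_def using bij_betw_inv_into bij_betw_inv_into_right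
  by (smt (verit) bij_betwE)

lemma qiso_comp: "qiso A B h \<Longrightarrow> qiso B C k \<Longrightarrow> qiso A C (k \<circ> h)"
  unfolding qiso_def by (auto simp: bij_betw_trans dest: bij_betwE)

definition qcopy :: "('x \<Rightarrow> 'y) \<Rightarrow> ('x, 'o, 'a) qcat \<Rightarrow> ('y, 'o, 'a) qcat" where
  "qcopy h A = (let g = inv_into (obj A) h in
     \<lparr>obj = h ` obj A, ty = (\<lambda>y\<in>h ` obj A. ty A (g y)),
      qhom = (\<lambda>(y, y')\<in>h ` obj A \<times> h ` obj A. qhom A (g y, g y'))\<rparr>)"

lemma qiso_qcopy: "inj_on h (obj A) \<Longrightarrow> qiso A (qcopy h A) h"
  by (auto simp: qiso_def qcopy_def Let_def bij_betw_def)

section \<open>Enriched adjunctions, presheaves and completeness\<close>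

context universe
begin

lemma small_inj_on: "inj_on f S \<Longrightarrow> f ` S \<subseteq> T \<Longrightarrow> small \<kappa> T \<Longrightarrow> small \<kappa> S"
  unfolding small_def using card_of_ordLeq[of S T] ordLeq_ordLess_trans by blast

lemma under_le_refl: "qcategory Q A \<Longrightarrow> x \<in> obj A \<Longrightarrow> under_le Q A x x"
  by (simp add: under_le_def qhom_ident)

lemma under_le_hom_right:
  assumes A: "qcategory Q A" and x: "x \<in> obj A" "y \<in> obj A" "z \<in> obj A" and le: "under_le Q A y z"
  shows "Leq Q (ty A x) (ty A z) (qhom A (x, y)) (qhom A (x, z))"
proof -
  note m = ty_ob[OF A] qhom_hom[OF A] ident_in comp_in
  have ty: "ty A z = ty A y" and one: "Leq Q (ty A y) (ty A y) (Ident Q (ty A y)) (qhom A (y, z))"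
    using le by (auto simp: under_le_def)
  have yz: "qhom A (y, z) \<in> Hom Q (ty A y) (ty A y)" using qhom_hom[OF A, of y z] x ty by simp
  have "Leq Q (ty A x) (ty A y) (Comp Q (ty A x) (ty A y) (ty A y) (Ident Q (ty A y)) (qhom A (x, y)))
    (Comp Q (ty A x) (ty A y) (ty A y) (qhom A (y, z)) (qhom A (x, y)))"
    using x one yz by (intro comp_mono_left) (auto simp: m)
  then show ?thesis
    using qhom_comp[OF A x(1,2,3)] x ty yz qhom_hom[OF A, of x z]
    by (auto simp: m comp_ident_left intro: Leq_trans)
qed

lemma under_le_hom_left:
  assumes A: "qcategory Q A" and x: "x \<in> obj A" "y \<in> obj A" "z \<in> obj A" and le: "under_le Q A x y"
  shows "Leq Q (ty A x) (ty A z) (qhom A (y, z)) (qhom A (x, z))"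
proof -
  note m = ty_ob[OF A] qhom_hom[OF A] ident_in comp_in
  have ty: "ty A y = ty A x" and one: "Leq Q (ty A x) (ty A x) (Ident Q (ty A x)) (qhom A (x, y))"
    using le by (auto simp: under_le_def)
  have xy: "qhom A (x, y) \<in> Hom Q (ty A x) (ty A x)" "qhom A (y, z) \<in> Hom Q (ty A x) (ty A z)"
    using qhom_hom[OF A, of x y] qhom_hom[OF A, of y z] x ty by simp_all
  have "Leq Q (ty A x) (ty A z) (Comp Q (ty A x) (ty A x) (ty A z) (qhom A (y, z)) (Ident Q (ty A x)))
    (Comp Q (ty A x) (ty A x) (ty A z) (qhom A (y, z)) (qhom A (x, y)))"
    using x one xy by (intro comp_mono_right) (auto simp: m)
  then show ?thesis
    using qhom_comp[OF A x(1,2,3)] x ty xy qhom_hom[OF A, of x z]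
    by (auto simp: m comp_ident_right intro: Leq_trans)
qed

lemma under_le_trans:
  assumes A: "qcategory Q A" and x: "x \<in> obj A" "y \<in> obj A" "z \<in> obj A"
    and le: "under_le Q A x y" "under_le Q A y z"
  shows "under_le Q A x z"
proof -
  have ty: "ty A z = ty A y" "ty A y = ty A x" using le by (auto simp: under_le_def)
  have "Leq Q (ty A x) (ty A x) (qhom A (x, y)) (qhom A (x, z))"
    using under_le_hom_right[OF A x le(2)] ty by simp
  moreover have "qhom A (x, y) \<in> Hom Q (ty A x) (ty A x)" "qhom A (x, z) \<in> Hom Q (ty A x) (ty A x)"
    using qhom_hom[OF A, of x y] qhom_hom[OF A, of x z] x ty by simp_all
  ultimately show ?thesis
    using le(1) ty x Leq_trans[of "ty A x" "ty A x" "Ident Q (ty A x)" "qhom A (x, y)" "qhom A (x, z)"]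
    by (auto simp: under_le_def ty_ob[OF A] ident_in)
qed

lemma adjoint_unit_counit:
  assumes A: "qcategory Q A" and B: "qcategory Q B"
    and F: "\<And>x. x \<in> obj A \<Longrightarrow> F x \<in> obj B \<and> ty B (F x) = ty A x"
    and G: "\<And>y. y \<in> obj B \<Longrightarrow> G y \<in> obj A \<and> ty A (G y) = ty B y"
    and hom: "\<And>x y. x \<in> obj A \<Longrightarrow> y \<in> obj B \<Longrightarrow> qhom B (F x, y) = qhom A (x, G y)"
  shows "x \<in> obj A \<Longrightarrow> under_le Q A x (G (F x))"
    and "y \<in> obj B \<Longrightarrow> under_le Q B (F (G y)) y"
    and "\<lbrakk>x \<in> obj A; x' \<in> obj A\<rbrakk> \<Longrightarrow>
      Leq Q (ty A x) (ty A x') (qhom A (x, x')) (qhom B (F x, F x'))"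
    and "\<lbrakk>y \<in> obj B; y' \<in> obj B\<rbrakk> \<Longrightarrow>
      Leq Q (ty B y) (ty B y') (qhom B (y, y')) (qhom A (G y, G y'))"
proof -
  show unit: "under_le Q A x (G (F x))" if "x \<in> obj A" for x
    using qhom_ident[OF B, of "F x"] F[OF that] G[of "F x"] hom[of x "F x"] that
    by (simp add: under_le_def)
  show counit: "under_le Q B (F (G y)) y" if "y \<in> obj B" for y
    using qhom_ident[OF A, of "G y"] G[OF that] F[of "G y"] hom[of "G y" y] that
    by (simp add: under_le_def)
  show "Leq Q (ty A x) (ty A x') (qhom A (x, x')) (qhom B (F x, F x'))" if "x \<in> obj A" "x' \<in> obj A"
    using under_le_hom_right[OF A that(1,2) _ unit[OF that(2)]] F G hom that by auto
  show "Leq Q (ty B y) (ty B y') (qhom B (y, y')) (qhom A (G y, G y'))" if "y \<in> obj B" "y' \<in> obj B"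
    using under_le_hom_left[OF B _ that counit[OF that(1)]] F G hom[symmetric] that by auto
qed

text \<open>
  Unit and counit of an adjunction amount to an equality of hom-arrows. In this form the functoriality of both maps is automatic, and composites, identities and isomorphic copies of
  adjunctions are immediate.
\<close>

lemma qadjoint_iff:
  assumes A: "qcategory Q A" and B: "qcategory Q B"
  shows "qadjoint Q A B F G \<longleftrightarrow> F \<in> obj A \<rightarrow>\<^sub>E obj B \<and> G \<in> obj B \<rightarrow>\<^sub>E obj A \<and>
    (\<forall>x\<in>obj A. ty B (F x) = ty A x) \<and> (\<forall>y\<in>obj B. ty A (G y) = ty B y) \<and>
    (\<forall>x\<in>obj A. \<forall>y\<in>obj B. qhom B (F x, y) = qhom A (x, G y))"
proof
  assume *: "F \<in> obj A \<rightarrow>\<^sub>E obj B \<and> G \<in> obj B \<rightarrow>\<^sub>E obj A \<and>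
    (\<forall>x\<in>obj A. ty B (F x) = ty A x) \<and> (\<forall>y\<in>obj B. ty A (G y) = ty B y) \<and>
    (\<forall>x\<in>obj A. \<forall>y\<in>obj B. qhom B (F x, y) = qhom A (x, G y))"
  then have F: "\<And>x. x \<in> obj A \<Longrightarrow> F x \<in> obj B \<and> ty B (F x) = ty A x"
    and G: "\<And>y. y \<in> obj B \<Longrightarrow> G y \<in> obj A \<and> ty A (G y) = ty B y" by auto
  have hom: "\<And>x y. x \<in> obj A \<Longrightarrow> y \<in> obj B \<Longrightarrow> qhom B (F x, y) = qhom A (x, G y)"
    using * by blast
  show "qadjoint Q A B F G"
    using * F G adjoint_unit_counit[OF A B F G hom]
    by (simp add: qadjoint_def qfunctor_def qfunctor_le_def compose_eq)
next
  assume *: "qadjoint Q A B F G"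
  then have F: "\<And>x. x \<in> obj A \<Longrightarrow> F x \<in> obj B \<and> ty B (F x) = ty A x"
    and G: "\<And>y. y \<in> obj B \<Longrightarrow> G y \<in> obj A \<and> ty A (G y) = ty B y"
    and unit: "\<And>x. x \<in> obj A \<Longrightarrow> under_le Q A x (G (F x))"
    and counit: "\<And>y. y \<in> obj B \<Longrightarrow> under_le Q B (F (G y)) y"
    and Ff: "\<And>x x'. \<lbrakk>x \<in> obj A; x' \<in> obj A\<rbrakk> \<Longrightarrow>
      Leq Q (ty A x) (ty A x') (qhom A (x, x')) (qhom B (F x, F x'))"
    and Gf: "\<And>y y'. \<lbrakk>y \<in> obj B; y' \<in> obj B\<rbrakk> \<Longrightarrow>
      Leq Q (ty B y) (ty B y') (qhom B (y, y')) (qhom A (G y, G y'))"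
    by (auto simp: qadjoint_def qfunctor_def qfunctor_le_def compose_eq)
  have "qhom B (F x, y) = qhom A (x, G y)" if x: "x \<in> obj A" and y: "y \<in> obj B" for x y
  proof (rule Leq_antisym[of "ty A x" "ty B y"])
    have h: "qhom B (F x, y) \<in> Hom Q (ty A x) (ty B y)" "qhom A (x, G y) \<in> Hom Q (ty A x) (ty B y)"
      "qhom A (G (F x), G y) \<in> Hom Q (ty A x) (ty B y)" "qhom B (F x, F (G y)) \<in> Hom Q (ty A x) (ty B y)"
      using x y F G qhom_hom[OF A, of x "G y"] qhom_hom[OF B, of "F x" y]
        qhom_hom[OF A, of "G (F x)" "G y"] qhom_hom[OF B, of "F x" "F (G y)"] by simp_all
    show t: "ty A x \<in> Ob Q" "ty B y \<in> Ob Q" using x y by (auto intro: ty_ob A B)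
    show "qhom B (F x, y) \<in> Hom Q (ty A x) (ty B y)" "qhom A (x, G y) \<in> Hom Q (ty A x) (ty B y)"
      by (fact h)+
    have "Leq Q (ty A x) (ty B y) (qhom B (F x, y)) (qhom A (G (F x), G y))"
      using Gf[of "F x" y] F x y by simp
    moreover have "Leq Q (ty A x) (ty B y) (qhom A (G (F x), G y)) (qhom A (x, G y))"
      using under_le_hom_left[OF A _ _ _ unit[OF x], of "G y"] F G x y by simp
    ultimately show "Leq Q (ty A x) (ty B y) (qhom B (F x, y)) (qhom A (x, G y))"
      by (rule Leq_trans[OF _ _ t h(1,3,2)])
    have "Leq Q (ty A x) (ty B y) (qhom A (x, G y)) (qhom B (F x, F (G y)))"
      using Ff[of x "G y"] G x y by simp
    moreover have "Leq Q (ty A x) (ty B y) (qhom B (F x, F (G y))) (qhom B (F x, y))"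
      using under_le_hom_right[OF B _ _ _ counit[OF y], of "F x"] F G x y by simp
    ultimately show "Leq Q (ty A x) (ty B y) (qhom A (x, G y)) (qhom B (F x, y))"
      by (rule Leq_trans[OF _ _ t h(2,4,1)])
  qed
  then show "F \<in> obj A \<rightarrow>\<^sub>E obj B \<and> G \<in> obj B \<rightarrow>\<^sub>E obj A \<and>
    (\<forall>x\<in>obj A. ty B (F x) = ty A x) \<and> (\<forall>y\<in>obj B. ty A (G y) = ty B y) \<and>
    (\<forall>x\<in>obj A. \<forall>y\<in>obj B. qhom B (F x, y) = qhom A (x, G y))"
    using * by (auto simp: qadjoint_def qfunctor_def)
qed

abbreviation PSh :: "('x, 'o, 'a) qcat \<Rightarrow> (('x, 'o, 'a) presheaf, 'o, 'a) qcat" where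
  "PSh \<equiv> presheaves \<kappa> Q"

lemma presheaves_simps:
  "(X, \<mu>) \<in> obj (PSh A) \<longleftrightarrow> X \<in> Ob Q \<and> \<mu> \<in> Hom D A (star Q X)"
  "\<lbrakk>X \<in> Ob Q; \<mu> \<in> Hom D A (star Q X)\<rbrakk> \<Longrightarrow> ty (PSh A) (X, \<mu>) = X"
  "\<lbrakk>X \<in> Ob Q; \<mu> \<in> Hom D A (star Q X); X' \<in> Ob Q; \<mu>' \<in> Hom D A (star Q X')\<rbrakk> \<Longrightarrow>
    qhom (PSh A) ((X, \<mu>), (X', \<mu>')) = limp D A (star Q X) (star Q X') \<mu>' \<mu> (pt, pt)"
  by (simp_all add: presheaves_def Let_def)

lemma presheaf_hom:
  fixes A :: "('x, 'o, 'a) qcat"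
  assumes "A \<in> Ob D" "X \<in> Ob Q" "\<mu> \<in> Hom D A (star Q X)" "X' \<in> Ob Q" "\<mu>' \<in> Hom D A (star Q X')"
  shows "qhom (PSh A) ((X, \<mu>), (X', \<mu>')) \<in> Hom Q X X'"
    and "k \<in> Hom Q X X' \<Longrightarrow> Leq Q X X' k (qhom (PSh A) ((X, \<mu>), (X', \<mu>'))) \<longleftrightarrow>
      (\<forall>x\<in>obj A. Leq Q (ty A x) X' (Comp Q (ty A x) X X' k (\<mu> (x, pt))) (\<mu>' (x, pt)))"
proof -
  have "limp D A (star Q X) (star Q X') \<mu>' \<mu> \<in> Hom D (star Q X) (star Q X')"
    using assms by (intro D_limp_hom) auto
  from dist_hom[OF _ _ this, of pt pt]
  show "qhom (PSh A) ((X, \<mu>), (X', \<mu>')) \<in> Hom Q X X'"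
    using assms by (simp add: presheaves_simps)
  show "k \<in> Hom Q X X' \<Longrightarrow> Leq Q X X' k (qhom (PSh A) ((X, \<mu>), (X', \<mu>'))) \<longleftrightarrow>
      (\<forall>x\<in>obj A. Leq Q (ty A x) X' (Comp Q (ty A x) X X' k (\<mu> (x, pt))) (\<mu>' (x, pt)))"
    using le_limp_elt_iff[of A "star Q X" "star Q X'" \<mu> \<mu>' pt pt k] assms
    by (simp add: presheaves_simps)
qed

lemma presheaf_elt:
  "\<lbrakk>A \<in> Ob D; X \<in> Ob Q; \<mu> \<in> Hom D A (star Q X); x \<in> obj A\<rbrakk> \<Longrightarrow> \<mu> (x, pt) \<in> Hom Q (ty A x) X"
  by (simp add: presheaf_iff)

lemma qcategory_presheaves:
  fixes A :: "('x, 'o, 'a) qcat"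
  assumes A: "A \<in> Ob D"
  shows "qcategory Q (PSh A)"
proof -
  have "ty (PSh A) \<in> obj (PSh A) \<rightarrow>\<^sub>E Ob Q" by (auto simp: presheaves_def Let_def)
  moreover have "qhom (PSh A) \<in> (\<Pi>\<^sub>E (x, y)\<in>obj (PSh A) \<times> obj (PSh A). Hom Q (ty (PSh A) x) (ty (PSh A) y))"
  proof (rule PiE_I)
    fix p assume "p \<in> obj (PSh A) \<times> obj (PSh A)"
    then show "qhom (PSh A) p \<in> (case p of (x, y) \<Rightarrow> Hom Q (ty (PSh A) x) (ty (PSh A) y))"
      using presheaf_hom(1)[OF A] by (auto simp: presheaves_simps)
  qed (auto simp: presheaves_def Let_def)
  moreover have "Leq Q X X (Ident Q X) (qhom (PSh A) ((X, \<mu>), (X, \<mu>)))"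
    if "X \<in> Ob Q" "\<mu> \<in> Hom D A (star Q X)" for X \<mu>
    using A that by (subst presheaf_hom(2))
      (auto simp: ident_in comp_ident_left presheaf_elt Dty_ob Leq_refl)
  moreover have "Leq Q X X'' (Comp Q X X' X'' (qhom (PSh A) ((X', \<mu>'), (X'', \<mu>''))) (qhom (PSh A) ((X, \<mu>), (X', \<mu>'))))
      (qhom (PSh A) ((X, \<mu>), (X'', \<mu>'')))"
    if "X \<in> Ob Q" "\<mu> \<in> Hom D A (star Q X)" "X' \<in> Ob Q" "\<mu>' \<in> Hom D A (star Q X')"
      "X'' \<in> Ob Q" "\<mu>'' \<in> Hom D A (star Q X'')" for X \<mu> X' \<mu>' X'' \<mu>''
  proof (subst presheaf_hom(2)[OF A], (use A that presheaf_hom(1)[OF A] in \<open>auto intro: comp_in\<close>)[5], intro ballI)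
    fix x assume x: "x \<in> obj A"
    let ?h = "qhom (PSh A) ((X, \<mu>), (X', \<mu>'))" and ?h' = "qhom (PSh A) ((X', \<mu>'), (X'', \<mu>''))"
    have m: "?h \<in> Hom Q X X'" "?h' \<in> Hom Q X' X''" "\<mu> (x, pt) \<in> Hom Q (ty A x) X"
      "\<mu>' (x, pt) \<in> Hom Q (ty A x) X'" "\<mu>'' (x, pt) \<in> Hom Q (ty A x) X''" "ty A x \<in> Ob Q"
      using A that x by (auto intro: presheaf_hom(1) presheaf_elt Dty_ob)
    have 1: "Leq Q (ty A x) X' (Comp Q (ty A x) X X' ?h (\<mu> (x, pt))) (\<mu>' (x, pt))"
      using A that x m(1) presheaf_hom(2)[of A X \<mu> X' \<mu>' ?h] by (auto intro: Leq_refl)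
    have 2: "Leq Q (ty A x) X'' (Comp Q (ty A x) X' X'' ?h' (\<mu>' (x, pt))) (\<mu>'' (x, pt))"
      using A that x m(2) presheaf_hom(2)[of A X' \<mu>' X'' \<mu>'' ?h'] by (auto intro: Leq_refl)
    have "Leq Q (ty A x) X'' (Comp Q (ty A x) X' X'' ?h' (Comp Q (ty A x) X X' ?h (\<mu> (x, pt)))) (\<mu>'' (x, pt))"
      by (rule Leq_trans[OF comp_mono_right[OF _ _ _ _ _ _ 1] 2]) (use m that in \<open>auto intro: comp_in\<close>)
    then show "Leq Q (ty A x) X'' (Comp Q (ty A x) X X'' (Comp Q X X' X'' ?h' ?h) (\<mu> (x, pt))) (\<mu>'' (x, pt))"
      using m that by (simp add: comp_assoc)
  qed
  ultimately show ?thesis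
    unfolding qcategory_def by (auto simp: presheaves_simps)
qed

lemma under_le_presheaves:
  fixes A :: "('x, 'o, 'a) qcat"
  assumes A: "A \<in> Ob D" and "X \<in> Ob Q" "\<mu> \<in> Hom D A (star Q X)" "X' \<in> Ob Q" "\<mu>' \<in> Hom D A (star Q X')"
  shows "under_le Q (PSh A) (X, \<mu>) (X', \<mu>') \<longleftrightarrow> X' = X \<and> Leq D A (star Q X) \<mu> \<mu>'"
proof (cases "X' = X")
  case True
  then show ?thesis
    using assms presheaf_hom(2)[of A X \<mu> X \<mu>' "Ident Q X"]
    by (simp add: under_le_def presheaves_simps Leq_D_iff ident_in comp_ident_left presheaf_elt Dty_ob)
qed (use assms in \<open>auto simp: under_le_def presheaves_simps\<close>)

lemma skeletal_presheaves:
  fixes A :: "('x, 'o, 'a) qcat"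
  assumes A: "A \<in> Ob D"
  shows "skeletal Q (PSh A)"
proof -
  have "\<mu> = \<mu>'" if "X \<in> Ob Q" "\<mu> \<in> Hom D A (star Q X)" "\<mu>' \<in> Hom D A (star Q X)"
    "Leq D A (star Q X) \<mu> \<mu>'" "Leq D A (star Q X) \<mu>' \<mu>" for X \<mu> \<mu>'
    using A that by (intro ordered_category.Leq_antisym[OF ordered_category_QDist, of A "star Q X"]) auto
  then show ?thesis using A by (auto simp: skeletal_def presheaves_simps under_le_presheaves)
qed

text \<open>
  A presheaf of type \<open>X\<close> is determined by \<open>X\<close> and its graph, a set of pairs of an object of \<open>A\<close> and an arrow
  of \<open>Q\<close>. The type is recorded separately since the graph is empty if \<open>A\<close> is.
\<close>

lemma small_presheaves:
  fixes A :: "('x, 'o, 'a) qcat"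
  assumes A: "A \<in> Ob D"
  shows "small \<kappa> (obj (PSh A))"
proof (rule small_inj_on)
  define graph where "graph = (\<lambda>(X :: 'o, \<mu> :: 'x \<times> 'x \<Rightarrow> 'a). (X, (\<lambda>x. (x, ty A x, X, \<mu> (x, pt))) ` obj A))"
  show "inj_on graph (obj (PSh A))"
  proof (rule inj_onI)
    fix p p' assume *: "p \<in> obj (PSh A)" "p' \<in> obj (PSh A)" "graph p = graph p'"
    obtain X \<mu> X' \<mu>' where eq: "p = (X, \<mu>)" "p' = (X', \<mu>')" by fastforce
    then have X: "X' = X" using * by (simp add: graph_def)
    have "\<mu> (x, pt) = \<mu>' (x, pt)" if "x \<in> obj A" for x
    proof -
      have "(x, ty A x, X, \<mu> (x, pt)) \<in> snd (graph p)"
        using that eq by (simp add: graph_def)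
      then have "(x, ty A x, X, \<mu> (x, pt)) \<in> snd (graph p')" using *(3) by simp
      then show ?thesis using eq by (auto simp: graph_def)
    qed
    then show "p = p'" using * A eq X by (auto simp: presheaves_simps intro: presheaf_eqI)
  qed
  show "graph ` obj (PSh A) \<subseteq> Ob Q \<times> Pow (obj A \<times> arrows Q)"
    using A by (auto simp: graph_def presheaves_simps arrows_def presheaf_elt Dty_ob)
  show "small \<kappa> (Ob Q \<times> Pow (obj A \<times> arrows Q))"
    using Q A by (intro small_Times small_Pow) (auto simp: small_quantaloid_def QDist_simps)
qed

lemma yoneda_eq: "x \<in> obj A \<Longrightarrow> yoneda A x = (ty A x, col A (qhom A) x)"
  by (simp add: yoneda_def col_def)

text \<open>
  As the Yoneda presheaf is a column of the identity distributor, this is \<open>\<mu> \<swarrow> 1 = \<mu>\<close>.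
\<close>

lemma yoneda_lemma:
  fixes A :: "('x, 'o, 'a) qcat"
  assumes "A \<in> Ob D" "X \<in> Ob Q" "\<mu> \<in> Hom D A (star Q X)" "x \<in> obj A"
  shows "qhom (PSh A) (yoneda A x, (X, \<mu>)) = \<mu> (x, pt)"
  using assms limp_col[of A A "star Q X" "qhom A" \<mu> x pt]
  by (simp add: yoneda_eq presheaves_simps Dty_ob qhom_D D_limp_ident)

lemma yoneda_hom: "A \<in> Ob D \<Longrightarrow> yoneda A \<in> obj A \<rightarrow>\<^sub>E obj (PSh A)"
  by (auto simp: yoneda_eq presheaves_simps Dty_ob qhom_D) (simp add: yoneda_def)

text \<open>
  Presheaves and their suprema without reference to one-object categories, so that completeness can be
  compared for categories over different carrier types.
\<close>

definition weight :: "('x, 'o, 'a) qcat \<Rightarrow> 'o \<Rightarrow> ('x \<Rightarrow> 'a) \<Rightarrow> bool" where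
  "weight A X m \<longleftrightarrow> (\<forall>x\<in>obj A. m x \<in> Hom Q (ty A x) X) \<and>
    (\<forall>x\<in>obj A. \<forall>x'\<in>obj A. Leq Q (ty A x') X (Comp Q (ty A x') (ty A x) X (m x) (qhom A (x', x))) (m x'))"

definition supremum :: "('x, 'o, 'a) qcat \<Rightarrow> 'o \<Rightarrow> ('x \<Rightarrow> 'a) \<Rightarrow> 'x \<Rightarrow> bool" where
  "supremum A X m s \<longleftrightarrow> s \<in> obj A \<and> ty A s = X \<and> (\<forall>y\<in>obj A. \<forall>k\<in>Hom Q X (ty A y).
    Leq Q X (ty A y) k (qhom A (s, y)) \<longleftrightarrow>
    (\<forall>x\<in>obj A. Leq Q (ty A x) (ty A y) (Comp Q (ty A x) X (ty A y) k (m x)) (qhom A (x, y))))"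

text \<open>
  A left adjoint of the Yoneda embedding is a choice of suprema.
\<close>

lemma qcomplete_iff:
  fixes A :: "('x, 'o, 'a) qcat"
  assumes A: "A \<in> Ob D"
  shows "qcomplete \<kappa> Q A \<longleftrightarrow> (\<forall>X\<in>Ob Q. \<forall>m. weight A X m \<longrightarrow> (\<exists>s. supremum A X m s))"
proof -
  have qA: "qcategory Q A" using A by (simp add: QDist_simps)
  have hom_iff: "(\<forall>y\<in>obj A. qhom A (s, y) = qhom (PSh A) ((X, \<mu>), yoneda A y)) \<longleftrightarrow>
      supremum A X (\<lambda>x. \<mu> (x, pt)) s"
    if X: "X \<in> Ob Q" "\<mu> \<in> Hom D A (star Q X)" and s: "s \<in> obj A" "ty A s = X" for X \<mu> s
  proof -
    have "qhom A (s, y) = qhom (PSh A) ((X, \<mu>), yoneda A y) \<longleftrightarrow>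
      (\<forall>k\<in>Hom Q X (ty A y). Leq Q X (ty A y) k (qhom A (s, y)) \<longleftrightarrow>
    (\<forall>x\<in>obj A. Leq Q (ty A x) (ty A y) (Comp Q (ty A x) X (ty A y) k (\<mu> (x, pt))) (qhom A (x, y))))"
      if y: "y \<in> obj A" for y
    proof -
      let ?h = "qhom (PSh A) ((X, \<mu>), yoneda A y)"
      have t: "ty A y \<in> Ob Q" using A y by (rule Dty_ob)
      have h: "?h \<in> Hom Q X (ty A y)" "qhom A (s, y) \<in> Hom Q X (ty A y)"
        using A X y s presheaf_hom(1)[of A X \<mu> "ty A y" "col A (qhom A) y"] Dqhom_hom[OF A s(1) y]
        by (simp_all add: yoneda_eq Dty_ob qhom_D)
      have le: "Leq Q X (ty A y) k ?h \<longleftrightarrow>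
        (\<forall>x\<in>obj A. Leq Q (ty A x) (ty A y) (Comp Q (ty A x) X (ty A y) k (\<mu> (x, pt))) (qhom A (x, y)))"
        if "k \<in> Hom Q X (ty A y)" for k
        using A X y that presheaf_hom(2)[of A X \<mu> "ty A y" "col A (qhom A) y" k]
        by (simp add: yoneda_eq Dty_ob qhom_D)
      show ?thesis
        using le Leq_below_ext[OF X(1) t h(2,1)] by auto
    qed
    then show ?thesis using s by (simp add: supremum_def)
  qed
  have weight: "weight A X (\<lambda>x. \<mu> (x, pt))" if "X \<in> Ob Q" "\<mu> \<in> Hom D A (star Q X)" for X \<mu>
    using A that by (simp add: presheaf_iff weight_def)
  have unweight: "\<exists>\<mu>\<in>Hom D A (star Q X). \<forall>x\<in>obj A. m x = \<mu> (x, pt)" if "X \<in> Ob Q" "weight A X m" for X m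
    using A that by (intro bexI[of _ "\<lambda>(x, p)\<in>obj A \<times> {pt}. m x"]) (auto simp: presheaf_iff weight_def)
  have sup_cong: "supremum A X m s \<longleftrightarrow> supremum A X m' s" if "\<forall>x\<in>obj A. m x = m' x" for X m m' s
    using that by (simp add: supremum_def)
  have "qcomplete \<kappa> Q A \<longleftrightarrow> (\<forall>X\<in>Ob Q. \<forall>\<mu>\<in>Hom D A (star Q X). \<exists>s. supremum A X (\<lambda>x. \<mu> (x, pt)) s)"
  proof
    assume "qcomplete \<kappa> Q A"
    then obtain S where S: "qadjoint Q (PSh A) A S (yoneda A)" by (auto simp: qcomplete_def)
    have "supremum A X (\<lambda>x. \<mu> (x, pt)) (S (X, \<mu>))" if X: "X \<in> Ob Q" "\<mu> \<in> Hom D A (star Q X)" for X \<mu>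
      using S X hom_iff[OF X, of "S (X, \<mu>)"]
      unfolding qadjoint_iff[OF qcategory_presheaves[OF A] qA]
      by (force simp: presheaves_simps PiE_def Pi_def)
    then show "\<forall>X\<in>Ob Q. \<forall>\<mu>\<in>Hom D A (star Q X). \<exists>s. supremum A X (\<lambda>x. \<mu> (x, pt)) s" by blast
  next
    assume *: "\<forall>X\<in>Ob Q. \<forall>\<mu>\<in>Hom D A (star Q X). \<exists>s. supremum A X (\<lambda>x. \<mu> (x, pt)) s"
    define S where "S = (\<lambda>(X, \<mu>)\<in>obj (PSh A). SOME s. supremum A X (\<lambda>x. \<mu> (x, pt)) s)"
    have S: "supremum A X (\<lambda>x. \<mu> (x, pt)) (S (X, \<mu>))" if X: "X \<in> Ob Q" "\<mu> \<in> Hom D A (star Q X)" for X \<mu>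
      using * X by (auto simp: S_def presheaves_simps intro: someI_ex)
    then have S': "S (X, \<mu>) \<in> obj A \<and> ty A (S (X, \<mu>)) = X \<and>
        (\<forall>y\<in>obj A. qhom A (S (X, \<mu>), y) = qhom (PSh A) ((X, \<mu>), yoneda A y))"
      if X: "X \<in> Ob Q" "\<mu> \<in> Hom D A (star Q X)" for X \<mu>
      using hom_iff[OF X, of "S (X, \<mu>)"] X by (auto simp: supremum_def)
    have "S \<in> extensional (obj (PSh A))" by (simp add: S_def)
    moreover have "ty (PSh A) (yoneda A y) = ty A y" if "y \<in> obj A" for y
      using A that by (simp add: yoneda_eq presheaves_simps Dty_ob qhom_D)
    ultimately have "qadjoint Q (PSh A) A S (yoneda A)"
      unfolding qadjoint_iff[OF qcategory_presheaves[OF A] qA]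
      using S' yoneda_hom[OF A] by (auto simp: presheaves_simps PiE_def Pi_def)
    then show "qcomplete \<kappa> Q A" by (auto simp: qcomplete_def)
  qed
  also have "\<dots> \<longleftrightarrow> (\<forall>X\<in>Ob Q. \<forall>m. weight A X m \<longrightarrow> (\<exists>s. supremum A X m s))"
  proof (intro iffI ballI allI impI)
    fix X m assume *: "\<forall>X\<in>Ob Q. \<forall>\<mu>\<in>Hom D A (star Q X). \<exists>s. supremum A X (\<lambda>x. \<mu> (x, pt)) s"
      and X: "X \<in> Ob Q" "weight A X m"
    from unweight[OF X] obtain \<mu> where \<mu>: "\<mu> \<in> Hom D A (star Q X)" "\<forall>x\<in>obj A. m x = \<mu> (x, pt)"
      by blast
    with * X(1) obtain s where "supremum A X (\<lambda>x. \<mu> (x, pt)) s" by blast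
    then show "\<exists>s. supremum A X m s" using sup_cong[OF \<mu>(2)] by blast
  next
    fix X \<mu> assume "\<forall>X\<in>Ob Q. \<forall>m. weight A X m \<longrightarrow> (\<exists>s. supremum A X m s)"
      and X: "X \<in> Ob Q" "\<mu> \<in> Hom D A (star Q X)"
    then show "\<exists>s. supremum A X (\<lambda>x. \<mu> (x, pt)) s" using weight[OF X] by blast
  qed
  finally show ?thesis .
qed

lemma qcategory_qcopy:
  assumes A: "qcategory Q A" and h: "inj_on h (obj A)"
  shows "qcategory Q (qcopy h A)"
  using h ty_ob[OF A] qhom_hom[OF A] qhom_ident[OF A] qhom_comp[OF A]
  by (auto simp: qcategory_def qcopy_def Let_def)

lemma skeletal_qiso: "qiso A B h \<Longrightarrow> skeletal Q A \<Longrightarrow> skeletal Q B"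
  using qisoD[of A B h] by (auto simp: skeletal_def under_le_def)

lemma qcomplete_qiso:
  assumes A: "A \<in> Ob D" and B: "B \<in> Ob D" and h: "qiso A B h" and "qcomplete \<kappa> Q A"
  shows "qcomplete \<kappa> Q B"
proof -
  note hD = qisoD[OF h]
  have "\<exists>s. supremum B X m s" if X: "X \<in> Ob Q" and m: "weight B X m" for X m
  proof -
    have "weight A X (m \<circ> h)"
      using m hD(1-3) by (simp add: weight_def hD(4))
    then obtain s where s: "supremum A X (m \<circ> h) s"
      using assms(4) X by (auto simp: qcomplete_iff[OF A])
    have "supremum B X m (h s)"
      using s hD(1-3) by (simp add: supremum_def hD(4))
    then show ?thesis ..
  qed
  then show ?thesis by (simp add: qcomplete_iff[OF B])
qed

section \<open>Complete categories and left adjoints\<close>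

lemma QCCat_simps:
  "A \<in> Ob (QCCat \<kappa> Q) \<longleftrightarrow> A \<in> Ob D \<and> skeletal Q A \<and> qcomplete \<kappa> Q A"
  "Comp (QCCat \<kappa> Q) A B C G F = compose (obj A) G F"
  "Ident (QCCat \<kappa> Q) A = (\<lambda>x\<in>obj A. x)"
  "Leq (QCCat \<kappa> Q) = qfunctor_le Q"
  by (simp_all add: QCCat_def QDist_simps)

lemma QCCat_Hom_iff:
  assumes "A \<in> Ob D" "B \<in> Ob D"
  shows "F \<in> Hom (QCCat \<kappa> Q) A B \<longleftrightarrow> F \<in> obj A \<rightarrow>\<^sub>E obj B \<and> (\<forall>x\<in>obj A. ty B (F x) = ty A x) \<and>
    (\<exists>G. (\<forall>y\<in>obj B. G y \<in> obj A \<and> ty A (G y) = ty B y) \<and>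
      (\<forall>x\<in>obj A. \<forall>y\<in>obj B. qhom B (F x, y) = qhom A (x, G y)))"
proof -
  have q: "qcategory Q A" "qcategory Q B" using assms by (auto simp: QDist_simps)
  show ?thesis
  proof
    assume "F \<in> Hom (QCCat \<kappa> Q) A B"
    then obtain G where "qadjoint Q A B F G" by (auto simp: QCCat_def)
    then show "F \<in> obj A \<rightarrow>\<^sub>E obj B \<and> (\<forall>x\<in>obj A. ty B (F x) = ty A x) \<and>
    (\<exists>G. (\<forall>y\<in>obj B. G y \<in> obj A \<and> ty A (G y) = ty B y) \<and>
      (\<forall>x\<in>obj A. \<forall>y\<in>obj B. qhom B (F x, y) = qhom A (x, G y)))"
      unfolding qadjoint_iff[OF q] by (intro conjI exI[of _ G]) auto
  next
    assume *: "F \<in> obj A \<rightarrow>\<^sub>E obj B \<and> (\<forall>x\<in>obj A. ty B (F x) = ty A x) \<and>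
    (\<exists>G. (\<forall>y\<in>obj B. G y \<in> obj A \<and> ty A (G y) = ty B y) \<and>
      (\<forall>x\<in>obj A. \<forall>y\<in>obj B. qhom B (F x, y) = qhom A (x, G y)))"
    then obtain G where "\<forall>y\<in>obj B. G y \<in> obj A \<and> ty A (G y) = ty B y"
      "\<forall>x\<in>obj A. \<forall>y\<in>obj B. qhom B (F x, y) = qhom A (x, G y)" by blast
    then have "qadjoint Q A B F (restrict G (obj B))"
      unfolding qadjoint_iff[OF q] using * by simp
    then show "F \<in> Hom (QCCat \<kappa> Q) A B" by (auto simp: QCCat_def)
  qed
qed

lemma QCCat_Hom_functor:
  assumes A: "A \<in> Ob D" and B: "B \<in> Ob D" and F: "F \<in> Hom (QCCat \<kappa> Q) A B"
    and x: "x \<in> obj A" "x' \<in> obj A" "under_le Q A x x'"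
  shows "under_le Q B (F x) (F x')"
proof -
  from F obtain G where *: "F \<in> obj A \<rightarrow>\<^sub>E obj B" "\<forall>x\<in>obj A. ty B (F x) = ty A x"
    "\<forall>y\<in>obj B. G y \<in> obj A \<and> ty A (G y) = ty B y"
    "\<forall>x\<in>obj A. \<forall>y\<in>obj B. qhom B (F x, y) = qhom A (x, G y)"
    unfolding QCCat_Hom_iff[OF A B] by blast
  have F': "\<And>x. x \<in> obj A \<Longrightarrow> F x \<in> obj B \<and> ty B (F x) = ty A x"
    and G: "\<And>y. y \<in> obj B \<Longrightarrow> G y \<in> obj A \<and> ty A (G y) = ty B y"
    and hom: "\<And>x y. x \<in> obj A \<Longrightarrow> y \<in> obj B \<Longrightarrow> qhom B (F x, y) = qhom A (x, G y)"
    using * by auto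
  have q: "qcategory Q A" "qcategory Q B" using A B by (auto simp: QDist_simps)
  have "Leq Q (ty A x) (ty A x') (qhom A (x, x')) (qhom B (F x, F x'))"
    using adjoint_unit_counit(3)[OF q F' G hom x(1,2)] .
  moreover have "ty A x' = ty A x" "Leq Q (ty A x) (ty A x) (Ident Q (ty A x)) (qhom A (x, x'))"
    using x by (auto simp: under_le_def)
  moreover have "qhom A (x, x') \<in> Hom Q (ty A x) (ty A x')" "qhom B (F x, F x') \<in> Hom Q (ty A x) (ty A x')"
    using x F'[of x] F'[of x'] qhom_hom[OF q(1), of x x'] qhom_hom[OF q(2), of "F x" "F x'"] by auto
  ultimately show ?thesis
    using F' x Leq_trans[of "ty A x" "ty A x" "Ident Q (ty A x)" "qhom A (x, x')" "qhom B (F x, F x')"]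
    by (auto simp: under_le_def ident_in ty_ob[OF q(1)])
qed

lemma ordered_category_QCCat: "ordered_category (QCCat \<kappa> Q :: (('x, 'o, 'a) qcat, _) quant)"
proof (unfold_locales, goal_cases)
  case (1 A)
  then show ?case by (auto simp: QCCat_simps QCCat_Hom_iff intro!: exI[of _ "\<lambda>x. x"])
next
  case (2 A B C F F')
  then have ob: "A \<in> Ob D" "B \<in> Ob D" "C \<in> Ob D" by (auto simp: QCCat_simps)
  from 2(4) obtain G where F: "F \<in> obj A \<rightarrow>\<^sub>E obj B" "\<forall>x\<in>obj A. ty B (F x) = ty A x"
    "\<forall>y\<in>obj B. G y \<in> obj A \<and> ty A (G y) = ty B y"
    "\<forall>x\<in>obj A. \<forall>y\<in>obj B. qhom B (F x, y) = qhom A (x, G y)"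
    unfolding QCCat_Hom_iff[OF ob(1,2)] by blast
  from 2(5) obtain G' where F': "F' \<in> obj B \<rightarrow>\<^sub>E obj C" "\<forall>x\<in>obj B. ty C (F' x) = ty B x"
    "\<forall>y\<in>obj C. G' y \<in> obj B \<and> ty B (G' y) = ty C y"
    "\<forall>x\<in>obj B. \<forall>y\<in>obj C. qhom C (F' x, y) = qhom B (x, G' y)"
    unfolding QCCat_Hom_iff[OF ob(2,3)] by blast
  have Fx: "x \<in> obj A \<Longrightarrow> F x \<in> obj B" for x using F(1) by auto
  have "compose (obj A) F' F \<in> obj A \<rightarrow>\<^sub>E obj C"
    using F(1) F'(1) by (auto simp: compose_def)
  then show ?case
    unfolding QCCat_simps QCCat_Hom_iff[OF ob(1,3)]
    using F F' Fx by (auto simp: compose_eq intro!: exI[of _ "G \<circ> G'"])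
next
  case (3 A B C E F G H)
  then have "F \<in> obj A \<rightarrow> obj B" by (auto simp: QCCat_simps QCCat_Hom_iff)
  then show ?case by (simp add: QCCat_simps compose_assoc)
next
  case (4 A B F)
  then show ?case by (auto simp: QCCat_simps QCCat_Hom_iff PiE_def intro!: compose_Id)
next
  case (5 A B F)
  then show ?case by (auto simp: QCCat_simps QCCat_Hom_iff PiE_def intro!: Id_compose)
next
  case (6 A B F)
  then have "qcategory Q B" "F \<in> obj A \<rightarrow> obj B" by (auto simp: QCCat_simps QCCat_Hom_iff QDist_simps)
  then show ?case by (auto simp: QCCat_simps qfunctor_le_def intro!: under_le_refl)
next
  case (7 A B F G H)
  then have "qcategory Q B" "F \<in> obj A \<rightarrow> obj B" "G \<in> obj A \<rightarrow> obj B" "H \<in> obj A \<rightarrow> obj B"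
    by (auto simp: QCCat_simps QCCat_Hom_iff QDist_simps(1))
  then show ?case using 7(1,2) under_le_trans[of B] unfolding QCCat_simps qfunctor_le_def
    by (meson PiE Pi_mem)
next
  case (8 A B F G)
  then have F: "F \<in> obj A \<rightarrow>\<^sub>E obj B" "G \<in> obj A \<rightarrow>\<^sub>E obj B" "skeletal Q B"
    by (auto simp: QCCat_simps QCCat_Hom_iff)
  show ?case
    by (rule PiE_ext[OF F(1,2)]) (use 8(1,2) F PiE_mem[OF F(1)] PiE_mem[OF F(2)] in \<open>auto simp: QCCat_simps qfunctor_le_def skeletal_def\<close>)
next
  case (9 A B F F' C G G')
  then have F: "F \<in> obj A \<rightarrow> obj B" "F' \<in> obj A \<rightarrow> obj B" "G \<in> obj B \<rightarrow> obj C" "G' \<in> obj B \<rightarrow> obj C"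
    and ob: "B \<in> Ob D" "C \<in> Ob D" "qcategory Q C"
    by (auto simp: QCCat_simps QCCat_Hom_iff QDist_simps(1))
  have "under_le Q C (G (F x)) (G' (F' x))" if x: "x \<in> obj A" for x
  proof (rule under_le_trans[OF ob(3), of _ "G (F' x)"])
    show "under_le Q C (G (F x)) (G (F' x))"
      using 9 F ob x by (intro QCCat_Hom_functor[of B C]) (auto simp: QCCat_simps qfunctor_le_def)
    show "under_le Q C (G (F' x)) (G' (F' x))"
      using 9(2) F x by (auto simp: QCCat_simps qfunctor_le_def)
  qed (use F x in auto)
  then show ?case by (simp add: QCCat_simps qfunctor_le_def compose_eq)
qed

lemma qiso_is_iso:
  assumes A: "A \<in> Ob (QCCat \<kappa> Q)" and B: "B \<in> Ob (QCCat \<kappa> Q)" and h: "qiso A B h"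
  shows "is_iso (QCCat \<kappa> Q) A B (restrict h (obj A))"
proof -
  have hom: "restrict h (obj A) \<in> Hom (QCCat \<kappa> Q) A B"
    if A: "A \<in> Ob (QCCat \<kappa> Q)" and B: "B \<in> Ob (QCCat \<kappa> Q)" and h: "qiso A B h" for A B h
  proof -
    note hD = qisoD[OF h]
    have "qhom B (h x, y) = qhom A (x, inv_into (obj A) h y)" if "x \<in> obj A" "y \<in> obj B" for x y
      using hD that by auto
    then show ?thesis
      using hD A B by (subst QCCat_Hom_iff)
        (auto simp: QCCat_simps intro!: exI[of _ "inv_into (obj A) h"])
  qed
  note hD = qisoD[OF h]
  let ?g = "restrict (inv_into (obj A) h) (obj B)"
  have "?g \<in> Hom (QCCat \<kappa> Q) B A" using hom[OF B A qiso_inv[OF h]] .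
  moreover have "compose (obj A) ?g (restrict h (obj A)) = (\<lambda>x\<in>obj A. x)"
    "compose (obj B) (restrict h (obj A)) ?g = (\<lambda>x\<in>obj B. x)"
    using hD by (auto simp: compose_def fun_eq_iff)
  ultimately show ?thesis
    using hom[OF A B h] by (auto simp: is_iso_def QCCat_simps)
qed

lemma qcopy_QCCat:
  assumes A: "A \<in> Ob (QCCat \<kappa> Q)" and h: "inj_on h (obj A)"
  shows "qcopy h A \<in> Ob (QCCat \<kappa> Q)"
proof -
  have "qcategory Q A" "small \<kappa> (obj A)" using A by (auto simp: QCCat_simps QDist_simps)
  then have ob: "qcopy h A \<in> Ob D"
    using h by (auto simp: QDist_simps qcategory_qcopy qisoD(4)[OF qiso_qcopy[OF h]] small_image)
  then show ?thesis
    using A skeletal_qiso[OF qiso_qcopy[OF h]] qcomplete_qiso[OF _ ob qiso_qcopy[OF h]]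
    by (auto simp: QCCat_simps)
qed

end

section \<open>Fixed points of a distributor\<close>

context universe
begin

lemmas D_limp_comp = quantaloid.limp_comp[OF quantaloid_QDist]
  and D_rimp_comp = quantaloid.rimp_comp[OF quantaloid_QDist]
  and D_limp_rimp = quantaloid.limp_rimp[OF quantaloid_QDist]
  and D_limp_fixed_clos = quantaloid.limp_fixed_clos[OF quantaloid_QDist]
  and D_clos_rimp = quantaloid.clos_rimp[OF quantaloid_QDist]
  and D_clos_eq_iff = quantaloid.clos_eq_iff[OF quantaloid_QDist]
  and D_clos_le_iff = quantaloid.clos_le_iff[OF quantaloid_QDist]
  and D_clos_self = quantaloid.clos_self[OF quantaloid_QDist]
  and D_le_clos = quantaloid.le_clos[OF quantaloid_QDist]
  and D_arrows_iff = quantaloid.arrows_iff[OF quantaloid_QDist]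
  and D_ChuCon_simps = quantaloid.ChuCon_simps[OF quantaloid_QDist]
  and D_Leq_refl = ordered_category.Leq_refl[OF ordered_category_QDist]

abbreviation M :: "('x, 'o, 'a) dist \<Rightarrow> (('x, 'o, 'a) presheaf, 'o, 'a) qcat" where
  "M \<equiv> M_ob \<kappa> Q"

lemma M_obj_iff:
  "(X, \<mu>) \<in> obj (M (A, B, \<phi>)) \<longleftrightarrow> X \<in> Ob Q \<and> \<mu> \<in> Hom D A (star Q X) \<and> cl A B \<phi> (star Q X) \<mu> = \<mu>"
  by (auto simp: M_ob_def full_sub_def presheaves_simps up_arrow_def down_arrow_def cl_def)

lemma M_obj_subset: "obj (M (A, B, \<phi>)) \<subseteq> obj (PSh A)"
  by (auto simp: M_obj_iff presheaves_simps)

lemma M_ty: "p \<in> obj (M (A, B, \<phi>)) \<Longrightarrow> ty (M (A, B, \<phi>)) p = ty (PSh A) p"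
  by (simp add: M_ob_def full_sub_def)

lemma M_ty_pair: "(X, \<mu>) \<in> obj (M (A, B, \<phi>)) \<Longrightarrow> ty (M (A, B, \<phi>)) (X, \<mu>) = X"
  by (simp add: M_ty M_obj_iff presheaves_simps)

lemma M_qhom: "\<lbrakk>p \<in> obj (M (A, B, \<phi>)); p' \<in> obj (M (A, B, \<phi>))\<rbrakk> \<Longrightarrow>
    qhom (M (A, B, \<phi>)) (p, p') = qhom (PSh A) (p, p')"
  by (simp add: M_ob_def full_sub_def)

lemma M_under_le:
  fixes A B :: "('x, 'o, 'a) qcat"
  assumes "A \<in> Ob D" "(X, \<mu>) \<in> obj (M (A, B, \<phi>))" "(X', \<mu>') \<in> obj (M (A, B, \<phi>))"
  shows "under_le Q (M (A, B, \<phi>)) (X, \<mu>) (X', \<mu>') \<longleftrightarrow> X' = X \<and> Leq D A (star Q X) \<mu> \<mu>'"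
  using under_le_presheaves[of A X \<mu> X' \<mu>'] assms
  by (auto simp: under_le_def M_ty M_qhom M_obj_iff)

text \<open>
  The closure is a reflection of all presheaves onto the fixed points.
\<close>

lemma clos_presheaf_qhom:
  fixes A B :: "('x, 'o, 'a) qcat"
  assumes "A \<in> Ob D" "B \<in> Ob D" "\<phi> \<in> Hom D A B" "X \<in> Ob Q" "\<mu> \<in> Hom D A (star Q X)"
    and "(Z, \<nu>) \<in> obj (M (A, B, \<phi>))"
  shows "qhom (PSh A) ((X, cl A B \<phi> (star Q X) \<mu>), (Z, \<nu>)) = qhom (PSh A) ((X, \<mu>), (Z, \<nu>))"
  using assms by (simp add: presheaves_simps M_obj_iff cl_hom D_limp_fixed_clos)

lemma clos_M_obj:
  fixes A B :: "('x, 'o, 'a) qcat"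
  assumes "A \<in> Ob D" "B \<in> Ob D" "\<phi> \<in> Hom D A B" "X \<in> Ob Q" "\<mu> \<in> Hom D A (star Q X)"
  shows "(X, cl A B \<phi> (star Q X) \<mu>) \<in> obj (M (A, B, \<phi>))"
proof -
  have "limp D A (star Q X) B \<phi> \<mu> \<in> Hom D (star Q X) B" using assms by (intro D_limp_hom) auto
  then show ?thesis
    using assms D_clos_rimp[of A B "star Q X" \<phi>] by (simp add: M_obj_iff cl_hom) (simp add: cl_def)
qed

text \<open>
  The supremum in the presheaf category of a weight \<open>m\<close> on the fixed points is the presheaf
  \<open>\<Squnion> m(\<mu>) \<circ> \<mu>\<close>, and its closure is the supremum among the fixed points.
\<close>

lemma M_complete:
  fixes A B :: "('x, 'o, 'a) qcat"
  assumes A: "A \<in> Ob D" and B: "B \<in> Ob D" and \<phi>: "\<phi> \<in> Hom D A B"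
    and X: "X \<in> Ob Q" and m: "weight (M (A, B, \<phi>)) X m"
  shows "\<exists>s. supremum (M (A, B, \<phi>)) X m s"
proof -
  let ?M = "M (A, B, \<phi>)"
  \<comment> \<open>The presheaf \<open>\<sigma>\<close> is the supremum among all presheaves.\<close>
  define S where "S x = (\<lambda>(Y, \<mu>). Comp Q (ty A x) Y X (m (Y, \<mu>)) (\<mu> (x, pt))) ` obj ?M" for x :: 'x
  define \<sigma> where "\<sigma> = (\<lambda>(x, p)\<in>obj A \<times> {pt :: 'x}. \<Squnion>\<^bsub>hom_order Q (ty A x) X\<^esub> (S x))"
  have mem: "Y \<in> Ob Q" "m (Y, \<mu>) \<in> Hom Q Y X" "x \<in> obj A \<Longrightarrow> \<mu> (x, pt) \<in> Hom Q (ty A x) Y"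
    "\<mu> \<in> Hom D A (star Q Y)"
    if "(Y, \<mu>) \<in> obj ?M" for Y \<mu> x
  proof -
    show "Y \<in> Ob Q" "x \<in> obj A \<Longrightarrow> \<mu> (x, pt) \<in> Hom Q (ty A x) Y" "\<mu> \<in> Hom D A (star Q Y)"
      using that A by (auto simp: M_obj_iff intro: presheaf_elt)
    have "m (Y, \<mu>) \<in> Hom Q (ty ?M (Y, \<mu>)) X" using m that by (simp add: weight_def)
    then show "m (Y, \<mu>) \<in> Hom Q Y X" using that by (simp add: M_ty_pair)
  qed
  have S: "S x \<subseteq> Hom Q (ty A x) X" if "x \<in> obj A" for x
    using that mem X A by (auto simp: S_def Dty_ob intro!: comp_in)
  have \<sigma>_elt: "\<sigma> (x, pt) \<in> Hom Q (ty A x) X" if "x \<in> obj A" for x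
    using that S X A by (simp add: \<sigma>_def sup_hom Dty_ob)
  have up: "Leq Q (ty A x) X (Comp Q (ty A x) Y X (m (Y, \<mu>)) (\<mu> (x, pt))) (\<sigma> (x, pt))"
    if "x \<in> obj A" "(Y, \<mu>) \<in> obj ?M" for x Y \<mu>
  proof -
    have "Comp Q (ty A x) Y X (m (Y, \<mu>)) (\<mu> (x, pt)) \<in> S x" using that by (force simp: S_def)
    then show ?thesis using that S X A by (simp add: \<sigma>_def sup_upper Dty_ob)
  qed
  have "\<sigma> \<in> Hom D A (star Q X)"
  proof (subst presheaf_iff[OF A X], intro conjI ballI)
    fix x x' assume x: "x \<in> obj A" "x' \<in> obj A"
    have "Leq Q (ty A x') X (Comp Q (ty A x') (ty A x) X
        (Comp Q (ty A x) Y X (m (Y, \<mu>)) (\<mu> (x, pt))) (qhom A (x', x))) (\<sigma> (x', pt))"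
      if p: "(Y, \<mu>) \<in> obj ?M" for Y \<mu>
    proof -
      have "Leq Q (ty A x') Y (Comp Q (ty A x') (ty A x) Y (\<mu> (x, pt)) (qhom A (x', x))) (\<mu> (x', pt))"
        using mem(1,4)[OF p] A x by (auto simp: presheaf_iff)
      then have "Leq Q (ty A x') X (Comp Q (ty A x') Y X (m (Y, \<mu>))
          (Comp Q (ty A x') (ty A x) Y (\<mu> (x, pt)) (qhom A (x', x)))) (Comp Q (ty A x') Y X (m (Y, \<mu>)) (\<mu> (x', pt)))"
        using mem[OF p] A X x by (intro comp_mono_right) (auto simp: Dty_ob Dqhom_hom intro!: comp_in)
      from Leq_trans[OF this up[OF x(2) p]] show ?thesis
        using mem[OF p] A X x \<sigma>_elt by (simp add: Dty_ob Dqhom_hom comp_assoc comp_in)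
    qed
    then show "Leq Q (ty A x') X (Comp Q (ty A x') (ty A x) X (\<sigma> (x, pt)) (qhom A (x', x))) (\<sigma> (x', pt))"
      using x A X S[OF x(1)] \<sigma>_elt[OF x(2)] sup_comp_le_iff[of "ty A x'" "ty A x" X "S x" "qhom A (x', x)" "\<sigma> (x', pt)"]
      by (auto simp: \<sigma>_def[THEN fun_cong, of "(x, pt)"] Dty_ob Dqhom_hom S_def)
  qed (auto simp: \<sigma>_elt, simp add: \<sigma>_def)
  note \<sigma> = this
  let ?s = "(X, cl A B \<phi> (star Q X) \<sigma>)"
  have s: "?s \<in> obj ?M"
    using A B \<phi> X \<sigma> by (rule clos_M_obj)
  have "Leq Q X Z k (qhom ?M (?s, (Z, \<nu>))) \<longleftrightarrow>
    (\<forall>p\<in>obj ?M. Leq Q (ty ?M p) Z (Comp Q (ty ?M p) X Z k (m p)) (qhom ?M (p, (Z, \<nu>))))"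
    if Z: "(Z, \<nu>) \<in> obj ?M" and k: "k \<in> Hom Q X Z" for Z \<nu> k
  proof -
    note memZ = mem(1,3,4)[OF Z]
    have "Leq Q X Z k (qhom ?M (?s, (Z, \<nu>))) \<longleftrightarrow> Leq Q X Z k (qhom (PSh A) ((X, \<sigma>), (Z, \<nu>)))"
      using A B \<phi> X \<sigma> Z s by (simp add: M_qhom clos_presheaf_qhom)
    also have "\<dots> \<longleftrightarrow> (\<forall>x\<in>obj A. Leq Q (ty A x) Z (Comp Q (ty A x) X Z k (\<sigma> (x, pt))) (\<nu> (x, pt)))"
      using A X \<sigma> memZ k by (simp add: presheaf_hom(2))
    also have "\<dots> \<longleftrightarrow> (\<forall>x\<in>obj A. \<forall>(Y, \<mu>)\<in>obj ?M.
        Leq Q (ty A x) Z (Comp Q (ty A x) X Z k (Comp Q (ty A x) Y X (m (Y, \<mu>)) (\<mu> (x, pt)))) (\<nu> (x, pt)))"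
    proof (intro ball_cong refl)
      fix x assume x: "x \<in> obj A"
      have "Leq Q (ty A x) Z (Comp Q (ty A x) X Z k (\<sigma> (x, pt))) (\<nu> (x, pt)) \<longleftrightarrow>
        (\<forall>f\<in>S x. Leq Q (ty A x) Z (Comp Q (ty A x) X Z k f) (\<nu> (x, pt)))"
        using x A X S[OF x] memZ(1) memZ(2)[OF x] k by (simp add: \<sigma>_def comp_sup_le_iff Dty_ob)
      then show "Leq Q (ty A x) Z (Comp Q (ty A x) X Z k (\<sigma> (x, pt))) (\<nu> (x, pt)) \<longleftrightarrow> (\<forall>(Y, \<mu>)\<in>obj ?M.
        Leq Q (ty A x) Z (Comp Q (ty A x) X Z k (Comp Q (ty A x) Y X (m (Y, \<mu>)) (\<mu> (x, pt)))) (\<nu> (x, pt)))"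
        by (simp add: S_def case_prod_beta)
    qed
    also have "\<dots> \<longleftrightarrow> (\<forall>(Y, \<mu>)\<in>obj ?M. \<forall>x\<in>obj A.
        Leq Q (ty A x) Z (Comp Q (ty A x) Y Z (Comp Q Y X Z k (m (Y, \<mu>))) (\<mu> (x, pt))) (\<nu> (x, pt)))"
    proof -
      have "Comp Q (ty A x) X Z k (Comp Q (ty A x) Y X (m (Y, \<mu>)) (\<mu> (x, pt))) =
        Comp Q (ty A x) Y Z (Comp Q Y X Z k (m (Y, \<mu>))) (\<mu> (x, pt))"
        if "(Y, \<mu>) \<in> obj ?M" "x \<in> obj A" for x Y \<mu>
        using mem[OF that(1)] that(2) A X memZ(1) k by (intro comp_assoc) (auto simp: Dty_ob)
      then show ?thesis by fastforce
    qed
    also have "\<dots> \<longleftrightarrow> (\<forall>p\<in>obj ?M. Leq Q (ty ?M p) Z (Comp Q (ty ?M p) X Z k (m p)) (qhom ?M (p, (Z, \<nu>))))"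
    proof (intro ball_cong refl, clarify)
      fix Y \<mu> assume p: "(Y, \<mu>) \<in> obj ?M"
      show "(\<forall>x\<in>obj A. Leq Q (ty A x) Z (Comp Q (ty A x) Y Z (Comp Q Y X Z k (m (Y, \<mu>))) (\<mu> (x, pt))) (\<nu> (x, pt)))
        \<longleftrightarrow> Leq Q (ty ?M (Y, \<mu>)) Z (Comp Q (ty ?M (Y, \<mu>)) X Z k (m (Y, \<mu>))) (qhom ?M ((Y, \<mu>), (Z, \<nu>)))"
        using mem[OF p] p Z memZ A X k by (simp add: M_ty_pair M_qhom presheaf_hom(2) comp_in)
    qed
    finally show ?thesis .
  qed
  note key = this
  have "supremum ?M X m ?s"
    unfolding supremum_def
  proof (intro conjI ballI)
    fix p k assume p: "p \<in> obj ?M" and k: "k \<in> Hom Q X (ty ?M p)"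
    obtain Z \<nu> where eq: "p = (Z, \<nu>)" by fastforce
    have t: "ty ?M p = Z" using p by (simp add: eq M_ty_pair)
    show "Leq Q X (ty ?M p) k (qhom ?M (?s, p)) \<longleftrightarrow> (\<forall>x\<in>obj ?M. Leq Q (ty ?M x) (ty ?M p)
        (Comp Q (ty ?M x) X (ty ?M p) k (m x)) (qhom ?M (x, p)))"
      using key[of Z \<nu> k] p k unfolding t unfolding eq by blast
  qed (use s in \<open>auto simp: M_ty_pair\<close>)
  then show ?thesis ..
qed

lemma qcategory_full_sub:
  assumes "qcategory Q A" "S \<subseteq> obj A"
  shows "qcategory Q (full_sub A S)"
  unfolding qcategory_def[of Q "full_sub A S"]
  using assms(2) ty_ob[OF assms(1)] qhom_hom[OF assms(1)] qhom_ident[OF assms(1)] qhom_comp[OF assms(1)]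
  by (auto simp: full_sub_def subset_iff)

lemma M_ob_QCCat:
  fixes A B :: "('x, 'o, 'a) qcat"
  assumes A: "A \<in> Ob D" and B: "B \<in> Ob D" and \<phi>: "\<phi> \<in> Hom D A B"
  shows "M (A, B, \<phi>) \<in> Ob (QCCat \<kappa> Q)"
proof -
  have "qcategory Q (M (A, B, \<phi>))"
    using qcategory_full_sub[OF qcategory_presheaves[OF A]] by (auto simp: M_ob_def)
  then have ob: "M (A, B, \<phi>) \<in> Ob D"
    using small_subset[OF small_presheaves[OF A] M_obj_subset] by (auto simp: QDist_simps)
  moreover have "qcomplete \<kappa> Q (M (A, B, \<phi>))"
    using M_complete[OF A B \<phi>] by (simp add: qcomplete_iff[OF ob])
  moreover have "skeletal Q (M (A, B, \<phi>))"
    using skeletal_presheaves[OF A] M_obj_subset[of A B \<phi>]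
    unfolding skeletal_def under_le_def by (simp add: M_ty M_qhom) blast
  ultimately show ?thesis by (simp add: QCCat_simps)
qed

lemma M_arr_apply:
  "(X, m) \<in> obj (M (A', B', \<psi>)) \<Longrightarrow> M_arr \<kappa> Q (A', B', \<psi>) (A, B, \<phi>) (\<zeta>, \<eta>) (X, m) =
    (X, cl A B \<phi> (star Q X) (Comp D A A' (star Q X) m \<zeta>))"
  by (simp add: M_arr_def up_arrow_def down_arrow_def cl_def)

lemma M_arr_ext: "M_arr \<kappa> Q (A', B', \<psi>) (A, B, \<phi>) (\<zeta>, \<eta>) \<in> extensional (obj (M (A', B', \<psi>)))"
  by (simp add: M_arr_def)

context
  fixes A B A' B' :: "('x, 'o, 'a) qcat" and \<phi> \<psi> \<zeta> \<eta>
  assumes ob [simp]: "A \<in> Ob D" "B \<in> Ob D" "A' \<in> Ob D" "B' \<in> Ob D"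
    and [simp]: "\<phi> \<in> Hom D A B" "\<psi> \<in> Hom D A' B'" "\<zeta> \<in> Hom D A A'" "\<eta> \<in> Hom D B B'"
    and chu: "limp D A A' B \<phi> \<zeta> = rimp D A' B B' \<eta> \<psi>"
begin

text \<open>
  The diagonal of a Chu connection is a fixed point for the codomain because it has the form \<open>\<eta> \<searrow> \<psi>\<close>.
\<close>

lemma chu_diagonal_fixed: "cl A' B' \<psi> B (limp D A A' B \<phi> \<zeta>) = limp D A A' B \<phi> \<zeta>"
  unfolding chu by (rule D_clos_rimp) simp_all

text \<open>
  Restriction along \<open>\<zeta>\<close> followed by closure does not distinguish a presheaf from its closure; this is
  what makes the assignment on arrows functorial.
\<close>

lemma limp_chu_comp_clos:
  assumes "P \<in> Ob D" "m \<in> Hom D A' P"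
  shows "limp D A P B \<phi> (Comp D A A' P (cl A' B' \<psi> P m) \<zeta>) = limp D A P B \<phi> (Comp D A A' P m \<zeta>)"
  using assms by (simp add: D_limp_comp cl_hom D_limp_fixed_clos D_limp_hom chu_diagonal_fixed)

text \<open>
  With \<open>m = n \<searrow> \<phi>\<close>, one has \<open>m \<swarrow> \<zeta> = n \<searrow> (\<phi> \<swarrow> \<zeta>) = n \<searrow> (\<eta> \<searrow> \<psi>) = (\<eta> \<circ> n) \<searrow> \<psi>\<close>. Thus \<open>m \<mapsto> m \<swarrow> \<zeta>\<close>
  restricts to fixed points, where it is the right adjoint of the functor induced by \<open>(\<zeta>, \<eta>)\<close>.
\<close>

lemma limp_fixed:
  assumes P: "P \<in> Ob D" and m: "m \<in> Hom D A P" "cl A B \<phi> P m = m"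
  shows "cl A' B' \<psi> P (limp D A A' P m \<zeta>) = limp D A A' P m \<zeta>"
proof -
  let ?n = "limp D A P B \<phi> m"
  have n: "?n \<in> Hom D P B" using P m by (intro D_limp_hom) simp_all
  have "m = rimp D A P B ?n \<phi>" using m(2) by (simp add: cl_def)
  then have "limp D A A' P m \<zeta> = rimp D A' P B ?n (limp D A A' B \<phi> \<zeta>)"
    using D_limp_rimp[of A A' P B \<phi> ?n \<zeta>] P n by simp
  also have "\<dots> = rimp D A' P B' (Comp D P B B' \<eta> ?n) \<psi>"
    unfolding chu using P n by (intro D_rimp_comp[symmetric]) simp_all
  finally show ?thesis using P n by (simp add: D_clos_rimp Comp_D_hom)
qed

lemma M_arr_hom: "M_arr \<kappa> Q (A', B', \<psi>) (A, B, \<phi>) (\<zeta>, \<eta>) \<in> Hom (QCCat \<kappa> Q) (M (A', B', \<psi>)) (M (A, B, \<phi>))"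
proof -
  let ?F = "M_arr \<kappa> Q (A', B', \<psi>) (A, B, \<phi>) (\<zeta>, \<eta>)"
  let ?G = "\<lambda>(X, \<mu>). (X, limp D A A' (star Q X) \<mu> \<zeta>)"
  have Mob: "M (A', B', \<psi>) \<in> Ob D" "M (A, B, \<phi>) \<in> Ob D"
    using M_ob_QCCat[of A' B' \<psi>] M_ob_QCCat[of A B \<phi>] by (auto simp: QCCat_simps)
  have F: "(X, cl A B \<phi> (star Q X) (Comp D A A' (star Q X) m \<zeta>)) \<in> obj (M (A, B, \<phi>))"
    if "(X, m) \<in> obj (M (A', B', \<psi>))" for X m
    using that by (intro clos_M_obj) (auto simp: M_obj_iff intro: Comp_D_hom)
  have G: "(X, limp D A A' (star Q X) \<mu> \<zeta>) \<in> obj (M (A', B', \<psi>))"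
    if "(X, \<mu>) \<in> obj (M (A, B, \<phi>))" for X \<mu>
    using that unfolding M_obj_iff by (auto intro!: D_limp_hom limp_fixed)
  have hom: "qhom (M (A, B, \<phi>)) (?F (X, m), (Z, \<mu>)) = qhom (M (A', B', \<psi>)) ((X, m), ?G (Z, \<mu>))"
    if "(X, m) \<in> obj (M (A', B', \<psi>))" "(Z, \<mu>) \<in> obj (M (A, B, \<phi>))" for X m Z \<mu>
    using that F[OF that(1)] G[OF that(2)]
    by (simp add: M_arr_apply M_qhom clos_presheaf_qhom Comp_D_hom M_obj_iff[of X m] M_obj_iff[of Z \<mu>]
        presheaves_simps D_limp_comp D_limp_hom)
  show ?thesis
    unfolding QCCat_Hom_iff[OF Mob]
    using F G hom M_arr_ext[of A' B' \<psi> A B \<phi> \<zeta> \<eta>]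
    by (auto simp: PiE_def M_arr_apply M_ty_pair intro!: exI[of _ ?G])
qed

text \<open>
  Under \<open>\<phi> \<swarrow> _\<close>, which reflects the order of closed presheaves and reverses it, the value of the functor
  at \<open>m\<close> becomes \<open>\<theta> \<swarrow> m\<close>, where \<open>\<theta>\<close> is the diagonal. Hence comparing diagonals suffices; and the
  entries of \<open>\<theta>\<close> are recovered by taking for \<open>m\<close> the closures of the representables, which
  \<open>\<theta> \<swarrow> _\<close> does not distinguish from the representables themselves.
\<close>

lemma M_arr_le_iff:
  assumes [simp]: "\<zeta>' \<in> Hom D A A'" "\<eta>' \<in> Hom D B B'" and chu': "limp D A A' B \<phi> \<zeta>' = rimp D A' B B' \<eta>' \<psi>"
  shows "qfunctor_le Q (M (A', B', \<psi>)) (M (A, B, \<phi>))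
    (M_arr \<kappa> Q (A', B', \<psi>) (A, B, \<phi>) (\<zeta>, \<eta>)) (M_arr \<kappa> Q (A', B', \<psi>) (A, B, \<phi>) (\<zeta>', \<eta>'))
    \<longleftrightarrow> Leq D A' B (limp D A A' B \<phi> \<zeta>') (limp D A A' B \<phi> \<zeta>)"
proof -
  let ?\<theta> = "limp D A A' B \<phi> \<zeta>" and ?\<theta>' = "limp D A A' B \<phi> \<zeta>'"
  have \<theta>: "?\<theta> \<in> Hom D A' B" "?\<theta>' \<in> Hom D A' B" by (auto intro: D_limp_hom)
  have fixed: "cl A' B' \<psi> B ?\<theta> = ?\<theta>" "cl A' B' \<psi> B ?\<theta>' = ?\<theta>'"
    unfolding chu chu' by (auto intro: D_clos_rimp)
  have le: "qfunctor_le Q (M (A', B', \<psi>)) (M (A, B, \<phi>))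
    (M_arr \<kappa> Q (A', B', \<psi>) (A, B, \<phi>) (\<zeta>, \<eta>)) (M_arr \<kappa> Q (A', B', \<psi>) (A, B, \<phi>) (\<zeta>', \<eta>')) \<longleftrightarrow>
    (\<forall>(X, m)\<in>obj (M (A', B', \<psi>)). Leq D (star Q X) B (limp D A' (star Q X) B ?\<theta>' m) (limp D A' (star Q X) B ?\<theta> m))"
    unfolding qfunctor_le_def
  proof (intro ball_cong refl, clarify)
    fix X m assume m: "(X, m) \<in> obj (M (A', B', \<psi>))"
    then have X: "X \<in> Ob Q" "m \<in> Hom D A' (star Q X)" by (auto simp: M_obj_iff)
    have "(X, cl A B \<phi> (star Q X) (Comp D A A' (star Q X) m \<zeta>)) \<in> obj (M (A, B, \<phi>))"
      if "\<zeta> \<in> Hom D A A'" for \<zeta>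
      using that X by (intro clos_M_obj) (auto intro: Comp_D_hom)
    then show "under_le Q (M (A, B, \<phi>)) (M_arr \<kappa> Q (A', B', \<psi>) (A, B, \<phi>) (\<zeta>, \<eta>) (X, m))
        (M_arr \<kappa> Q (A', B', \<psi>) (A, B, \<phi>) (\<zeta>', \<eta>') (X, m)) \<longleftrightarrow>
      Leq D (star Q X) B (limp D A' (star Q X) B ?\<theta>' m) (limp D A' (star Q X) B ?\<theta> m)"
      using m X by (simp add: M_arr_apply M_under_le D_clos_le_iff Comp_D_hom D_limp_comp)
  qed
  show ?thesis
  proof
    assume "Leq D A' B ?\<theta>' ?\<theta>"
    have "Leq D (star Q X) B (limp D A' (star Q X) B ?\<theta>' m) (limp D A' (star Q X) B ?\<theta> m)"
      if "(X, m) \<in> obj (M (A', B', \<psi>))" for X m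
    proof -
      have X: "X \<in> Ob Q" "m \<in> Hom D A' (star Q X)" using that by (auto simp: M_obj_iff)
      let ?n = "limp D A' (star Q X) B ?\<theta>' m"
      have n: "?n \<in> Hom D (star Q X) B" using X \<theta> by (intro D_limp_hom) auto
      have "Leq D A' B (Comp D A' (star Q X) B ?n m) ?\<theta>'"
        using D_le_limp_iff[of A' "star Q X" B m ?\<theta>' ?n] X \<theta> n by (simp add: D_Leq_refl)
      then have "Leq D A' B (Comp D A' (star Q X) B ?n m) ?\<theta>"
        by (rule ordered_category.Leq_trans[OF ordered_category_QDist _ \<open>Leq D A' B ?\<theta>' ?\<theta>\<close>])
          (use X \<theta> n in \<open>auto intro: Comp_D_hom\<close>)
      then show ?thesis using X \<theta> n by (subst D_le_limp_iff) auto
    qed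
    then show "qfunctor_le Q (M (A', B', \<psi>)) (M (A, B, \<phi>))
      (M_arr \<kappa> Q (A', B', \<psi>) (A, B, \<phi>) (\<zeta>, \<eta>)) (M_arr \<kappa> Q (A', B', \<psi>) (A, B, \<phi>) (\<zeta>', \<eta>'))"
      unfolding le by blast
  next
    assume "qfunctor_le Q (M (A', B', \<psi>)) (M (A, B, \<phi>))
      (M_arr \<kappa> Q (A', B', \<psi>) (A, B, \<phi>) (\<zeta>, \<eta>)) (M_arr \<kappa> Q (A', B', \<psi>) (A, B, \<phi>) (\<zeta>', \<eta>'))"
    note * = this[unfolded le]
    have "Leq Q (ty A' x) (ty B y) (?\<theta>' (x, y)) (?\<theta> (x, y))" if x: "x \<in> obj A'" and y: "y \<in> obj B" for x y
    proof -
      let ?X = "ty A' x" and ?Y = "col A' (qhom A') x"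
      let ?m = "cl A' B' \<psi> (star Q ?X) ?Y"
      have X: "?X \<in> Ob Q" "?Y \<in> Hom D A' (star Q ?X)" using x by (auto simp: Dty_ob qhom_D)
      then have "(?X, ?m) \<in> obj (M (A', B', \<psi>))" by (intro clos_M_obj) auto
      with * have "Leq D (star Q ?X) B (limp D A' (star Q ?X) B ?\<theta>' ?m) (limp D A' (star Q ?X) B ?\<theta> ?m)"
        by blast
      then have "Leq D (star Q ?X) B (limp D A' (star Q ?X) B ?\<theta>' ?Y) (limp D A' (star Q ?X) B ?\<theta> ?Y)"
        using X \<theta> fixed by (simp add: D_limp_fixed_clos)
      then have "Leq Q ?X (ty B y) (limp D A' (star Q ?X) B ?\<theta>' ?Y (pt, y)) (limp D A' (star Q ?X) B ?\<theta> ?Y (pt, y))"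
        using y by (simp add: Leq_D_iff)
      then show ?thesis using x y \<theta> by (simp add: limp_col qhom_D D_limp_ident)
    qed
    then show "Leq D A' B ?\<theta>' ?\<theta>" by (simp add: Leq_D_iff)
  qed
qed

end

lemma M_arr_ident:
  fixes A B :: "('x, 'o, 'a) qcat"
  assumes "A \<in> Ob D" "B \<in> Ob D" "\<phi> \<in> Hom D A B"
  shows "M_arr \<kappa> Q (A, B, \<phi>) (A, B, \<phi>) (qhom A, \<eta>) = (\<lambda>p\<in>obj (M (A, B, \<phi>)). p)"
proof (rule extensionalityI[OF M_arr_ext])
  fix p assume p: "p \<in> obj (M (A, B, \<phi>))"
  then show "M_arr \<kappa> Q (A, B, \<phi>) (A, B, \<phi>) (qhom A, \<eta>) p = (\<lambda>p\<in>obj (M (A, B, \<phi>)). p) p"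
    using assms by (cases p) (auto simp: M_arr_apply M_obj_iff Comp_D_qhom)
qed simp

lemma M_arr_comp:
  fixes A B A1 B1 A2 B2 :: "('x, 'o, 'a) qcat"
  assumes ob: "A \<in> Ob D" "B \<in> Ob D" "A1 \<in> Ob D" "B1 \<in> Ob D" "A2 \<in> Ob D" "B2 \<in> Ob D"
    and h: "\<phi> \<in> Hom D A B" "\<psi> \<in> Hom D A1 B1" "\<chi> \<in> Hom D A2 B2"
    and c1: "\<zeta>1 \<in> Hom D A A1" "\<eta>1 \<in> Hom D B B1" "limp D A A1 B \<phi> \<zeta>1 = rimp D A1 B B1 \<eta>1 \<psi>"
    and c2: "\<zeta>2 \<in> Hom D A1 A2"
  shows "M_arr \<kappa> Q (A2, B2, \<chi>) (A, B, \<phi>) (Comp D A A1 A2 \<zeta>2 \<zeta>1, \<eta>) =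
    compose (obj (M (A2, B2, \<chi>))) (M_arr \<kappa> Q (A1, B1, \<psi>) (A, B, \<phi>) (\<zeta>1, \<eta>1))
      (M_arr \<kappa> Q (A2, B2, \<chi>) (A1, B1, \<psi>) (\<zeta>2, \<eta>2))"
proof (rule extensionalityI[OF M_arr_ext])
  fix p assume p: "p \<in> obj (M (A2, B2, \<chi>))"
  obtain X m where eq: "p = (X, m)" by fastforce
  have X: "X \<in> Ob Q" "m \<in> Hom D A2 (star Q X)" using p eq by (auto simp: M_obj_iff)
  let ?P = "star Q X" and ?m = "Comp D A1 A2 (star Q X) m \<zeta>2"
  have m: "?m \<in> Hom D A1 ?P" using ob X c2 by (intro Comp_D_hom) auto
  have m': "(X, cl A1 B1 \<psi> ?P ?m) \<in> obj (M (A1, B1, \<psi>))"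
    using ob X h m by (intro clos_M_obj) auto
  have "cl A B \<phi> ?P (Comp D A A1 ?P ?m \<zeta>1) = cl A B \<phi> ?P (Comp D A A1 ?P (cl A1 B1 \<psi> ?P ?m) \<zeta>1)"
    using ob X h m c1 limp_chu_comp_clos[of A B A1 B1 \<phi> \<psi> \<zeta>1 \<eta>1 ?P ?m]
    by (subst D_clos_eq_iff) (auto intro!: Comp_D_hom cl_hom)
  moreover have "Comp D A A2 ?P m (Comp D A A1 A2 \<zeta>2 \<zeta>1) = Comp D A A1 ?P ?m \<zeta>1"
    using ob X c1 c2 by (intro Comp_D_assoc) auto
  ultimately show "M_arr \<kappa> Q (A2, B2, \<chi>) (A, B, \<phi>) (Comp D A A1 A2 \<zeta>2 \<zeta>1, \<eta>) p =
    compose (obj (M (A2, B2, \<chi>))) (M_arr \<kappa> Q (A1, B1, \<psi>) (A, B, \<phi>) (\<zeta>1, \<eta>1))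
      (M_arr \<kappa> Q (A2, B2, \<chi>) (A1, B1, \<psi>) (\<zeta>2, \<eta>2)) p"
    using p m' by (simp add: eq compose_eq M_arr_apply)
qed simp

text \<open>
  A distributor is the same as a functor into presheaves.
\<close>

lemma curry_distributor:
  fixes A A' :: "('x, 'o, 'a) qcat"
  assumes A: "A \<in> Ob D" and A': "A' \<in> Ob D"
    and z: "\<And>y. y \<in> obj A' \<Longrightarrow> z y \<in> Hom D A (star Q (ty A' y))"
    and le: "\<And>y y'. \<lbrakk>y \<in> obj A'; y' \<in> obj A'\<rbrakk> \<Longrightarrow>
      Leq Q (ty A' y) (ty A' y') (qhom A' (y, y')) (qhom (PSh A) ((ty A' y, z y), (ty A' y', z y')))"
  obtains \<zeta> where "\<zeta> \<in> Hom D A A'" "\<And>y. y \<in> obj A' \<Longrightarrow> col A \<zeta> y = z y"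
proof
  let ?\<zeta> = "\<lambda>(x, y)\<in>obj A \<times> obj A'. z y (x, pt)"
  have "Leq Q (ty A x) (ty A' y') (Comp Q (ty A x) (ty A' y) (ty A' y') (qhom A' (y, y')) (z y (x, pt))) (z y' (x, pt))"
    if "x \<in> obj A" "y \<in> obj A'" "y' \<in> obj A'" for x y y'
    using le[OF that(2,3)] that A A' z
    by (simp add: presheaf_hom(2) Dty_ob Dqhom_hom)
  moreover have "qcategory Q A" "qcategory Q A'" using A A' by (auto simp: QDist_simps)
  ultimately show *: "?\<zeta> \<in> Hom D A A'"
    using z A A' by (auto simp: QDist_simps(2) distributors_iff presheaf_iff[unfolded QDist_simps(2)] Dty_ob)
  show "col A ?\<zeta> y = z y" if "y \<in> obj A'" for y
    using that z A A' col_hom[OF A A' * that] by (intro presheaf_eqI[of A "ty A' y"]) (auto simp: Dty_ob)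
qed

text \<open>
  The distributor \<open>\<zeta>\<close> has as columns the values of \<open>F\<close> at the closed representables \<open>r x\<close>. For the right
  adjoint \<open>G\<close> of \<open>F\<close> and the columns \<open>c y\<close> of \<open>\<phi>\<close>, the entry \<open>(x, y)\<close> of the diagonal is the hom-arrow from
  \<open>F (r x)\<close> to \<open>c y\<close>, hence from \<open>r x\<close> to \<open>G (c y)\<close>, hence the value of \<open>G (c y)\<close> at \<open>x\<close>. So the columns
  of the diagonal are fixed points for \<open>\<psi>\<close>, and \<open>\<eta>\<close> is obtained from the fixed-point equation.
\<close>

lemma M_arr_full:
  fixes A B A' B' :: "('x, 'o, 'a) qcat"
  assumes ob [simp]: "A \<in> Ob D" "B \<in> Ob D" "A' \<in> Ob D" "B' \<in> Ob D"
    and h [simp]: "\<phi> \<in> Hom D A B" "\<psi> \<in> Hom D A' B'"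
    and F: "F \<in> Hom (QCCat \<kappa> Q) (M (A', B', \<psi>)) (M (A, B, \<phi>))"
  shows "\<exists>\<zeta> \<eta>. \<zeta> \<in> Hom D A A' \<and> \<eta> \<in> Hom D B B' \<and> limp D A A' B \<phi> \<zeta> = rimp D A' B B' \<eta> \<psi> \<and>
    M_arr \<kappa> Q (A', B', \<psi>) (A, B, \<phi>) (\<zeta>, \<eta>) = F"
proof -
  let ?M = "M (A, B, \<phi>)" and ?M' = "M (A', B', \<psi>)"
  have Mob: "?M' \<in> Ob D" "?M \<in> Ob D"
    using M_ob_QCCat[of A' B' \<psi>] M_ob_QCCat[of A B \<phi>] by (auto simp: QCCat_simps)
  then have Mq: "qcategory Q ?M'" "qcategory Q ?M" by (auto simp: QDist_simps)
  from F obtain G where FG: "F \<in> obj ?M' \<rightarrow>\<^sub>E obj ?M" "\<forall>x\<in>obj ?M'. ty ?M (F x) = ty ?M' x"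
    "\<forall>y\<in>obj ?M. G y \<in> obj ?M' \<and> ty ?M' (G y) = ty ?M y"
    "\<forall>x\<in>obj ?M'. \<forall>y\<in>obj ?M. qhom ?M (F x, y) = qhom ?M' (x, G y)"
    unfolding QCCat_Hom_iff[OF Mob] by blast
  have F': "F x \<in> obj ?M \<and> ty ?M (F x) = ty ?M' x" if "x \<in> obj ?M'" for x using FG that by auto
  have G': "G y \<in> obj ?M' \<and> ty ?M' (G y) = ty ?M y" if "y \<in> obj ?M" for y using FG that by auto
  have hom: "qhom ?M (F x, y) = qhom ?M' (x, G y)" if "x \<in> obj ?M'" "y \<in> obj ?M" for x y
    using FG that by blast
  have pair: "p = (ty ?M p, snd p) \<and> ty ?M p \<in> Ob Q \<and> snd p \<in> Hom D A (star Q (ty ?M p)) \<and>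
      cl A B \<phi> (star Q (ty ?M p)) (snd p) = snd p" if "p \<in> obj ?M" for p
    using that by (cases p) (simp add: M_ty_pair, simp add: M_obj_iff)
  have pair': "p = (ty ?M' p, snd p) \<and> ty ?M' p \<in> Ob Q \<and> snd p \<in> Hom D A' (star Q (ty ?M' p)) \<and>
      cl A' B' \<psi> (star Q (ty ?M' p)) (snd p) = snd p" if "p \<in> obj ?M'" for p
    using that by (cases p) (simp add: M_ty_pair, simp add: M_obj_iff)
  define Y where "Y x = col A' (qhom A') x" for x
  define r where "r x = (ty A' x, cl A' B' \<psi> (star Q (ty A' x)) (Y x))" for x
  have Y: "ty A' x \<in> Ob Q" "Y x \<in> Hom D A' (star Q (ty A' x))" if "x \<in> obj A'" for x
    using that by (auto simp: Y_def Dty_ob qhom_D)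
  have r: "r x \<in> obj ?M'" "ty ?M' (r x) = ty A' x" if "x \<in> obj A'" for x
  proof -
    show *: "r x \<in> obj ?M'" unfolding r_def using Y[OF that] by (intro clos_M_obj) auto
    show "ty ?M' (r x) = ty A' x" using * by (simp add: r_def M_ty_pair)
  qed
  \<comment> \<open>The Yoneda lemma for closed representables.\<close>
  have rY: "qhom ?M' (r x, (X, m)) = m (x, pt)" if "x \<in> obj A'" "(X, m) \<in> obj ?M'" for x X m
    using that r[OF that(1)] Y[OF that(1)] yoneda_lemma[of A' X m x]
    by (simp add: r_def M_qhom clos_presheaf_qhom yoneda_eq[OF that(1)] Y_def M_obj_iff[of X m])
  define z where "z x = snd (F (r x))" for x
  have z: "F (r x) = (ty A' x, z x)" "z x \<in> Hom D A (star Q (ty A' x))" if "x \<in> obj A'" for x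
    using pair[of "F (r x)"] F'[of "r x"] r[OF that] by (auto simp: z_def)
  obtain \<zeta> where \<zeta>: "\<zeta> \<in> Hom D A A'" "\<And>x. x \<in> obj A' \<Longrightarrow> col A \<zeta> x = z x"
  proof (rule curry_distributor[OF ob(1,3) z(2)])
    fix x x' assume x: "x \<in> obj A'" "x' \<in> obj A'"
    have rx: "(ty A' x', cl A' B' \<psi> (star Q (ty A' x')) (Y x')) \<in> obj ?M'"
      using r[OF x(2)] by (simp add: r_def)
    have "Leq Q (ty A' x) (ty A' x') (qhom A' (x, x')) (qhom ?M' (r x, r x'))"
    proof -
      have "Leq D A' (star Q (ty A' x')) (Y x') (cl A' B' \<psi> (star Q (ty A' x')) (Y x'))"
        using Y[OF x(2)] by (intro D_le_clos) auto
      then have "Leq Q (ty A' x) (ty A' x') (qhom A' (x, x')) (cl A' B' \<psi> (star Q (ty A' x')) (Y x') (x, pt))"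
        using x by (auto simp: Leq_D_iff Y_def)
      then show ?thesis using rY[OF x(1) rx] by (simp add: r_def)
    qed
    moreover have "Leq Q (ty A' x) (ty A' x') (qhom ?M' (r x, r x')) (qhom ?M (F (r x), F (r x')))"
      using adjoint_unit_counit(3)[OF Mq F' G' hom r(1)[OF x(1)] r(1)[OF x(2)]] x by (simp add: r(2))
    moreover have "qhom ?M (F (r x), F (r x')) = qhom (PSh A) ((ty A' x, z x), (ty A' x', z x'))"
      using x F'[OF r(1)] z(1) by (metis M_qhom)
    moreover have "qhom ?M' (r x, r x') \<in> Hom Q (ty A' x) (ty A' x')"
      using qhom_hom[OF Mq(1) r(1)[OF x(1)] r(1)[OF x(2)]] x by (simp add: r(2))
    ultimately show "Leq Q (ty A' x) (ty A' x') (qhom A' (x, x'))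
        (qhom (PSh A) ((ty A' x, z x), (ty A' x', z x')))"
      using x z presheaf_hom(1)[OF ob(1), of "ty A' x" "z x" "ty A' x'" "z x'"]
        Leq_trans[of "ty A' x" "ty A' x'" "qhom A' (x, x')" "qhom ?M' (r x, r x')"
          "qhom (PSh A) ((ty A' x, z x), (ty A' x', z x'))"]
      by (simp add: Dty_ob Dqhom_hom)
  qed auto
  define c where "c y = (ty B y, col A \<phi> y)" for y
  have c: "c y \<in> obj ?M" "ty ?M (c y) = ty B y" if "y \<in> obj B" for y
  proof -
    show *: "c y \<in> obj ?M" unfolding c_def M_obj_iff
      using that col_cl[of A B B \<phi> \<phi> y] by (auto simp: Dty_ob D_clos_self)
    show "ty ?M (c y) = ty B y" using * by (simp add: c_def M_ty_pair)
  qed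
  define g where "g y = snd (G (c y))" for y
  have g: "G (c y) = (ty B y, g y)" "g y \<in> Hom D A' (star Q (ty B y))" "cl A' B' \<psi> (star Q (ty B y)) (g y) = g y"
    if "y \<in> obj B" for y
    using pair'[of "G (c y)"] G'[of "c y"] c[OF that] by (auto simp: g_def)
  let ?\<theta> = "limp D A A' B \<phi> \<zeta>"
  have \<theta>: "?\<theta> \<in> Hom D A' B" using \<zeta>(1) by (auto intro: D_limp_hom)
  have col\<theta>: "col A' ?\<theta> y = g y" if y: "y \<in> obj B" for y
  proof (rule presheaf_eqI[of A' "ty B y"])
    fix x assume x: "x \<in> obj A'"
    have "?\<theta> (x, y) = limp D A (star Q (ty A' x)) B \<phi> (z x) (pt, y)"
      using x y \<zeta> limp_col[of A A' B \<zeta> \<phi> x y] by simp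
    also have "\<dots> = limp D A (star Q (ty A' x)) (star Q (ty B y)) (col A \<phi> y) (z x) (pt, pt)"
      using x y z(2)[OF x] limp_to_col[of A "star Q (ty A' x)" B "z x" \<phi> pt y] by (simp add: Dty_ob)
    also have "\<dots> = qhom (PSh A) ((ty A' x, z x), c y)"
      using x y z(2)[OF x] by (simp add: c_def presheaves_simps Dty_ob)
    also have "\<dots> = qhom ?M (F (r x), c y)"
      using x y z(1)[OF x] c(1)[OF y] F'[OF r(1)[OF x]] by (simp add: M_qhom)
    also have "\<dots> = qhom ?M' (r x, G (c y))" using x y r c by (simp add: hom)
    also have "\<dots> = g y (x, pt)" using x y rY[OF x, of "ty B y" "g y"] G'[OF c(1)[OF y]] g(1)[OF y] by simp
    finally show "col A' ?\<theta> y (x, pt) = g y (x, pt)" using x by simp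
  qed (use y \<theta> g in \<open>auto simp: Dty_ob\<close>)
  \<comment> \<open>With this choice, \<open>\<eta> \<searrow> \<psi>\<close> is the closure of the diagonal.\<close>
  define \<eta> where "\<eta> = limp D A' B B' \<psi> ?\<theta>"
  have \<eta>: "\<eta> \<in> Hom D B B'" using \<theta> by (auto simp: \<eta>_def intro: D_limp_hom)
  have chu: "?\<theta> = rimp D A' B B' \<eta> \<psi>"
  proof (rule dist_eqI[of A' B])
    have cl\<theta>: "cl A' B' \<psi> B ?\<theta> = rimp D A' B B' \<eta> \<psi>" by (simp add: cl_def \<eta>_def)
    fix x y assume x: "x \<in> obj A'" and y: "y \<in> obj B"
    have "col A' (cl A' B' \<psi> B ?\<theta>) y = col A' ?\<theta> y"
      using y \<theta> g by (simp add: col_cl col\<theta>)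
    from fun_cong[OF this, of "(x, pt)"] show "?\<theta> (x, y) = rimp D A' B B' \<eta> \<psi> (x, y)"
      using x by (simp add: cl\<theta>)
  qed (use \<theta> \<eta> in \<open>auto intro: D_rimp_hom\<close>)
  have "M_arr \<kappa> Q (A', B', \<psi>) (A, B, \<phi>) (\<zeta>, \<eta>) = F"
  proof (rule extensionalityI[OF M_arr_ext])
    show "F \<in> extensional (obj ?M')" using FG(1) by (auto simp: PiE_def)
    fix p assume p: "p \<in> obj ?M'"
    obtain X m where eq: "p = (X, m)" by fastforce
    have X: "X \<in> Ob Q" "m \<in> Hom D A' (star Q X)" using p eq by (auto simp: M_obj_iff)
    obtain f where f: "F p = (X, f)" "f \<in> Hom D A (star Q X)" "cl A B \<phi> (star Q X) f = f"
      using F'[OF p] pair[of "F p"] p eq by (auto simp: M_ty_pair)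
    have "limp D A (star Q X) B \<phi> (Comp D A A' (star Q X) m \<zeta>) = limp D A' (star Q X) B ?\<theta> m"
      using X \<zeta> by (simp add: D_limp_comp)
    also have "\<dots> = limp D A (star Q X) B \<phi> f"
    proof (rule dist_eqI[of "star Q X" B])
      fix x y assume x: "x \<in> obj (star Q X :: ('x, 'o, 'a) qcat)" and y: "y \<in> obj B"
      have x: "x = pt" using x by simp
      have "limp D A' (star Q X) B ?\<theta> m (pt, y) = limp D A' (star Q X) (star Q (ty B y)) (g y) m (pt, pt)"
        using X y \<theta> limp_to_col[of A' "star Q X" B m ?\<theta> pt y] by (simp add: col\<theta>)
      also have "\<dots> = qhom ?M' (p, G (c y))"
        using p X g(1,2)[OF y] G'[OF c(1)[OF y]] y by (simp add: eq M_qhom presheaves_simps Dty_ob)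
      also have "\<dots> = qhom ?M (F p, c y)" using p c[OF y] by (simp add: hom)
      also have "\<dots> = limp D A (star Q X) (star Q (ty B y)) (col A \<phi> y) f (pt, pt)"
        using F'[OF p] c(1)[OF y] X y f by (simp add: M_qhom c_def presheaves_simps Dty_ob)
      also have "\<dots> = limp D A (star Q X) B \<phi> f (pt, y)"
        using X y f limp_to_col[of A "star Q X" B f \<phi> pt y] by simp
      finally show "limp D A' (star Q X) B ?\<theta> m (x, y) = limp D A (star Q X) B \<phi> f (x, y)"
        by (simp add: x)
    qed (use X \<theta> f in \<open>auto intro: D_limp_hom\<close>)
    finally have "cl A B \<phi> (star Q X) (Comp D A A' (star Q X) m \<zeta>) = cl A B \<phi> (star Q X) f"
      using X f \<zeta> by (subst D_clos_eq_iff) (auto intro: Comp_D_hom)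
    then show "M_arr \<kappa> Q (A', B', \<psi>) (A, B, \<phi>) (\<zeta>, \<eta>) p = F p"
      using p f by (simp add: eq M_arr_apply)
  qed
  then show ?thesis using \<zeta>(1) \<eta> chu by blast
qed

end

section \<open>The equivalence\<close>

text \<open>
  Transport of a map along the bijections \<open>h\<close> and \<open>k\<close> of its domain \<open>S\<close> and its codomain.
\<close>

definition conj_map :: "('x \<Rightarrow> 'y) \<Rightarrow> ('w \<Rightarrow> 'z) \<Rightarrow> 'x set \<Rightarrow> ('x \<Rightarrow> 'w) \<Rightarrow> 'y \<Rightarrow> 'z" where
  "conj_map h k S F = (\<lambda>y\<in>h ` S. k (F (inv_into S h y)))"

lemma conj_map_apply: "inj_on h S \<Longrightarrow> x \<in> S \<Longrightarrow> conj_map h k S F (h x) = k (F x)"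
  by (simp add: conj_map_def)

context universe
begin

abbreviation Bop :: "(('x, 'o, 'a) dist, (('x \<times> 'x \<Rightarrow> 'a) \<times> ('x \<times> 'x \<Rightarrow> 'a)) set) quant" where
  "Bop \<equiv> op_quant (back_diagonals D)"

lemma quantaloid_Bop: "quantaloid Bop"
  by (intro quantaloid_op_quant quantaloid.quantaloid_back_diagonals quantaloid_QDist)

abbreviation bcls :: "('x, 'o, 'a) dist \<Rightarrow> ('x, 'o, 'a) dist \<Rightarrow>
    ('x \<times> 'x \<Rightarrow> 'a) \<times> ('x \<times> 'x \<Rightarrow> 'a) \<Rightarrow> (('x \<times> 'x \<Rightarrow> 'a) \<times> ('x \<times> 'x \<Rightarrow> 'a)) set" where
  "bcls \<equiv> ordered_congruence.cls (back_cong D)"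

lemmas D_ordered_congruence = quantaloid.ordered_congruence_back[OF quantaloid_QDist]

lemmas back_B = ordered_congruence.Ob_B[OF D_ordered_congruence, folded back_diagonals_def]
  ordered_congruence.Hom_B[OF D_ordered_congruence, folded back_diagonals_def]
  ordered_congruence.Ident_B[OF D_ordered_congruence, folded back_diagonals_def]
  ordered_congruence.Comp_B[OF D_ordered_congruence, folded back_diagonals_def]
  ordered_congruence.Leq_B[OF D_ordered_congruence, folded back_diagonals_def]

lemma M_arr_chu:
  fixes \<phi> \<psi> :: "('x, 'o, 'a) dist"
  assumes "\<phi> \<in> arrows D" "\<psi> \<in> arrows D" "c \<in> Hom (ChuCon D) \<phi> \<psi>"
  shows "M_arr \<kappa> Q \<psi> \<phi> c \<in> Hom (QCCat \<kappa> Q) (M \<psi>) (M \<phi>)"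
    and "c' \<in> Hom (ChuCon D) \<phi> \<psi> \<Longrightarrow>
      qfunctor_le Q (M \<psi>) (M \<phi>) (M_arr \<kappa> Q \<psi> \<phi> c) (M_arr \<kappa> Q \<psi> \<phi> c') \<longleftrightarrow> quantaloid.back_le D \<phi> \<psi> c c'"
proof -
  obtain A B f A' B' g \<zeta> \<eta> \<zeta>' \<eta>' where eq: "\<phi> = (A, B, f)" "\<psi> = (A', B', g)" "c = (\<zeta>, \<eta>)" "c' = (\<zeta>', \<eta>')"
    by (metis surj_pair)
  show "M_arr \<kappa> Q \<psi> \<phi> c \<in> Hom (QCCat \<kappa> Q) (M \<psi>) (M \<phi>)"
    using assms unfolding eq D_arrows_iff D_ChuCon_simps by (auto intro!: M_arr_hom)
  show "qfunctor_le Q (M \<psi>) (M \<phi>) (M_arr \<kappa> Q \<psi> \<phi> c) (M_arr \<kappa> Q \<psi> \<phi> c') \<longleftrightarrow> quantaloid.back_le D \<phi> \<psi> c c'"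
    if "c' \<in> Hom (ChuCon D) \<phi> \<psi>"
    using assms that unfolding eq D_arrows_iff D_ChuCon_simps quantaloid.back_le_iff[OF quantaloid_QDist]
    by (auto simp: M_arr_le_iff)
qed

lemma M_dist_QCCat: "\<phi> \<in> arrows D \<Longrightarrow> M \<phi> \<in> Ob (QCCat \<kappa> Q)"
  by (cases \<phi>) (auto simp: D_arrows_iff intro: M_ob_QCCat)

text \<open>
  Equivalent Chu connections induce functors that are below each other, and these are equal because
  the categories of fixed points are skeletal.
\<close>

lemma Mb_arr_cls:
  fixes \<phi> \<psi> :: "('x, 'o, 'a) dist"
  assumes \<phi>: "\<phi> \<in> arrows D" and \<psi>: "\<psi> \<in> arrows D" and c: "c \<in> Hom (ChuCon D) \<phi> \<psi>"
  shows "Mb_arr \<kappa> Q \<psi> \<phi> (bcls \<phi> \<psi> c) = M_arr \<kappa> Q \<psi> \<phi> c"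
proof -
  note ob = \<phi> \<psi>
  have "\<phi> \<in> Ob (ChuCon D)" "\<psi> \<in> Ob (ChuCon D)" using ob by (simp_all add: D_ChuCon_simps)
  note cls = ordered_congruence.mem_cls_iff[OF D_ordered_congruence this c]
    ordered_congruence.cls_self[OF D_ordered_congruence this c]
  have "M_arr \<kappa> Q \<psi> \<phi> d = M_arr \<kappa> Q \<psi> \<phi> c" if "d \<in> bcls \<phi> \<psi> c" for d
  proof -
    have d: "d \<in> Hom (ChuCon D) \<phi> \<psi>" "quantaloid.back_le D \<phi> \<psi> c d" "quantaloid.back_le D \<phi> \<psi> d c"
      using that cls(1) by auto
    show ?thesis
      by (rule ordered_category.Leq_antisym[OF ordered_category_QCCat, of "M \<psi>" "M \<phi>"])
        (simp_all add: QCCat_simps(4) d c M_dist_QCCat ob M_arr_chu(1)[OF ob c] M_arr_chu(1)[OF ob d(1)]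
          M_arr_chu(2)[OF ob c d(1)] M_arr_chu(2)[OF ob d(1) c])
  qed
  then have "M_arr \<kappa> Q \<psi> \<phi> ` bcls \<phi> \<psi> c = (\<lambda>_. M_arr \<kappa> Q \<psi> \<phi> c) ` bcls \<phi> \<psi> c"
    by (rule image_cong[OF refl])
  then have "M_arr \<kappa> Q \<psi> \<phi> ` bcls \<phi> \<psi> c = {M_arr \<kappa> Q \<psi> \<phi> c}"
    unfolding image_constant[OF cls(2)] .
  then show ?thesis by (simp add: Mb_arr_def)
qed

lemma Mb_order_fully_faithful:
  "order_fully_faithful (Bop :: (('x, 'o, 'a) dist, _) quant) (QCCat \<kappa> Q) M (Mb_arr \<kappa> Q)"
proof -
  have Hom_eq: "Mb_arr \<kappa> Q \<psi> \<phi> ` Hom (back_diagonals D) \<phi> \<psi> = Hom (QCCat \<kappa> Q) (M \<psi>) (M \<phi>)"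
    if ob: "\<phi> \<in> arrows D" "\<psi> \<in> arrows D" for \<phi> \<psi> :: "('x, 'o, 'a) dist"
  proof -
    have "Mb_arr \<kappa> Q \<psi> \<phi> ` Hom (back_diagonals D) \<phi> \<psi> = M_arr \<kappa> Q \<psi> \<phi> ` Hom (ChuCon D) \<phi> \<psi>"
      unfolding back_B(2) image_image using ob by (auto simp: Mb_arr_cls)
    also have "\<dots> = Hom (QCCat \<kappa> Q) (M \<psi>) (M \<phi>)"
    proof (intro equalityI subsetI)
      fix F assume F: "F \<in> Hom (QCCat \<kappa> Q) (M \<psi>) (M \<phi>)"
      obtain A B f A' B' g where eq: "\<phi> = (A, B, f)" "\<psi> = (A', B', g)" by (metis surj_pair)
      from M_arr_full[of A B A' B' f g F] obtain \<zeta> \<eta> where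
        "\<zeta> \<in> Hom D A A'" "\<eta> \<in> Hom D B B'" "limp D A A' B f \<zeta> = rimp D A' B B' \<eta> g"
        "M_arr \<kappa> Q \<psi> \<phi> (\<zeta>, \<eta>) = F"
        using ob F unfolding eq D_arrows_iff by blast
      then show "F \<in> M_arr \<kappa> Q \<psi> \<phi> ` Hom (ChuCon D) \<phi> \<psi>"
        unfolding eq D_ChuCon_simps by (intro image_eqI[of _ _ "(\<zeta>, \<eta>)"]) auto
    qed (use ob in \<open>auto intro: M_arr_chu(1)\<close>)
    finally show ?thesis .
  qed
  have Leq: "Leq (QCCat \<kappa> Q) (M \<psi>) (M \<phi>) (Mb_arr \<kappa> Q \<psi> \<phi> c) (Mb_arr \<kappa> Q \<psi> \<phi> d) \<longleftrightarrow>
      Leq (back_diagonals D) \<phi> \<psi> c d"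
    if ob: "\<phi> \<in> arrows D" "\<psi> \<in> arrows D" and c: "c \<in> Hom (back_diagonals D) \<phi> \<psi>" "d \<in> Hom (back_diagonals D) \<phi> \<psi>"
    for \<phi> \<psi> :: "('x, 'o, 'a) dist" and c d
  proof -
    from c obtain c' d' where "c' \<in> Hom (ChuCon D) \<phi> \<psi>" "c = bcls \<phi> \<psi> c'"
      "d' \<in> Hom (ChuCon D) \<phi> \<psi>" "d = bcls \<phi> \<psi> d'" unfolding back_B(2) by blast
    then show ?thesis
      using ob by (simp add: Mb_arr_cls QCCat_simps(4) M_arr_chu(2) back_B(5) D_ChuCon_simps(1))
  qed
  have Ident: "Mb_arr \<kappa> Q \<phi> \<phi> (Ident (back_diagonals D) \<phi>) = Ident (QCCat \<kappa> Q) (M \<phi>)"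
    if \<phi>: "\<phi> \<in> arrows D" for \<phi> :: "('x, 'o, 'a) dist"
  proof -
    obtain A B f where eq: "\<phi> = (A, B, f)" by (metis surj_pair)
    have "Ident (ChuCon D) \<phi> \<in> Hom (ChuCon D) \<phi> \<phi>"
      using \<phi> by (intro ordered_category.Ident_hom[OF quantaloid.ordered_category_ChuCon[OF quantaloid_QDist]])
        (simp add: D_ChuCon_simps)
    then have "Mb_arr \<kappa> Q \<phi> \<phi> (Ident (back_diagonals D) \<phi>) = M_arr \<kappa> Q \<phi> \<phi> (Ident (ChuCon D) \<phi>)"
      using \<phi> by (simp add: back_B(3) Mb_arr_cls)
    then show ?thesis
      using \<phi> by (simp add: eq D_ChuCon_simps QDist_simps(3) M_arr_ident D_arrows_iff QCCat_simps)
  qed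
  have Comp: "Mb_arr \<kappa> Q \<chi> \<phi> (Comp (back_diagonals D) \<phi> \<psi> \<chi> d c) =
      Comp (QCCat \<kappa> Q) (M \<chi>) (M \<psi>) (M \<phi>) (Mb_arr \<kappa> Q \<psi> \<phi> c) (Mb_arr \<kappa> Q \<chi> \<psi> d)"
    if ob: "\<phi> \<in> arrows D" "\<psi> \<in> arrows D" "\<chi> \<in> arrows D"
      and c: "c \<in> Hom (back_diagonals D) \<phi> \<psi>" "d \<in> Hom (back_diagonals D) \<psi> \<chi>"
    for \<phi> \<psi> \<chi> :: "('x, 'o, 'a) dist" and c d
  proof -
    from c obtain c' d' where cd: "c' \<in> Hom (ChuCon D) \<phi> \<psi>" "c = bcls \<phi> \<psi> c'"
      "d' \<in> Hom (ChuCon D) \<psi> \<chi>" "d = bcls \<psi> \<chi> d'" unfolding back_B(2) by blast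
    have "Comp (ChuCon D) \<phi> \<psi> \<chi> d' c' \<in> Hom (ChuCon D) \<phi> \<chi>"
      using ob cd by (intro ordered_category.Comp_hom[OF quantaloid.ordered_category_ChuCon[OF quantaloid_QDist]])
        (simp_all add: D_ChuCon_simps(1))
    then have 1: "Mb_arr \<kappa> Q \<chi> \<phi> (Comp (back_diagonals D) \<phi> \<psi> \<chi> d c) = M_arr \<kappa> Q \<chi> \<phi> (Comp (ChuCon D) \<phi> \<psi> \<chi> d' c')"
      using ob cd by (simp add: back_B(4) Mb_arr_cls D_ChuCon_simps(1))
    obtain A B f A' B' g A'' B'' h \<zeta> \<eta> \<zeta>' \<eta>' where eq: "\<phi> = (A, B, f)" "\<psi> = (A', B', g)" "\<chi> = (A'', B'', h)"
      "c' = (\<zeta>, \<eta>)" "d' = (\<zeta>', \<eta>')" by (metis surj_pair)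
    have "M_arr \<kappa> Q \<chi> \<phi> (Comp (ChuCon D) \<phi> \<psi> \<chi> d' c') =
        compose (obj (M \<chi>)) (M_arr \<kappa> Q \<psi> \<phi> c') (M_arr \<kappa> Q \<chi> \<psi> d')"
      using ob cd(1,3) unfolding eq D_arrows_iff D_ChuCon_simps by (auto intro!: M_arr_comp)
    then show ?thesis using 1 ob cd by (simp add: Mb_arr_cls QCCat_simps)
  qed
  have Hom_in: "Mb_arr \<kappa> Q \<psi> \<phi> c \<in> Hom (QCCat \<kappa> Q) (M \<psi>) (M \<phi>)"
    if "\<phi> \<in> arrows D" "\<psi> \<in> arrows D" "c \<in> Hom (back_diagonals D) \<phi> \<psi>"
    for \<phi> \<psi> :: "('x, 'o, 'a) dist" and c
    using Hom_eq[OF that(1,2)] that(3) by blast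
  have ObB: "Ob (back_diagonals D) = arrows D" by (simp add: back_B D_ChuCon_simps)
  show ?thesis
    unfolding order_fully_faithful_def is_functor_def op_quant_simps ObB
    by (intro conjI ballI funcsetI) (simp_all add: Hom_in Hom_eq Leq Ident Comp M_dist_QCCat)
qed

lemma conj_map_hom:
  assumes ob: "A \<in> Ob D" "B \<in> Ob D" "A' \<in> Ob D" "B' \<in> Ob D" and h: "qiso A A' h" and k: "qiso B B' k"
    and F: "F \<in> Hom (QCCat \<kappa> Q) A B"
  shows "conj_map h k (obj A) F \<in> Hom (QCCat \<kappa> Q) A' B'"
proof -
  note hD = qisoD[OF h] and kD = qisoD[OF k]
  from F obtain G where FG: "F \<in> obj A \<rightarrow>\<^sub>E obj B" "\<forall>x\<in>obj A. ty B (F x) = ty A x"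
    "\<forall>y\<in>obj B. G y \<in> obj A \<and> ty A (G y) = ty B y"
    "\<forall>x\<in>obj A. \<forall>y\<in>obj B. qhom B (F x, y) = qhom A (x, G y)"
    unfolding QCCat_Hom_iff[OF ob(1,2)] by blast
  have Fx: "x \<in> obj A \<Longrightarrow> F x \<in> obj B" for x using FG(1) by auto
  show ?thesis
    unfolding QCCat_Hom_iff[OF ob(3,4)]
  proof (intro conjI ballI exI[of _ "h \<circ> G \<circ> inv_into (obj B) k"])
    show "conj_map h k (obj A) F \<in> obj A' \<rightarrow>\<^sub>E obj B'"
      using hD kD Fx by (auto simp: conj_map_def)
  qed (use hD kD Fx FG in \<open>auto simp: conj_map_apply\<close>)
qed

text \<open>
  Replacing the values of a functor by isomorphic copies over another carrier type.
\<close>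

lemma transport_order_fully_faithful:
  fixes Fo :: "'p \<Rightarrow> ('x, 'o, 'a) qcat" and b :: "'p \<Rightarrow> 'x \<Rightarrow> 'y"
  assumes F: "order_fully_faithful C (QCCat \<kappa> Q) Fo Fa"
    and C: "\<And>X Y Z f g. \<lbrakk>X \<in> Ob C; Y \<in> Ob C; Z \<in> Ob C; f \<in> Hom C X Y; g \<in> Hom C Y Z\<rbrakk>
      \<Longrightarrow> Comp C X Y Z g f \<in> Hom C X Z" "\<And>X. X \<in> Ob C \<Longrightarrow> Ident C X \<in> Hom C X X"
    and b: "\<And>X. X \<in> Ob C \<Longrightarrow> inj_on (b X) (obj (Fo X))"
  shows "order_fully_faithful C (QCCat \<kappa> Q) (\<lambda>X. qcopy (b X) (Fo X))
    (\<lambda>X Y f. conj_map (b X) (b Y) (obj (Fo X)) (Fa X Y f))"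
proof -
  note F' = F[unfolded order_fully_faithful_def is_functor_def]
  let ?Go = "\<lambda>X. qcopy (b X) (Fo X)"
  let ?Ga = "\<lambda>X Y f. conj_map (b X) (b Y) (obj (Fo X)) (Fa X Y f)"
  have Fo: "Fo X \<in> Ob (QCCat \<kappa> Q)" "?Go X \<in> Ob (QCCat \<kappa> Q)" if "X \<in> Ob C" for X
    using F' b that qcopy_QCCat by auto
  then have FoD: "Fo X \<in> Ob D" "?Go X \<in> Ob D" if "X \<in> Ob C" for X
    using that by (auto simp: QCCat_simps)
  have iso: "qiso (Fo X) (?Go X) (b X)" if "X \<in> Ob C" for X using b that by (intro qiso_qcopy)
  have objGo: "obj (?Go X) = b X ` obj (Fo X)" if "X \<in> Ob C" for X using qisoD(4)[OF iso[OF that]] .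
  have Fa: "Fa X Y f \<in> Hom (QCCat \<kappa> Q) (Fo X) (Fo Y)" if "X \<in> Ob C" "Y \<in> Ob C" "f \<in> Hom C X Y" for X Y f
    using F' that by blast
  have Fax: "Fa X Y f x \<in> obj (Fo Y)" if "X \<in> Ob C" "Y \<in> Ob C" "f \<in> Hom C X Y" "x \<in> obj (Fo X)" for X Y f x
    using Fa[OF that(1-3)] that unfolding QCCat_Hom_iff[OF FoD(1)[OF that(1)] FoD(1)[OF that(2)]] by auto
  have Ga: "?Ga X Y f \<in> Hom (QCCat \<kappa> Q) (?Go X) (?Go Y)" if "X \<in> Ob C" "Y \<in> Ob C" "f \<in> Hom C X Y" for X Y f
    using that by (intro conj_map_hom[of "Fo X" "Fo Y"] FoD iso Fa)
  have surj: "h \<in> ?Ga X Y ` Hom C X Y"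
    if X: "X \<in> Ob C" "Y \<in> Ob C" and h: "h \<in> Hom (QCCat \<kappa> Q) (?Go X) (?Go Y)" for X Y h
  proof -
    let ?g = "conj_map (inv_into (obj (Fo X)) (b X)) (inv_into (obj (Fo Y)) (b Y)) (obj (?Go X)) h"
    have "?g \<in> Hom (QCCat \<kappa> Q) (Fo X) (Fo Y)"
      using X h by (intro conj_map_hom[of "?Go X" "?Go Y"] FoD qiso_inv[OF iso])
    moreover have "Fa X Y ` Hom C X Y = Hom (QCCat \<kappa> Q) (Fo X) (Fo Y)" using F' X by blast
    ultimately have "?g \<in> Fa X Y ` Hom C X Y" by simp
    then obtain f where f: "f \<in> Hom C X Y" "Fa X Y f = ?g" by (metis imageE)
    have hE: "h \<in> obj (?Go X) \<rightarrow>\<^sub>E obj (?Go Y)"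
      using h unfolding QCCat_Hom_iff[OF FoD(2)[OF X(1)] FoD(2)[OF X(2)]] by blast
    have "?Ga X Y f = h"
    proof (rule extensionalityI[of _ "obj (?Go X)"])
      show "?Ga X Y f \<in> extensional (obj (?Go X))" using X by (simp add: conj_map_def objGo)
      show "h \<in> extensional (obj (?Go X))" using hE by (auto simp: PiE_def)
      fix y assume y: "y \<in> obj (?Go X)"
      then obtain x where x: "x \<in> obj (Fo X)" "y = b X x" using X objGo by auto
      have "inj_on (inv_into (obj (Fo X)) (b X)) (obj (?Go X))"
        using X b by (simp add: objGo inj_on_inv_into)
      from conj_map_apply[OF this y, of "inv_into (obj (Fo Y)) (b Y)" h]
      have "?g x = inv_into (obj (Fo Y)) (b Y) (h y)" using x b X by simp
      moreover have "h y \<in> b Y ` obj (Fo Y)" using hE y X objGo by auto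
      ultimately show "?Ga X Y f y = h y"
        using x b X f(2) by (simp add: conj_map_apply f_inv_into_f)
    qed
    then show ?thesis using f(1) by blast
  qed
  have Leq: "Leq (QCCat \<kappa> Q) (?Go X) (?Go Y) (?Ga X Y f) (?Ga X Y g) \<longleftrightarrow> Leq C X Y f g"
    if X: "X \<in> Ob C" "Y \<in> Ob C" and f: "f \<in> Hom C X Y" "g \<in> Hom C X Y" for X Y f g
  proof -
    have "under_le Q (?Go Y) (b Y y) (b Y y') \<longleftrightarrow> under_le Q (Fo Y) y y'" if "y \<in> obj (Fo Y)" "y' \<in> obj (Fo Y)" for y y'
      using qisoD(2,3)[OF iso[OF X(2)]] that by (simp add: under_le_def)
    then have "Leq (QCCat \<kappa> Q) (?Go X) (?Go Y) (?Ga X Y f) (?Ga X Y g) \<longleftrightarrow>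
      Leq (QCCat \<kappa> Q) (Fo X) (Fo Y) (Fa X Y f) (Fa X Y g)"
      using X f b Fax by (simp add: QCCat_simps(4) qfunctor_le_def objGo conj_map_apply)
    then show ?thesis using F' X f by blast
  qed
  have Ident: "?Ga X X (Ident C X) = Ident (QCCat \<kappa> Q) (?Go X)" if X: "X \<in> Ob C" for X
  proof -
    have "Fa X X (Ident C X) = (\<lambda>x\<in>obj (Fo X). x)" using F' X by (simp add: QCCat_simps)
    then show ?thesis using X b by (auto simp: QCCat_simps conj_map_def objGo fun_eq_iff)
  qed
  have Comp: "?Ga X Z (Comp C X Y Z g f) = Comp (QCCat \<kappa> Q) (?Go X) (?Go Y) (?Go Z) (?Ga Y Z g) (?Ga X Y f)"
    if X: "X \<in> Ob C" "Y \<in> Ob C" "Z \<in> Ob C" and f: "f \<in> Hom C X Y" "g \<in> Hom C Y Z" for X Y Z f g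
  proof -
    have "Fa X Z (Comp C X Y Z g f) = compose (obj (Fo X)) (Fa Y Z g) (Fa X Y f)"
      using F' X f by (simp add: QCCat_simps)
    then show ?thesis using X f b Fax
      by (auto simp: QCCat_simps fun_eq_iff compose_def objGo conj_map_apply) (auto simp: conj_map_def)
  qed
  show ?thesis
    unfolding order_fully_faithful_def is_functor_def
  proof (intro conjI ballI)
    fix X Y assume X: "X \<in> Ob C" "Y \<in> Ob C"
    then show "?Ga X Y ` Hom C X Y = Hom (QCCat \<kappa> Q) (?Go X) (?Go Y)" using Ga surj by blast
  qed (use Fo Ga Leq Ident Comp in auto)
qed

text \<open>
  Representables are closed since they are the columns of the identity distributor, which is fixed
  by its own closure. Conversely let \<open>\<mu>\<close> be a closed presheaf with supremum \<open>s\<close>. The defining property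
  of \<open>s\<close> says that \<open>\<mu>\<close> and the presheaf represented by \<open>s\<close> have the same image under \<open>E \<swarrow> _\<close>, and closed
  presheaves are determined by this image.
\<close>

lemma yoneda_qiso:
  fixes E :: "('x, 'o, 'a) qcat"
  assumes E: "E \<in> Ob (QCCat \<kappa> Q)"
  shows "qiso E (M (E, E, qhom E)) (yoneda E)"
proof -
  let ?M = "M (E, E, qhom E)"
  have ED [simp]: "E \<in> Ob D" and sk: "skeletal Q E" and co: "qcomplete \<kappa> Q E"
    using E by (auto simp: QCCat_simps)
  have qE: "qcategory Q E" using ED by (simp add: QDist_simps)
  have qD [simp]: "qhom E \<in> Hom D E E" by (simp add: qhom_D)
  have mem: "yoneda E x \<in> obj ?M" if "x \<in> obj E" for x
    using that col_cl[of E E E "qhom E" "qhom E" x] by (simp add: yoneda_eq M_obj_iff Dty_ob D_clos_self)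
  have ty: "ty ?M (yoneda E x) = ty E x" if "x \<in> obj E" for x
    using mem[OF that] that by (simp add: yoneda_eq M_ty_pair)
  have hom: "qhom ?M (yoneda E x, yoneda E y) = qhom E (x, y)" if "x \<in> obj E" "y \<in> obj E" for x y
    using mem that yoneda_lemma[of E "ty E y" "col E (qhom E) y" x]
    by (simp add: M_qhom) (simp add: yoneda_eq Dty_ob)
  have inj: "inj_on (yoneda E) (obj E)"
  proof (rule inj_onI)
    fix x y assume xy: "x \<in> obj E" "y \<in> obj E" "yoneda E x = yoneda E y"
    have t: "ty E x = ty E y" using xy by (simp add: yoneda_eq)
    have "qhom E (x, y) = qhom E (x, x)" "qhom E (y, x) = qhom E (y, y)"
      using hom xy by metis+
    then have "under_le Q E x y" "under_le Q E y x"
      using xy t qhom_ident[OF qE, of x] qhom_ident[OF qE, of y] by (auto simp: under_le_def)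
    then show "x = y" using sk xy by (auto simp: skeletal_def)
  qed
  have "p \<in> yoneda E ` obj E" if p: "p \<in> obj ?M" for p
  proof -
    obtain X \<mu> where eq: "p = (X, \<mu>)" by fastforce
    have X: "X \<in> Ob Q" "\<mu> \<in> Hom D E (star Q X)" "cl E E (qhom E) (star Q X) \<mu> = \<mu>"
      using p by (auto simp: eq M_obj_iff)
    obtain S where S: "qadjoint Q (PSh E) E S (yoneda E)" using co by (auto simp: qcomplete_def)
    have pP: "p \<in> obj (PSh E)" using X by (simp add: eq presheaves_simps)
    let ?s = "S p"
    have s: "?s \<in> obj E" "ty E ?s = X" "\<And>y. y \<in> obj E \<Longrightarrow> qhom E (?s, y) = qhom (PSh E) (p, yoneda E y)"
      using S pP X unfolding qadjoint_iff[OF qcategory_presheaves[OF ED] qE]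
      by (auto simp: eq presheaves_simps)
    have Y: "col E (qhom E) ?s \<in> Hom D E (star Q X)" using s(1,2) col_hom[of E E "qhom E" ?s] by simp
    have "limp D E (star Q X) E (qhom E) \<mu> = limp D E (star Q X) E (qhom E) (col E (qhom E) ?s)"
    proof (rule dist_eqI[of "star Q X" E])
      fix x y assume "x \<in> obj (star Q X :: ('x, 'o, 'a) qcat)" and y: "y \<in> obj E"
      then have x: "x = pt" by simp
      have "limp D E (star Q X) E (qhom E) \<mu> (pt, y) = qhom (PSh E) (p, yoneda E y)"
        using X y limp_to_col[of E "star Q X" E \<mu> "qhom E" pt y]
        by (simp add: eq yoneda_eq presheaves_simps Dty_ob)
      also have "\<dots> = qhom E (?s, y)" using s y by simp
      also have "\<dots> = limp D E (star Q X) E (qhom E) (col E (qhom E) ?s) (pt, y)"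
        using s y limp_col[of E E E "qhom E" "qhom E" ?s y] by (simp add: D_limp_ident)
      finally show "limp D E (star Q X) E (qhom E) \<mu> (x, y) =
        limp D E (star Q X) E (qhom E) (col E (qhom E) ?s) (x, y)" by (simp add: x)
    qed (use X Y in \<open>auto intro: D_limp_hom\<close>)
    then have "\<mu> = cl E E (qhom E) (star Q X) (col E (qhom E) ?s)"
      using X Y by (subst X(3)[symmetric], subst D_clos_eq_iff) auto
    also have "\<dots> = col E (qhom E) ?s"
      using s(1,2) col_cl[of E E E "qhom E" "qhom E" ?s] by (simp add: D_clos_self)
    finally have "p = yoneda E ?s" using s(1,2) by (simp add: eq yoneda_eq)
    then show ?thesis using s(1) by blast
  qed
  then show ?thesis
    using mem ty hom inj by (auto simp: qiso_def bij_betw_def)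
qed

text \<open>
  The category \<open>E\<close> may live over any carrier type, whereas distributors in the domain of \<open>\<M>\<^sub>b\<close> have carriers
  in the universe; hence the Yoneda embedding is applied to a copy of \<open>E\<close>.
\<close>

lemma M_essentially_surjective:
  fixes E :: "('y, 'o, 'a) qcat"
  assumes E: "E \<in> Ob (QCCat \<kappa> Q)"
  obtains \<phi> :: "('u, 'o, 'a) dist" and h where "\<phi> \<in> arrows D" "qiso (M \<phi>) E h"
proof -
  have "small \<kappa> (obj E)" using E by (simp add: QCCat_simps QDist_simps)
  then obtain h :: "'y \<Rightarrow> 'u" where h: "inj_on h (obj E)" by (rule small_inj)
  let ?E = "qcopy h E"
  have E': "?E \<in> Ob (QCCat \<kappa> Q)" by (rule qcopy_QCCat[OF E h])
  have "qiso E (M (?E, ?E, qhom ?E)) (yoneda ?E \<circ> h)"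
    by (rule qiso_comp[OF qiso_qcopy[OF h] yoneda_qiso[OF E']])
  moreover have "(?E, ?E, qhom ?E) \<in> arrows D"
    using E' by (auto simp: D_arrows_iff qhom_D QCCat_simps)
  ultimately show ?thesis using that qiso_inv by blast
qed

lemma Mb_equivalence:
  "quantaloid_equivalence (Bop :: (('u, 'o, 'a) dist, _) quant) (QCCat \<kappa> Q) M (Mb_arr \<kappa> Q)"
proof (rule order_equivalence.is_quantaloid_equivalence[OF order_equivalence.intro,
    OF quantaloid_Bop ordered_category_QCCat order_equivalence_axioms.intro, OF Mb_order_fully_faithful])
  fix E :: "(('u, 'o, 'a) presheaf, 'o, 'a) qcat" assume E: "E \<in> Ob (QCCat \<kappa> Q)"
  then obtain \<phi> :: "('u, 'o, 'a) dist" and h where \<phi>: "\<phi> \<in> arrows D" "qiso (M \<phi>) E h"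
    by (rule M_essentially_surjective)
  have "is_iso (QCCat \<kappa> Q) (M \<phi>) E (restrict h (obj (M \<phi>)))"
    using \<phi> E by (intro qiso_is_iso M_dist_QCCat)
  then show "\<exists>\<phi>\<in>Ob (Bop :: (('u, 'o, 'a) dist, _) quant). \<exists>e. is_iso (QCCat \<kappa> Q) (M \<phi>) E e"
    using \<phi>(1) by (auto simp: back_B D_ChuCon_simps)
qed

lemma dual_equivalence_small_carriers:
  "dually_equivalent (back_diagonals D :: (('u, 'o, 'a) dist, _) quant) (QCCat \<kappa> Q :: (('u, 'o, 'a) qcat, _) quant)"
proof -
  have Ob_Bop: "Ob (Bop :: (('u, 'o, 'a) dist, _) quant) = arrows D" by (simp add: back_B D_ChuCon_simps)
  define b :: "('u, 'o, 'a) dist \<Rightarrow> ('u, 'o, 'a) presheaf \<Rightarrow> 'u" where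
    "b \<phi> = (SOME h. inj_on h (obj (M \<phi>)))" for \<phi>
  have b: "inj_on (b \<phi>) (obj (M \<phi>))" if "\<phi> \<in> arrows D" for \<phi>
  proof -
    have "small \<kappa> (obj (M \<phi>))" using M_dist_QCCat[OF that] by (simp add: QCCat_simps QDist_simps)
    then have "\<exists>h :: _ \<Rightarrow> 'u. inj_on h (obj (M \<phi>))" using small_inj by blast
    then show ?thesis unfolding b_def by (rule someI_ex)
  qed
  interpret B: quantaloid "Bop :: (('u, 'o, 'a) dist, _) quant" by (rule quantaloid_Bop)
  let ?Fo = "\<lambda>\<phi>. qcopy (b \<phi>) (M \<phi>)"
  let ?Fa = "\<lambda>\<phi> \<psi> c. conj_map (b \<phi>) (b \<psi>) (obj (M \<phi>)) (Mb_arr \<kappa> Q \<phi> \<psi> c)"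
  have "order_fully_faithful (Bop :: (('u, 'o, 'a) dist, _) quant) (QCCat \<kappa> Q) ?Fo ?Fa"
    by (rule transport_order_fully_faithful[OF Mb_order_fully_faithful B.comp_in B.ident_in])
      (use b in \<open>simp_all only: Ob_Bop\<close>)
  then have "quantaloid_equivalence (Bop :: (('u, 'o, 'a) dist, _) quant) (QCCat \<kappa> Q) ?Fo ?Fa"
  proof (intro order_equivalence.is_quantaloid_equivalence order_equivalence.intro
      quantaloid_Bop ordered_category_QCCat order_equivalence_axioms.intro)
    fix E :: "('u, 'o, 'a) qcat" assume E: "E \<in> Ob (QCCat \<kappa> Q)"
    then obtain \<phi> :: "('u, 'o, 'a) dist" and h where \<phi>: "\<phi> \<in> arrows D" "qiso (M \<phi>) E h"
      by (rule M_essentially_surjective)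
    have "qiso (?Fo \<phi>) E (h \<circ> inv_into (obj (M \<phi>)) (b \<phi>))"
      by (rule qiso_comp[OF qiso_inv[OF qiso_qcopy[OF b[OF \<phi>(1)]]] \<phi>(2)])
    moreover have "?Fo \<phi> \<in> Ob (QCCat \<kappa> Q)" using \<phi> b by (intro qcopy_QCCat M_dist_QCCat)
    ultimately show "\<exists>\<phi>\<in>Ob (Bop :: (('u, 'o, 'a) dist, _) quant). \<exists>e. is_iso (QCCat \<kappa> Q) (?Fo \<phi>) E e"
      using E \<phi>(1) qiso_is_iso unfolding Ob_Bop by blast
  qed
  then show ?thesis unfolding dually_equivalent_def equivalent_quantaloids_def by blast
qed

end

theorem theorem3p3p5:
  fixes Q :: "('o, 'a) quant" and \<kappa> :: "'u rel"
  assumes universe: "\<kappa> = |UNIV :: 'u set|"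
    and strong_limit: "\<And>S :: 'u set. small \<kappa> S \<Longrightarrow> small \<kappa> (Pow S)"
    and Q: "small_quantaloid \<kappa> Q"
  shows "quantaloid_equivalence
           (op_quant (back_diagonals (QDist \<kappa> Q :: (('u, 'o, 'a) qcat, _) quant)))
           (QCCat \<kappa> Q) (M_ob \<kappa> Q) (Mb_arr \<kappa> Q)
       \<and> dually_equivalent
           (back_diagonals (QDist \<kappa> Q :: (('u, 'o, 'a) qcat, _) quant))
           (QCCat \<kappa> Q :: ((('u, 'o, 'a) presheaf, 'o, 'a) qcat, _) quant)
       \<and> dually_equivalent
           (back_diagonals (QDist \<kappa> Q :: (('u, 'o, 'a) qcat, _) quant))
           (QCCat \<kappa> Q :: (('u, 'o, 'a) qcat, _) quant)"
proof -
  interpret universe Q \<kappa> by unfold_locales (fact assms)+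
  show ?thesis
    using Mb_equivalence dual_equivalence_small_carriers
    unfolding dually_equivalent_def equivalent_quantaloids_def by blast
qed

end
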